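(* Let $s\ge 1$ be an integer and $c>0$ a real number. With the random matrices $U_r^{(N)},G_r^{(N)},W_r^{(M,N)}$ and the non-commutative random variables $U_r,G_r,W_r$ ($1\le r\le s$) described in the context, as $M,N\to\infty$ with $M/N\to c$ the families $(U_r^{(N)},G_r^{(N)})_{r=1}^s$ converge in $*$-distribution almost surely to $(U_r,G_r)_{r=1}^s$, and the families $(U_r^{(N)},W_r^{(M,N)})_{r=1}^s$ converge in $*$-distribution almost surely to $(U_r,W_r)_{r=1}^s$. That is, for every pair of strictly increasing sequences of positive integers $(M_q)_{q\ge1}$, $(N_q)_{q\ge1}$ with $\lim_{q\to\infty}M_q/N_q=c$, and for every monomial $\alpha$ in the elements $U_r,G_r$ ($1\le r\le s$) and their adjoints, or in the elements $U_r,W_r$ ($1\le r\le s$) and their adjoints, $$\lim_{q\to\infty}\mathrm{tr}^{(N_q)}\alpha^{(M_q,N_q)}=\varphi(\alpha)\quad\text{almost surely.}$$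
   Context: Random matrices. All random variables live on a fixed probability space $(\Omega,\mathcal F,P)$. A complex standard Gaussian is a complex random variable whose real and imaginary parts are independent real Gaussians of mean $0$ and variance $1/2$. Fix an independent family $(f_{r;i,j})_{1\le r\le s,\ i,j\ge1}$ of complex standard Gaussian random variables and let $G_r^{(M,N)}=[f_{r;i,j}]_{1\le i\le M,1\le j\le N}$ (a random $M\times N$ matrix), $G_r^{(N)}=\frac1{\sqrt N}G_r^{(N,N)}$, and $W_r^{(M,N)}=\frac1N (G_r^{(M,N)})^*G_r^{(M,N)}$ (a complex Wishart matrix, of size $N\times N$). For every $N\ge1$ let $U_1^{(N)},\dots,U_s^{(N)}$ be random $N\times N$ permutation matrices, each uniformly distributed on the $N!$ permutation matrices of size $N$. It is assumed that for every $N$ the $2s$ random matrices $U_1^{(N)},G_1^{(N)},\dots,U_s^{(N)},G_s^{(N)}$ are independent, and that for every $M,N$ the $2s$ random matrices $U_1^{(N)},W_1^{(M,N)},\dots,U_s^{(N)},W_s^{(M,N)}$ are independent. For an $N\times N$ matrix $A$, $\mathrm{tr}^{(N)}A=\frac1N\sum_{i=1}^N A_{ii}$. Limit variables. $(\mathcal A,\varphi)$ is a tracial non-commutative $*$-probability space (a unital $*$-algebra with a unital, tracial, positive linear functional $\varphi$). The non-crossing (free) cumulants $k_n:\mathcal A^n\to\mathbb C$ are the multilinear functionals determined by the moment-cumulant formula $\varphi(A_1\cdots A_n)=\sum_{\pi\in NC(n)}\prod_{V\in\pi}k_{|V|}(A_i: i\in V)$, summing over non-crossing partitions, with arguments in increasing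 order of index. $U\in\mathcal A$ is a Haar unitary if $U^*U=UU^*=I$ and $\varphi(U^n)=0$ for all $n\in\mathbb Z\setminus\{0\}$. $G\in\mathcal A$ is standard circular if the only non-zero cumulants with arguments in $\{G,G^*\}$ are $k_2(G,G^* )=k_2(G^*,G)=1$. $W\in\mathcal A$ is free Poisson of parameter $c$ if $W^*=W$ and $k_n(W,\dots,W)=c$ for all $n\ge1$. A family of elements of $\mathcal A$ is $*$-free if the unital $*$-subalgebras they generate are free with respect to $\varphi$. The family $(U_r,G_r,W_r)_{r=1}^s$ in $(\mathcal A,\varphi)$ is such that each $U_r$ is a Haar unitary, each $G_r$ is standard circular, each $W_r$ is free Poisson of parameter $c$, and the families $U_1,G_1,\dots,U_s,G_s$ and $U_1,W_1,\dots,U_s,W_s$ are each $*$-free. For a monomial $\alpha$ in the $U_r,G_r,W_r$ and their adjoints, $\alpha^{(M,N)}$ denotes the random $N\times N$ matrix obtained by replacing each $U_r$ by $U_r^{(N)}$, each $G_r$ by $G_r^{(N)}$, each $W_r$ by $W_r^{(M,N)}$ (and adjoints by adjoints). *)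

theory Defs
  imports
    "HOL-Probability.Probability"
    "Jordan_Normal_Form.Matrix"
    "Jordan_Normal_Form.Schur_Decomposition"
begin

section \<open>Random matrices\<close>

definition complex_std_gaussian :: "'w measure \<Rightarrow> ('w \<Rightarrow> complex) \<Rightarrow> bool" where
  "complex_std_gaussian P X \<longleftrightarrow>
     prob_space.indep_var P borel (\<lambda>\<omega>. Re (X \<omega>)) borel (\<lambda>\<omega>. Im (X \<omega>)) \<and>
     distributed P lborel (\<lambda>\<omega>. Re (X \<omega>)) (normal_density 0 (sqrt (1/2))) \<and>
     distributed P lborel (\<lambda>\<omega>. Im (X \<omega>)) (normal_density 0 (sqrt (1/2)))"

text \<open>
  The sigma-algebra generated by the entries.  It is the one with respect to which random
  matrices of a fixed size are measurable and (jointly) independent.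
\<close>

definition mat_borel :: "nat \<Rightarrow> nat \<Rightarrow> complex mat measure" where
  "mat_borel m n =
     vimage_algebra (carrier_mat m n) (\<lambda>A. \<lambda>ij\<in>{..<m} \<times> {..<n}. A $$ ij)
       (Pi\<^sub>M ({..<m} \<times> {..<n}) (\<lambda>_. borel))"

text \<open>Matrix entries are indexed from 0, as everywhere for the type of matrices.\<close>

definition gaussian_mat :: "(nat \<Rightarrow> nat \<Rightarrow> nat \<Rightarrow> 'w \<Rightarrow> complex) \<Rightarrow> nat \<Rightarrow> nat \<Rightarrow> nat \<Rightarrow> 'w \<Rightarrow> complex mat" where
  "gaussian_mat f M N r \<omega> = mat M N (\<lambda>(i, j). f r i j \<omega>)"

definition ginibre_mat :: "(nat \<Rightarrow> nat \<Rightarrow> nat \<Rightarrow> 'w \<Rightarrow> complex) \<Rightarrow> nat \<Rightarrow> nat \<Rightarrow> 'w \<Rightarrow> complex mat" where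
  "ginibre_mat f N r \<omega> = complex_of_real (1 / sqrt (real N)) \<cdot>\<^sub>m gaussian_mat f N N r \<omega>"

definition wishart_mat :: "(nat \<Rightarrow> nat \<Rightarrow> nat \<Rightarrow> 'w \<Rightarrow> complex) \<Rightarrow> nat \<Rightarrow> nat \<Rightarrow> nat \<Rightarrow> 'w \<Rightarrow> complex mat" where
  "wishart_mat f M N r \<omega> =
     complex_of_real (1 / real N) \<cdot>\<^sub>m (mat_adjoint (gaussian_mat f M N r \<omega>) * gaussian_mat f M N r \<omega>)"

definition permutation_mats :: "nat \<Rightarrow> complex mat set" where
  "permutation_mats N =
     {mat N N (\<lambda>(i, j). if i = \<sigma> j then 1 else 0) | \<sigma>. \<sigma> permutes {..<N}}"

definition uniform_permutation_mat :: "'w measure \<Rightarrow> nat \<Rightarrow> ('w \<Rightarrow> complex mat) \<Rightarrow> bool" where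
  "uniform_permutation_mat P N X \<longleftrightarrow>
     X \<in> measurable P (count_space (permutation_mats N)) \<and>
     distr P (count_space (permutation_mats N)) X = uniform_count_measure (permutation_mats N)"

definition normalized_trace :: "nat \<Rightarrow> complex mat \<Rightarrow> complex" where
  "normalized_trace N A = (\<Sum>i<N. A $$ (i, i)) / of_nat N"


section \<open>Tracial non-commutative *-probability spaces\<close>

locale tracial_star_prob_space = vector_space scaleC
  for scaleC :: "complex \<Rightarrow> 'a::ring_1 \<Rightarrow> 'a" +
  fixes star :: "'a \<Rightarrow> 'a"
    and \<phi> :: "'a \<Rightarrow> complex"
  assumes scale_mult_left: "scaleC a x * y = scaleC a (x * y)"
    and scale_mult_right: "x * scaleC a y = scaleC a (x * y)"
    and star_star: "star (star x) = x"
    and star_add: "star (x + y) = star x + star y"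
    and star_scale: "star (scaleC a x) = scaleC (cnj a) (star x)"
    and star_mult: "star (x * y) = star y * star x"
    and state_add: "\<phi> (x + y) = \<phi> x + \<phi> y"
    and state_scale: "\<phi> (scaleC a x) = a * \<phi> x"
    and state_one: "\<phi> 1 = 1"
    and state_trace: "\<phi> (x * y) = \<phi> (y * x)"
    and state_pos: "\<phi> (star x * x) \<in> nonneg_Reals"

inductive_set generated_star_subalgebra ::
  "(complex \<Rightarrow> 'a::ring_1 \<Rightarrow> 'a) \<Rightarrow> ('a \<Rightarrow> 'a) \<Rightarrow> 'a set \<Rightarrow> 'a set"
  for scaleC :: "complex \<Rightarrow> 'a \<Rightarrow> 'a" and star :: "'a \<Rightarrow> 'a" and S :: "'a set"
where
  base: "x \<in> S \<Longrightarrow> x \<in> generated_star_subalgebra scaleC star S"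
| one: "1 \<in> generated_star_subalgebra scaleC star S"
| scale: "x \<in> generated_star_subalgebra scaleC star S \<Longrightarrow>
    scaleC a x \<in> generated_star_subalgebra scaleC star S"
| add: "x \<in> generated_star_subalgebra scaleC star S \<Longrightarrow> y \<in> generated_star_subalgebra scaleC star S \<Longrightarrow>
    x + y \<in> generated_star_subalgebra scaleC star S"
| mult: "x \<in> generated_star_subalgebra scaleC star S \<Longrightarrow> y \<in> generated_star_subalgebra scaleC star S \<Longrightarrow>
    x * y \<in> generated_star_subalgebra scaleC star S"
| star: "x \<in> generated_star_subalgebra scaleC star S \<Longrightarrow>
    star x \<in> generated_star_subalgebra scaleC star S"

text \<open>
  A product \<open>a\<^sub>1 \<cdots> a\<^sub>n\<close> of centred elements, \<open>a\<^sub>j\<close> taken from the subalgebra with index \<open>i\<^sub>j\<close>,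
  is given as the list of the pairs \<open>(i\<^sub>j, a\<^sub>j)\<close>; consecutive indices have to differ.
\<close>

definition free_subalgebras :: "('a::ring_1 \<Rightarrow> complex) \<Rightarrow> ('i \<Rightarrow> 'a set) \<Rightarrow> 'i set \<Rightarrow> bool" where
  "free_subalgebras \<phi> B I \<longleftrightarrow>
     (\<forall>p :: ('i \<times> 'a) list.
        p \<noteq> [] \<and> (\<forall>(i, a) \<in> set p. i \<in> I \<and> a \<in> B i \<and> \<phi> a = 0) \<and> distinct_adj (map fst p) \<longrightarrow>
        \<phi> (prod_list (map snd p)) = 0)"

definition star_free ::
  "(complex \<Rightarrow> 'a::ring_1 \<Rightarrow> 'a) \<Rightarrow> ('a \<Rightarrow> 'a) \<Rightarrow> ('a \<Rightarrow> complex) \<Rightarrow> ('i \<Rightarrow> 'a) \<Rightarrow> 'i set \<Rightarrow> bool" where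
  "star_free scaleC star \<phi> X I \<longleftrightarrow>
     free_subalgebras \<phi> (\<lambda>i. generated_star_subalgebra scaleC star {X i}) I"


section \<open>Free cumulants\<close>

definition noncrossing_partitions :: "nat \<Rightarrow> nat set set set" where
  "noncrossing_partitions n =
     {\<pi>. partition_on {..<n} \<pi> \<and>
         (\<forall>V\<in>\<pi>. \<forall>W\<in>\<pi>. \<forall>a\<in>V. \<forall>b\<in>W. \<forall>c\<in>V. \<forall>d\<in>W. a < b \<and> b < c \<and> c < d \<longrightarrow> V = W)}"

lemma finite_noncrossing_partitions: "finite (noncrossing_partitions n)"
  unfolding noncrossing_partitions_def
  by (rule finite_subset[OF _ finitely_many_partition_on[of "{..<n}"]]) auto

lemma one_block_noncrossing: "n > 0 \<Longrightarrow> {{..<n}} \<in> noncrossing_partitions n"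
  by (auto simp: noncrossing_partitions_def lessThan_empty_iff intro!: partition_on_space)

lemma proper_block_length_nths:
  assumes "\<pi> \<in> noncrossing_partitions (length xs)" "\<pi> \<noteq> {{..<length xs}}" "V \<in> \<pi>"
  shows "length (nths xs V) < length xs"
proof -
  have part: "partition_on {..<length xs} \<pi>"
    using assms(1) by (simp add: noncrossing_partitions_def)
  have sub: "V \<subseteq> {..<length xs}"
    using partition_onD1[OF part] assms(3) by auto
  have "V \<noteq> {..<length xs}"
  proof
    assume V: "V = {..<length xs}"
    have "W = V" if W: "W \<in> \<pi>" for W
    proof (rule ccontr)
      assume "W \<noteq> V"
      then have "W \<inter> V = {}"
        using partition_onD2[OF part] W assms(3) by (auto simp: disjoint_def)
      moreover have "W \<subseteq> V" "W \<noteq> {}"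
        using partition_onD1[OF part] partition_onD3[OF part] W V by auto
      ultimately show False by auto
    qed
    then have "\<pi> = {V}" using assms(3) by blast
    then show False using assms(2) V by simp
  qed
  then have "V \<subset> {..<length xs}" using sub by auto
  then have "card V < length xs"
    using psubset_card_mono[of "{..<length xs}" V] by simp
  moreover have "{i. i < length xs \<and> i \<in> V} = V" using sub by auto
  ultimately show ?thesis by (simp add: length_nths)
qed

text \<open>
  \<open>free_cumulant \<phi> [A\<^sub>1, \<dots>, A\<^sub>n]\<close> is \<open>k\<^sub>n(A\<^sub>1, \<dots>, A\<^sub>n)\<close>, obtained by solving the moment-cumulant
  formula for the term of the one-block partition; \<open>nths xs V\<close> lists the arguments in the block
  \<open>V\<close> by increasing index.  The value for the empty list is a dummy and is never used.
\<close>

function free_cumulant :: "('a::monoid_mult \<Rightarrow> complex) \<Rightarrow> 'a list \<Rightarrow> complex" where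
  "free_cumulant \<phi> xs =
     (if xs = [] then 0
      else \<phi> (prod_list xs) -
        (\<Sum>\<pi> \<in> noncrossing_partitions (length xs) - {{{..<length xs}}}.
           \<Prod>V\<in>\<pi>. free_cumulant \<phi> (nths xs V)))"
  by auto
termination
  by (relation "Wellfounded.measure (\<lambda>(\<phi>, xs). length xs)") (auto intro: proper_block_length_nths)

declare free_cumulant.simps [simp del]

theorem moment_cumulant_formula:
  assumes "xs \<noteq> []"
  shows "\<phi> (prod_list xs) =
    (\<Sum>\<pi> \<in> noncrossing_partitions (length xs). \<Prod>V\<in>\<pi>. free_cumulant \<phi> (nths xs V))"
proof -
  have "(\<Sum>\<pi> \<in> noncrossing_partitions (length xs). \<Prod>V\<in>\<pi>. free_cumulant \<phi> (nths xs V)) =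
      free_cumulant \<phi> xs +
      (\<Sum>\<pi> \<in> noncrossing_partitions (length xs) - {{{..<length xs}}}.
         \<Prod>V\<in>\<pi>. free_cumulant \<phi> (nths xs V))"
    using assms
    by (subst sum.remove[OF finite_noncrossing_partitions one_block_noncrossing]) simp_all
  then show ?thesis
    using assms free_cumulant.simps[of \<phi> xs] by auto
qed

theorem free_cumulant_unique:
  assumes k: "\<And>xs. xs \<noteq> [] \<Longrightarrow> \<phi> (prod_list xs) =
    (\<Sum>\<pi> \<in> noncrossing_partitions (length xs). \<Prod>V\<in>\<pi>. k (nths xs V))"
    and "xs \<noteq> []"
  shows "k xs = free_cumulant \<phi> xs"
  using \<open>xs \<noteq> []\<close>
proof (induction xs rule: length_induct)
  case (1 xs)
  let ?NC = "noncrossing_partitions (length xs) - {{{..<length xs}}}"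
  have eq: "k (nths xs V) = free_cumulant \<phi> (nths xs V)" if "\<pi> \<in> ?NC" "V \<in> \<pi>" for \<pi> V
  proof -
    have part: "partition_on {..<length xs} \<pi>"
      using that by (simp add: noncrossing_partitions_def)
    have "V \<noteq> {}" "V \<subseteq> {..<length xs}"
      using partition_onD1[OF part] partition_onD3[OF part] that by auto
    then have "set (nths xs V) \<noteq> {}" by (auto simp: set_nths)
    then have "nths xs V \<noteq> []" by auto
    then show ?thesis
      using 1 proper_block_length_nths[of \<pi> xs V] that by auto
  qed
  have ne: "xs \<noteq> []" using 1 by simp
  have "\<phi> (prod_list xs) = k xs + (\<Sum>\<pi> \<in> ?NC. \<Prod>V\<in>\<pi>. k (nths xs V))"
    unfolding k[OF ne] using ne
    by (subst sum.remove[OF finite_noncrossing_partitions one_block_noncrossing]) simp_all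
  also have "(\<Sum>\<pi> \<in> ?NC. \<Prod>V\<in>\<pi>. k (nths xs V)) =
      (\<Sum>\<pi> \<in> ?NC. \<Prod>V\<in>\<pi>. free_cumulant \<phi> (nths xs V))"
    by (intro sum.cong prod.cong refl eq) auto
  finally show ?case
    using ne free_cumulant.simps[of \<phi> xs] by auto
qed


section \<open>The limit variables\<close>

definition haar_unitary :: "('a::ring_1 \<Rightarrow> 'a) \<Rightarrow> ('a \<Rightarrow> complex) \<Rightarrow> 'a \<Rightarrow> bool" where
  "haar_unitary star \<phi> u \<longleftrightarrow>
     star u * u = 1 \<and> u * star u = 1 \<and> (\<forall>n\<ge>1. \<phi> (u ^ n) = 0 \<and> \<phi> (star u ^ n) = 0)"

text \<open>
  The letters \<open>False\<close> and \<open>True\<close> stand for \<open>g\<close> and \<open>star g\<close>: arguments are words in these two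
  formal letters, so that \<open>k\<^sub>2(g, g) = 0\<close> is demanded separately from \<open>k\<^sub>2(g, star g) = 1\<close>.
\<close>

definition standard_circular :: "('a::ring_1 \<Rightarrow> 'a) \<Rightarrow> ('a \<Rightarrow> complex) \<Rightarrow> 'a \<Rightarrow> bool" where
  "standard_circular star \<phi> g \<longleftrightarrow>
     (\<forall>bs. bs \<noteq> [] \<longrightarrow>
        free_cumulant \<phi> (map (\<lambda>b. if b then star g else g) bs) =
          (if bs = [False, True] \<or> bs = [True, False] then 1 else 0))"

definition free_poisson :: "('a::ring_1 \<Rightarrow> 'a) \<Rightarrow> ('a \<Rightarrow> complex) \<Rightarrow> real \<Rightarrow> 'a \<Rightarrow> bool" where
  "free_poisson star \<phi> c w \<longleftrightarrow>
     star w = w \<and> (\<forall>n\<ge>1. free_cumulant \<phi> (replicate n w) = complex_of_real c)"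


section \<open>Monomials\<close>

text \<open>
  A monomial in a family of variables and their adjoints is a list of pairs \<open>(i, b)\<close>, standing
  for the variable with index \<open>i\<close> if \<open>b\<close> is false, and for its adjoint if \<open>b\<close> is true.
\<close>

definition eval_monomial :: "('a::ring_1 \<Rightarrow> 'a) \<Rightarrow> ('i \<Rightarrow> 'a) \<Rightarrow> ('i \<times> bool) list \<Rightarrow> 'a" where
  "eval_monomial star X \<alpha> = prod_list (map (\<lambda>(i, b). if b then star (X i) else X i) \<alpha>)"

definition eval_monomial_mat :: "nat \<Rightarrow> ('i \<Rightarrow> complex mat) \<Rightarrow> ('i \<times> bool) list \<Rightarrow> complex mat" where
  "eval_monomial_mat N X \<alpha> =
     foldr (*) (map (\<lambda>(i, b). if b then mat_adjoint (X i) else X i) \<alpha>) (1\<^sub>m N)"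

end

(*
  Write T(w_1, ..., w_k) for the expectation of the product of the normalized traces of the words
  w_1, ..., w_k.  Gaussian integration by parts in one letter of the first word expresses T by
  values at words with fewer Gaussian letters: splitting the first word at a second Gaussian letter
  gives a product of two traces, joining it with another word costs a factor 1/N^2.  The
  permutation matrices may be frozen during this step, since they are independent of the rest.  By
  induction T(w_1, ..., w_k) = T(w_1) ... T(w_k) + O(1/N^2), once this is known for words in the
  permutations alone.  There it follows from the fact that the number of fixed points of a
  cyclically reduced word has bounded second moment: the graph of a closed path along such a word
  has minimal degree at least 2, hence at least as many edges as vertices.

  So T(w) satisfies, in the limit, a recursion.  Its solution is the state: for a single circular or
  free Poisson element the recursion is a decomposition of non-crossing partitions, and freeness
  carries it over to words in several elements.  The factorization also bounds the variance of a
  trace by O(1/N^2), which is summable along the sequence N_q.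
*)

theory Submission
  imports Defs
begin

section \<open>Schwinger-Dyson systems\<close>

text \<open>Both models fit one scheme. A Wishart letter is quadratic in the Gaussian entries, so
  integration by parts acts on one of its two factors; when the derivative meets another such
  letter, the two factors left over are summed into a new Wishart letter, the word \<open>Z\<close>
  (\<open>X\<close> in the abstract system). A Ginibre letter leaves the empty word. In either case
  fewer Gaussian letters remain, so the recursion ends. The order 1/N^2 is what the last step needs:
  N_q is only known to be at least q, and 1/q^2 is summable while 1/q is not. This is why
  permutation words need a second moment. If a word does not reduce to the empty one, its expected
  fraction of fixed points is known to be O(1/N). The mean of a product of two such fractions is
  bounded through the sum of their squares, each of mean O(1/N^2). In the count behind this, a
  closed path with V vertices and E distinct edges has at most about N^V placements, each of
  probability about N^(-E).\<close>

fun splits :: "'l set \<Rightarrow> 'l list \<Rightarrow> ('l list \<times> 'l list) list" where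
  "splits H [] = []"
| "splits H (h # A) = (if h \<in> H then [([], A)] else []) @ map (\<lambda>(B, C). (h # B, C)) (splits H A)"

text \<open>\<open>splits H\<close> is the free difference quotient in the letters of
  \<open>H\<close>, a tensor of two words being written as a pair; this is its Leibniz rule.\<close>

lemma splits_append:
  "splits H (A @ B) =
     map (\<lambda>(C, D). (C, D @ B)) (splits H A) @ map (\<lambda>(C, D). (A @ C, D)) (splits H B)"
  by (induction A) (auto simp: comp_def case_prod_beta)

lemma splitsD: "(B, C) \<in> set (splits H A) \<Longrightarrow> \<exists>h\<in>H. A = B @ h # C"
  by (induction A arbitrary: B C) (auto split: if_splits)

lemma splits_eq_Nil: "set A \<inter> H = {} \<Longrightarrow> splits H A = []"
  by (induction A) auto

text \<open>The derivative of a product of traces. Deleting a letter from a cyclic word opens the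
  cycle at this place, so \<open>C @ h # D\<close> is then read as \<open>D @ C\<close>; in this
  form it can be inserted into another trace.\<close>

fun splits_list :: "'l set \<Rightarrow> 'l list list \<Rightarrow> ('l list \<times> 'l list list) list" where
  "splits_list H [] = []"
| "splits_list H (B # L) =
     map (\<lambda>(C, D). (D @ C, L)) (splits H B) @ map (\<lambda>(w, L'). (w, B # L')) (splits_list H L)"

lemma splits_listD:
  "(w, L') \<in> set (splits_list H L) \<Longrightarrow>
     \<exists>B C h. h \<in> H \<and> w = C @ B \<and> mset L = add_mset (B @ h # C) (mset L')"
proof (induction L arbitrary: L')
  case (Cons B L)
  then consider C D where "(C, D) \<in> set (splits H B)" "w = D @ C" "L' = L"
    | L'' where "(w, L'') \<in> set (splits_list H L)" "L' = B # L''"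
    by auto
  then show ?case
  proof cases
    case 1
    then show ?thesis using splitsD[of C D H B] by auto
  next
    case 2
    then show ?thesis using Cons.IH[of L''] by auto
  qed
qed simp

definition degree_wrt :: "('l \<Rightarrow> bool) \<Rightarrow> 'l list \<Rightarrow> nat" where
  "degree_wrt G w = length (filter G w)"

lemma degree_wrt_simps [simp]:
  "degree_wrt G [] = 0"
  "degree_wrt G (l # w) = (if G l then 1 else 0) + degree_wrt G w"
  "degree_wrt G (v @ w) = degree_wrt G v + degree_wrt G w"
  by (auto simp: degree_wrt_def)

lemma degree_wrt_le_length: "degree_wrt G w \<le> length w"
  by (simp add: degree_wrt_def)

section \<open>Asymptotic factorization and limits in an abstract Schwinger-Dyson system\<close>

lemma sum_list_in_bigo:
  assumes "\<And>x. x \<in> set xs \<Longrightarrow> f x \<in> O[F](g)"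
  shows "(\<lambda>q. \<Sum>x\<leftarrow>xs. f x q) \<in> O[F](g)"
  using assms by (induction xs) (auto intro: sum_in_bigo)

lemma prod_list_in_bigo_1:
  fixes f :: "'x \<Rightarrow> 'q \<Rightarrow> complex"
  assumes "\<And>x. x \<in> set xs \<Longrightarrow> f x \<in> O[F](\<lambda>_. 1)"
  shows "(\<lambda>q. \<Prod>x\<leftarrow>xs. f x q) \<in> O[F](\<lambda>_. 1)"
  using assms
proof (induction xs)
  case (Cons x xs)
  have "(\<lambda>q. f x q * (\<Prod>x\<leftarrow>xs. f x q)) \<in> O[F](\<lambda>q. 1 * 1)"
    by (intro landau_o.big.mult) (use Cons in auto)
  then show ?case by simp
qed simp

lemma bigo_tendsto_0:
  fixes f g :: "'q \<Rightarrow> complex"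
  assumes "f \<in> O[F](g)" "(g \<longlongrightarrow> 0) F"
  shows "(f \<longlongrightarrow> 0) F"
proof -
  obtain c where "eventually (\<lambda>x. norm (f x) \<le> c * norm (g x)) F"
    using assms(1) by (elim landau_o.bigE)
  then show ?thesis
    by (rule Lim_null_comparison) (auto intro!: tendsto_eq_intros assms(2))
qed

text \<open>\<open>G\<close> marks the Gaussian letters, \<open>H l\<close> the letters that
  contract with \<open>l\<close>, and \<open>X l\<close> is the word that such a contraction leaves
  behind; \<open>\<kappa>\<close> is the coefficient of the contraction of \<open>l\<close> within
  itself. \<open>n q\<close> is the matrix size, \<open>T q L\<close> the expected product of the
  traces of the words in \<open>L\<close>, and \<open>\<psi>\<close> the limit. A contraction
  removes two Gaussian letters, and \<open>length (X l) \<le> 1\<close> prevents both from coming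
  back.\<close>

locale schwinger_dyson =
  fixes V :: "'l set" and G :: "'l \<Rightarrow> bool" and H :: "'l \<Rightarrow> 'l set" and X :: "'l \<Rightarrow> 'l list"
    and \<kappa> :: "nat \<Rightarrow> 'l \<Rightarrow> complex" and \<kappa>' :: "'l \<Rightarrow> complex"
    and n :: "nat \<Rightarrow> nat" and T :: "nat \<Rightarrow> 'l list list \<Rightarrow> complex" and \<psi> :: "'l list \<Rightarrow> complex"
  assumes X: "l \<in> V \<Longrightarrow> G l \<Longrightarrow> set (X l) \<subseteq> V" "length (X l) \<le> 1"
    and H: "h \<in> H l \<Longrightarrow> G h"
    and n: "filterlim n at_top sequentially"
    and \<kappa>: "l \<in> V \<Longrightarrow> G l \<Longrightarrow> (\<lambda>q. \<kappa> q l) \<longlonglongrightarrow> \<kappa>' l"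
    and T_mset: "mset L = mset L' \<Longrightarrow> T q L = T q L'"
    and T_rotate: "T q ((v @ w) # L) = T q ((w @ v) # L)"
    and \<psi>_rotate: "\<psi> (v @ w) = \<psi> (w @ v)"
    and T_sd: "l \<in> V \<Longrightarrow> G l \<Longrightarrow> A \<in> lists V \<Longrightarrow> L \<in> lists (lists V) \<Longrightarrow>
      T q ((l # A) # L) = \<kappa> q l * T q (A # L) +
        (\<Sum>(B, C)\<leftarrow>splits (H l) A. T q ((X l @ B) # C # L)) +
        (\<Sum>(w, L')\<leftarrow>splits_list (H l) L. T q ((X l @ A @ w) # L')) / of_nat (n q) ^ 2"
    and \<psi>_sd: "l \<in> V \<Longrightarrow> G l \<Longrightarrow> A \<in> lists V \<Longrightarrow>
      \<psi> (l # A) = \<kappa>' l * \<psi> A + (\<Sum>(B, C)\<leftarrow>splits (H l) A. \<psi> (X l @ B) * \<psi> C)"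
    and T_base: "L \<in> lists (lists {l\<in>V. \<not> G l}) \<Longrightarrow> (\<lambda>q. T q L) \<in> O(\<lambda>_. 1)"
      "L \<in> lists (lists {l\<in>V. \<not> G l}) \<Longrightarrow>
         (\<lambda>q. T q L - (\<Prod>w\<leftarrow>L. T q [w])) \<in> O(\<lambda>q. 1 / of_nat (n q) ^ 2)"
      "w \<in> lists {l\<in>V. \<not> G l} \<Longrightarrow> (\<lambda>q. T q [w]) \<longlonglongrightarrow> \<psi> w"
begin

abbreviation deg where "deg \<equiv> degree_wrt G"

lemma deg_split:
  assumes "(B, C) \<in> set (splits (H l) A)"
  shows "deg B + deg C < deg A"
  using splitsD[OF assms] H by (auto simp: degree_wrt_def)

lemma split_in_lists:
  assumes "(B, C) \<in> set (splits (H l) A)" "A \<in> lists V"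
  shows "B \<in> lists V" "C \<in> lists V"
  using splitsD[OF assms(1)] assms(2) by auto

lemma deg_X: "deg (X l) \<le> 1"
  using degree_wrt_le_length[of G "X l"] X(2)[of l] by simp

lemma splits_list_smaller:
  assumes "(w, L') \<in> set (splits_list (H l) L)" "L \<in> lists (lists V)"
  shows "deg w + sum_list (map deg L') < sum_list (map deg L)" "w \<in> lists V" "L' \<in> lists (lists V)"
proof -
  obtain B C h where *: "h \<in> H l" "w = C @ B" and L: "mset L = add_mset (B @ h # C) (mset L')"
    using splits_listD[OF assms(1)] by blast
  have "sum_list (map deg L) = sum_mset (image_mset deg (mset L))"
    by (simp add: sum_mset_sum_list flip: mset_map)
  also have "\<dots> = deg (B @ h # C) + sum_list (map deg L')"
    by (simp add: L sum_mset_sum_list flip: mset_map)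
  finally show "deg w + sum_list (map deg L') < sum_list (map deg L)"
    using * H by simp
  have "set L = insert (B @ h # C) (set L')"
    using arg_cong[OF L, of set_mset] by simp
  then show "w \<in> lists V" "L' \<in> lists (lists V)"
    using assms(2) * by (auto simp: lists_eq_set)
qed

text \<open>Boundedness and factorization share one induction on the number of Gaussian letters.
  Subtracting \<open>P\<close> times the equation of the word \<open>l # A\<close> alone from the
  equation of \<open>L\<close> leaves differences covered by the induction hypothesis, and the
  joining terms, which carry the factor 1/n^2 already and so need only be bounded.\<close>

lemma T_factor:
  assumes "L \<in> lists (lists V)"
  shows "(\<lambda>q. T q L) \<in> O(\<lambda>_. 1) \<and>
    (\<lambda>q. T q L - (\<Prod>w\<leftarrow>L. T q [w])) \<in> O(\<lambda>q. 1 / of_nat (n q) ^ 2)"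
  using assms
proof (induction "sum_list (map deg L)" arbitrary: L rule: less_induct)
  case (less L)
  let ?s = "\<lambda>q. 1 / of_nat (n q) ^ 2 :: complex"
  show ?case
  proof (cases "\<exists>w\<in>set L. \<exists>l\<in>set w. G l")
    case False
    then have "L \<in> lists (lists {l\<in>V. \<not> G l})"
      using less.prems by (auto simp: lists_eq_set)
    then show ?thesis using T_base by blast
  next
    case True
    then obtain w l where w: "w \<in> set L" "l \<in> set w" "G l" by blast
    obtain a b where ab: "w = a @ l # b" using w(2) by (meson split_list)
    obtain L1 L2 where L12: "L = L1 @ w # L2" using w(1) by (meson split_list)
    define A where "A = b @ a"
    define L' where "L' = L1 @ L2"
    have T_L: "T q L = T q ((l # A) # L')" for q
      using T_mset[of L "w # L'" q] T_rotate[of q a "l # b" L'] by (simp add: L12 L'_def ab A_def)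
    have T_w: "T q [w] = T q [l # A]" for q
      using T_rotate[of q a "l # b" "[]"] by (simp add: ab A_def)
    have prod_L: "(\<Prod>w\<leftarrow>L. T q [w]) = T q [l # A] * (\<Prod>w\<leftarrow>L'. T q [w])" for q
      by (simp add: L12 L'_def T_w)
    have deg_L: "sum_list (map deg L) = Suc (deg A + sum_list (map deg L'))"
      using w(3) by (simp add: L12 L'_def ab A_def)
    have V: "l \<in> V" "A \<in> lists V" "L' \<in> lists (lists V)"
      using less.prems by (auto simp: L12 L'_def ab A_def lists_eq_set)
    have IH: "(\<lambda>q. T q K) \<in> O(\<lambda>_. 1)" "(\<lambda>q. T q K - (\<Prod>w\<leftarrow>K. T q [w])) \<in> O(?s)"
      if "sum_list (map deg K) \<le> deg A + sum_list (map deg L')" "K \<in> lists (lists V)" for K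
      using less.hyps[of K] that deg_L by auto
    define P where "P q = (\<Prod>w\<leftarrow>L'. T q [w])" for q
    have P: "P \<in> O(\<lambda>_. 1)"
      unfolding P_def[abs_def]
    proof (rule prod_list_in_bigo_1)
      fix w assume "w \<in> set L'"
      then show "(\<lambda>q. T q [w]) \<in> O(\<lambda>_. 1)"
        using V member_le_sum_list[of "deg w" "map deg L'"] by (intro IH) (auto simp: lists_eq_set)
    qed
    have mult_P: "(\<lambda>q. f q * P q) \<in> O(?s)" if "f \<in> O(?s)" for f
      using landau_o.big.mult[OF that P] by simp
    have \<kappa>_bd: "(\<lambda>q. \<kappa> q l) \<in> O(\<lambda>_. 1)"
      using \<kappa>[OF V(1) w(3)] by (intro bigoI_tendsto[of _ _ "\<kappa>' l"]) auto
    have split: "X l @ B \<in> lists V" "C \<in> lists V" "deg (X l @ B) + deg C \<le> deg A"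
      if "(B, C) \<in> set (splits (H l) A)" for B C
      using X(1)[OF V(1) w(3)] deg_split[OF that] deg_X[of l] split_in_lists[OF that V(2)]
      by (auto simp: lists_eq_set)
    have R: "(\<lambda>q. (\<Sum>(w, K)\<leftarrow>splits_list (H l) L'. T q ((X l @ A @ w) # K)) / of_nat (n q) ^ 2) \<in> O(?s)"
    proof -
      have "(\<lambda>q. \<Sum>x\<leftarrow>splits_list (H l) L'. T q ((X l @ A @ fst x) # snd x)) \<in> O(\<lambda>_. 1)"
      proof (rule sum_list_in_bigo)
        fix x assume "x \<in> set (splits_list (H l) L')"
        then have "(fst x, snd x) \<in> set (splits_list (H l) L')" by simp
        from splits_list_smaller[OF this V(3)]
        show "(\<lambda>q. T q ((X l @ A @ fst x) # snd x)) \<in> O(\<lambda>_. 1)"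
          using V(2) X(1)[OF V(1) w(3)] deg_X[of l] by (intro IH) (auto simp: lists_eq_set)
      qed
      from landau_o.big.mult[OF this, of ?s ?s] show ?thesis
        by (simp add: case_prod_unfold)
    qed
    have sd: "T q ((l # A) # L') = \<kappa> q l * T q (A # L') +
        (\<Sum>x\<leftarrow>splits (H l) A. T q ((X l @ fst x) # snd x # L')) +
        (\<Sum>(w, K)\<leftarrow>splits_list (H l) L'. T q ((X l @ A @ w) # K)) / of_nat (n q) ^ 2" for q
      using T_sd[OF V(1) w(3) V(2,3)] by (simp add: case_prod_unfold)
    have sd1: "T q [l # A] = \<kappa> q l * T q [A] +
        (\<Sum>x\<leftarrow>splits (H l) A. T q [X l @ fst x, snd x])" for q
      using T_sd[OF V(1) w(3) V(2), of "[]"] by (simp add: case_prod_unfold)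
    have "(\<lambda>q. T q L) \<in> O(\<lambda>_. 1)"
      unfolding T_L sd
    proof (intro sum_in_bigo)
      have "(\<lambda>q. \<kappa> q l * T q (A # L')) \<in> O(\<lambda>_. 1 * 1)"
        using V by (intro landau_o.big.mult \<kappa>_bd IH) auto
      then show "(\<lambda>q. \<kappa> q l * T q (A # L')) \<in> O(\<lambda>_. 1)" by simp
      show "(\<lambda>q. \<Sum>x\<leftarrow>splits (H l) A. T q ((X l @ fst x) # snd x # L')) \<in> O(\<lambda>_. 1)"
      proof (rule sum_list_in_bigo)
        fix x assume "x \<in> set (splits (H l) A)"
        then have "(fst x, snd x) \<in> set (splits (H l) A)" by simp
        from split[OF this] show "(\<lambda>q. T q ((X l @ fst x) # snd x # L')) \<in> O(\<lambda>_. 1)"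
          using V(3) by (intro IH) auto
      qed
      have "?s \<in> O(\<lambda>_. 1)"
      proof (rule landau_o.big_mono)
        show "eventually (\<lambda>q. norm (?s q) \<le> norm (1::complex)) sequentially"
        proof (intro always_eventually allI)
          \<comment> \<open>The case \<open>n q = 0\<close> is harmless, since then
            \<open>1 / 0 = 0\<close>.\<close>
          fix q show "norm (?s q) \<le> norm (1::complex)"
            by (cases "n q") (auto simp: norm_divide norm_power divide_simps one_le_power
                 simp del: of_nat_Suc)
        qed
      qed
      from landau_o.big_trans[OF R this]
      show "(\<lambda>q. (\<Sum>(w, K)\<leftarrow>splits_list (H l) L'. T q ((X l @ A @ w) # K)) / of_nat (n q) ^ 2) \<in> O(\<lambda>_. 1)" .
    qed
    moreover have "(\<lambda>q. T q L - (\<Prod>w\<leftarrow>L. T q [w])) \<in> O(?s)"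
    proof -
      \<comment> \<open>\<open>sd1\<close> has no joining terms, as there is no other trace to join;
        those of \<open>sd\<close> remain as they are.\<close>
      have "T q L - (\<Prod>w\<leftarrow>L. T q [w]) =
          \<kappa> q l * (T q (A # L') - T q [A] * P q) +
          (\<Sum>x\<leftarrow>splits (H l) A. T q ((X l @ fst x) # snd x # L') - T q [X l @ fst x, snd x] * P q) +
          (\<Sum>(w, K)\<leftarrow>splits_list (H l) L'. T q ((X l @ A @ w) # K)) / of_nat (n q) ^ 2" for q
        unfolding prod_L T_L sd sd1 P_def[symmetric]
        by (simp add: algebra_simps sum_list_subtractf sum_list_const_mult)
      moreover have "(\<lambda>q. \<kappa> q l * (T q (A # L') - T q [A] * P q)) \<in> O(?s)"
      proof -
        have "(\<lambda>q. \<kappa> q l * (T q (A # L') - (\<Prod>w\<leftarrow>A#L'. T q [w]))) \<in> O(\<lambda>q. 1 * ?s q)"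
          using V by (intro landau_o.big.mult \<kappa>_bd IH) auto
        then show ?thesis by (simp add: P_def)
      qed
      moreover have "(\<lambda>q. \<Sum>x\<leftarrow>splits (H l) A.
          T q ((X l @ fst x) # snd x # L') - T q [X l @ fst x, snd x] * P q) \<in> O(?s)"
      proof (rule sum_list_in_bigo)
        fix x assume "x \<in> set (splits (H l) A)"
        then have "(fst x, snd x) \<in> set (splits (H l) A)" by simp
        note sp = split[OF this]
        \<comment> \<open>Both terms of the difference are compared with the fully factored product
          of the traces.\<close>
        have 1: "(\<lambda>q. T q ((X l @ fst x) # snd x # L') -
            (\<Prod>w\<leftarrow>(X l @ fst x) # snd x # L'. T q [w])) \<in> O(?s)"
          using V(3) sp by (intro IH) auto
        have "(\<lambda>q. T q [X l @ fst x, snd x] - (\<Prod>w\<leftarrow>[X l @ fst x, snd x]. T q [w])) \<in> O(?s)"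
          using sp by (intro IH) auto
        from sum_in_bigo(2)[OF 1 mult_P[OF this]]
        show "(\<lambda>q. T q ((X l @ fst x) # snd x # L') - T q [X l @ fst x, snd x] * P q) \<in> O(?s)"
          by (simp add: P_def algebra_simps)
      qed
      ultimately show ?thesis
        using R by (simp only:) (intro sum_in_bigo)
    qed
    ultimately show ?thesis ..
  qed
qed

lemma inverse_square_tendsto_0: "(\<lambda>q. 1 / of_nat (n q) ^ 2 :: complex) \<longlonglongrightarrow> 0"
proof -
  have "(\<lambda>q. inverse (of_nat (n q)) :: complex) \<longlonglongrightarrow> 0"
    using filterlim_compose[OF lim_inverse_n n] .
  from tendsto_power[OF this, of 2] show ?thesis by (simp add: field_simps)
qed

text \<open>For a single word the equation has no joining terms, and factorization turns each split
  term into a product of two expectations whose limits are known by induction. So the limit obeys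
  the recursion of \<open>\<psi>\<close>.\<close>

lemma T_tendsto:
  assumes "w \<in> lists V"
  shows "(\<lambda>q. T q [w]) \<longlonglongrightarrow> \<psi> w"
  using assms
proof (induction "deg w" arbitrary: w rule: less_induct)
  case (less w)
  show ?case
  proof (cases "\<exists>l\<in>set w. G l")
    case False
    then show ?thesis using less.prems by (intro T_base) auto
  next
    case True
    then obtain l where l: "l \<in> set w" "G l" by blast
    obtain a b where ab: "w = a @ l # b" using l(1) by (meson split_list)
    define A where "A = b @ a"
    have T_w: "T q [w] = T q [l # A]" for q
      using T_rotate[of q a "l # b" "[]"] by (simp add: ab A_def)
    have \<psi>_w: "\<psi> w = \<psi> (l # A)"
      using \<psi>_rotate[of a "l # b"] by (simp add: ab A_def)
    have V: "l \<in> V" "A \<in> lists V"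
      using less.prems by (auto simp: ab A_def)
    have deg_w: "deg w = Suc (deg A)"
      using l(2) by (simp add: ab A_def)
    have IH: "(\<lambda>q. T q [v]) \<longlonglongrightarrow> \<psi> v" if "deg v \<le> deg A" "v \<in> lists V" for v
      using less.hyps[of v] that deg_w by auto
    have sd1: "T q [l # A] = \<kappa> q l * T q [A] +
        (\<Sum>x\<leftarrow>splits (H l) A. T q [X l @ fst x, snd x])" for q
      using T_sd[OF V(1) l(2) V(2), of "[]"] by (simp add: case_prod_unfold)
    have "(\<lambda>q. T q [X l @ fst x, snd x]) \<longlonglongrightarrow> \<psi> (X l @ fst x) * \<psi> (snd x)"
      if x: "x \<in> set (splits (H l) A)" for x
    proof -
      have x': "(fst x, snd x) \<in> set (splits (H l) A)" using x by simp
      have sp: "X l @ fst x \<in> lists V" "snd x \<in> lists V" "deg (X l @ fst x) + deg (snd x) \<le> deg A"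
        using X(1)[OF V(1) l(2)] deg_split[OF x'] deg_X[of l] split_in_lists[OF x' V(2)]
        by (auto simp: lists_eq_set)
      have "(\<lambda>q. T q [X l @ fst x, snd x] - T q [X l @ fst x] * T q [snd x]) \<in> O(\<lambda>q. 1 / of_nat (n q) ^ 2)"
        using T_factor[of "[X l @ fst x, snd x]"] sp by simp
      then have "(\<lambda>q. T q [X l @ fst x, snd x] - T q [X l @ fst x] * T q [snd x]) \<longlonglongrightarrow> 0"
        using inverse_square_tendsto_0 by (rule bigo_tendsto_0)
      from tendsto_add[OF this tendsto_mult[OF IH[OF _ sp(1)] IH[OF _ sp(2)]]] sp(3) show ?thesis by simp
    qed
    then have "(\<lambda>q. \<Sum>x\<leftarrow>xs. T q [X l @ fst x, snd x]) \<longlonglongrightarrow> (\<Sum>x\<leftarrow>xs. \<psi> (X l @ fst x) * \<psi> (snd x))"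
      if "set xs \<subseteq> set (splits (H l) A)" for xs
      using that by (induction xs) (auto intro!: tendsto_intros)
    from tendsto_add[OF tendsto_mult[OF \<kappa>[OF V(1) l(2)] IH[of A]] this[OF subset_refl]]
    show ?thesis
      unfolding T_w sd1 \<psi>_w \<psi>_sd[OF V(1) l(2) V(2)] using V by (simp add: case_prod_unfold)
  qed
qed

end

section \<open>Fixed points of words in random permutations\<close>

text \<open>Each further prescribed value costs a factor of at least N - n: a permutation that sends
  \<open>a\<close> to \<open>b\<close> can be followed by the transposition of \<open>b\<close> and
  any \<open>c\<close> that is not yet a prescribed value. The results still obey \<open>E\<close>,
  and they are distinct because \<open>c\<close> is the new value at \<open>a\<close>.\<close>

lemma card_permutes_extending:
  fixes E :: "(nat \<times> nat) set"
  assumes "finite E" "E \<subseteq> {..<N} \<times> {..<N}" "card E \<le> n"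
  shows "card {\<sigma>. \<sigma> permutes {..<N} \<and> (\<forall>(a, b)\<in>E. \<sigma> a = b)} * (N - n) ^ card E \<le> fact N"
  using assms
proof (induction E)
  case empty
  show ?case using card_permutations[OF refl, of "{..<N}"] by simp
next
  case (insert e E)
  obtain a b where e: "e = (a, b)" by (cases e)
  let ?S = "\<lambda>E. {\<sigma>. \<sigma> permutes {..<N} \<and> (\<forall>(a, b)\<in>E. \<sigma> a = b)}"
  have fin: "finite (?S E)" for E
    by (rule finite_subset[OF _ finite_permutations[of "{..<N}"]]) auto
  show ?case
  proof (cases "?S (insert e E) = {}")
    case False
    then obtain \<tau> where \<tau>: "\<tau> permutes {..<N}" "\<tau> a = b" "\<forall>(a, b)\<in>E. \<tau> a = b"
      by (auto simp: e)
    \<comment> \<open>A permutation satisfying all constraints exists here, and it is injective, so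
      \<open>b\<close> cannot already be the value at another point.\<close>
    have b: "b \<notin> snd ` E"
    proof
      assume "b \<in> snd ` E"
      then obtain c where "(c, b) \<in> E" by auto
      with \<tau> have "\<tau> c = \<tau> a" by auto
      then have "c = a" using permutes_inj[OF \<tau>(1)] by (auto dest: injD)
      with \<open>(c, b) \<in> E\<close> insert.hyps(2) show False by (simp add: e)
    qed
    have ab: "a < N" "b < N" using insert.prems by (auto simp: e)
    let ?B = "{..<N} - snd ` E"
    have "card (?S (insert e E) \<times> ?B) \<le> card (?S E)"
    proof (rule card_inj_on_le[where f = "\<lambda>(\<sigma>, c). Transposition.transpose b c \<circ> \<sigma>"])
      show "inj_on (\<lambda>(\<sigma>, c). Transposition.transpose b c \<circ> \<sigma>) (?S (insert e E) \<times> ?B)"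
      proof (rule inj_onI, safe)
        fix \<sigma> c \<sigma>' c'
        assume eq: "Transposition.transpose b c \<circ> \<sigma> = Transposition.transpose b c' \<circ> \<sigma>'"
          and \<sigma>: "\<forall>(a, b)\<in>insert e E. \<sigma> a = b" "\<forall>(a, b)\<in>insert e E. \<sigma>' a = b"
        from fun_cong[OF eq, of a] \<sigma> show "c = c'" by (simp add: e)
        then have "Transposition.transpose b c \<circ> (Transposition.transpose b c \<circ> \<sigma>) = Transposition.transpose b c \<circ> (Transposition.transpose b c \<circ> \<sigma>')"
          using eq by simp
        then show "\<sigma> = \<sigma>'" by (simp add: comp_assoc[symmetric])
      qed
      show "(\<lambda>(\<sigma>, c). Transposition.transpose b c \<circ> \<sigma>) ` (?S (insert e E) \<times> ?B) \<subseteq> ?S E"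
      proof safe
        fix \<sigma> c assume \<sigma>: "\<sigma> permutes {..<N}" "\<forall>(a, b)\<in>insert e E. \<sigma> a = b" and c: "c < N" "c \<notin> snd ` E"
        show "Transposition.transpose b c \<circ> \<sigma> permutes {..<N}"
          using \<sigma>(1) ab c by (intro permutes_compose permutes_swap_id) auto
        fix x y assume "(x, y) \<in> E"
        then have "\<sigma> x = y" "y \<noteq> b" "y \<noteq> c" using \<sigma>(2) b c(2) by (auto simp: image_iff)
        then show "(Transposition.transpose b c \<circ> \<sigma>) x = y" by simp
      qed
    qed (rule fin)
    then have "card (?S (insert e E)) * card ?B \<le> card (?S E)"
      by (simp add: card_cartesian_product)
    moreover have "N - n \<le> card ?B"
    proof -
      have "snd ` E \<subseteq> {..<N}" using insert.prems by auto
      then have "card ?B = N - card (snd ` E)"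
        using insert.hyps by (simp add: card_Diff_subset)
      moreover have "card (snd ` E) \<le> card E" using insert.hyps by (intro card_image_le)
      ultimately show ?thesis using insert by simp
    qed
    ultimately have "card (?S (insert e E)) * (N - n) \<le> card (?S E)"
      by (meson le_trans mult_le_mono2)
    then have "card (?S (insert e E)) * (N - n) * (N - n) ^ card E \<le> card (?S E) * (N - n) ^ card E"
      by (rule mult_le_mono1)
    also have "\<dots> \<le> fact N" using insert by simp
    finally show ?thesis using insert.hyps by (simp add: mult_ac)
  next
    case True
    then show ?thesis by (simp only: card.empty)
  qed
qed

section \<open>Weighted count of closed paths\<close>

text \<open>The values are chosen one at a time: a new one either repeats one of at most n earlier
  values at no cost, or is one of at most N new values at the cost of a factor x. With x of order
  1/N the sum stays bounded in N.\<close>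

lemma sum_power_card_image_le:
  fixes x :: real
  assumes "finite I" "card I \<le> n" "0 \<le> x"
  shows "(\<Sum>v\<in>I \<rightarrow>\<^sub>E {..<N}. x ^ card (v ` I)) \<le> (real n + real N * x) ^ card I"
  using assms(1,2)
proof (induction I)
  case (insert p I)
  have "(\<Sum>v\<in>insert p I \<rightarrow>\<^sub>E {..<N}. x ^ card (v ` insert p I)) =
      (\<Sum>(a, v)\<in>{..<N} \<times> (I \<rightarrow>\<^sub>E {..<N}). x ^ card ((v(p := a)) ` insert p I))"
    unfolding PiE_insert_eq
    using insert.hyps(2) by (subst sum.reindex[OF inj_combinator]) (auto simp: case_prod_unfold)
  also have "\<dots> = (\<Sum>v\<in>I \<rightarrow>\<^sub>E {..<N}. \<Sum>a<N. x ^ card (insert a (v ` I)))"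
  proof -
    have "(v(p := a)) ` insert p I = insert a (v ` I)" for a :: nat and v
      using insert.hyps(2) by auto
    then show ?thesis by (simp add: sum.cartesian_product[symmetric] sum.swap[of _ "{..<N}"])
  qed
  also have "\<dots> \<le> (\<Sum>v\<in>I \<rightarrow>\<^sub>E {..<N}. (real n + real N * x) * x ^ card (v ` I))"
  proof (rule sum_mono)
    fix v assume "v \<in> I \<rightarrow>\<^sub>E {..<N}"
    have fin: "finite (v ` I)" using insert by simp
    have "(\<Sum>a<N. x ^ card (insert a (v ` I))) \<le>
        (\<Sum>a<N. (if a \<in> v ` I then x ^ card (v ` I) else 0) + x * x ^ card (v ` I))"
      using fin assms(3) by (intro sum_mono) (auto simp: insert_absorb card_insert_if)
    also have "\<dots> = real (card ({..<N} \<inter> v ` I)) * x ^ card (v ` I) + real N * (x * x ^ card (v ` I))"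
      by (simp add: sum.distrib sum.If_cases)
    also have "\<dots> \<le> real n * x ^ card (v ` I) + real N * (x * x ^ card (v ` I))"
    proof -
      have "card ({..<N} \<inter> v ` I) \<le> card (v ` I)"
        using fin by (intro card_mono) auto
      also have "\<dots> \<le> n"
        using card_image_le[of I v] insert by simp
      finally show ?thesis
        using assms(3) by (intro add_right_mono mult_right_mono) auto
    qed
    finally show "(\<Sum>a<N. x ^ card (insert a (v ` I))) \<le> (real n + real N * x) * x ^ card (v ` I)"
      by (simp add: algebra_simps)
  qed
  also have "\<dots> \<le> (real n + real N * x) * (real n + real N * x) ^ card I"
    unfolding sum_distrib_left[symmetric]
    using insert assms(3) by (intro mult_left_mono insert.IH) auto
  finally show ?case using insert by simp
qed simp

text \<open>
  The edge at position \<open>p\<close> of a closed path joins \<open>v p\<close> and \<open>v (nx p)\<close>; it is oriented so that the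
  permutation belonging to the letter \<open>lab p\<close> maps its source to its target.
\<close>

definition path_edge :: "('p \<Rightarrow> 'r \<times> bool) \<Rightarrow> ('p \<Rightarrow> 'p) \<Rightarrow> ('p \<Rightarrow> 'v) \<Rightarrow> 'p \<Rightarrow> 'v \<times> 'v" where
  "path_edge lab nx v p = (if snd (lab p) then (v p, v (nx p)) else (v (nx p), v p))"

definition path_edges :: "('p \<Rightarrow> 'r \<times> bool) \<Rightarrow> ('p \<Rightarrow> 'p) \<Rightarrow> 'p set \<Rightarrow> ('p \<Rightarrow> 'v) \<Rightarrow> 'r \<Rightarrow> ('v \<times> 'v) set" where
  "path_edges lab nx I v r = path_edge lab nx v ` {p\<in>I. fst (lab p) = r}"

text \<open>
  By reducedness every vertex is an endpoint of two different half-edges, hence the path has at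
  least as many edges as vertices.
\<close>

lemma card_vertices_le_card_edges:
  assumes "finite I" "finite J" "fst ` lab ` I \<subseteq> J" "nx ` I = I"
    and reduced: "\<And>p. p \<in> I \<Longrightarrow> lab (nx p) \<noteq> apsnd Not (lab p)"
  shows "card (v ` I) \<le> (\<Sum>r\<in>J. card (path_edges lab nx I v r))"
proof -
  \<comment> \<open>The tag keeps equal vertex pairs apart when they belong to different
    permutations.\<close>
  define E where "E = (\<lambda>p. (fst (lab p), path_edge lab nx v p)) ` I"
  have finE: "finite E" using assms(1) by (simp add: E_def)
  have "E = Sigma J (path_edges lab nx I v)"
    using assms(3) by (auto simp: E_def path_edges_def)
  moreover have "finite (path_edges lab nx I v r)" for r
    using assms(1) by (simp add: path_edges_def)
  ultimately have card_E: "card E = (\<Sum>r\<in>J. card (path_edges lab nx I v r))"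
    using assms(2) by simp
  define endp where "endp = (\<lambda>((r :: 'b, e), s). if s then fst e else snd e :: 'c)"
  let ?h = "\<lambda>y. {h \<in> E \<times> (UNIV :: bool set). endp h = y}"
  have "2 \<le> card (?h y)" if "y \<in> v ` I" for y
  proof -
    obtain p where p: "p \<in> I" "y = v p" using \<open>y \<in> v ` I\<close> by blast
    then have "p \<in> nx ` I" using assms(4) by simp
    then obtain p' where p': "p' \<in> I" "nx p' = p" by auto
    let ?h1 = "((fst (lab p), path_edge lab nx v p), snd (lab p))"
    let ?h2 = "((fst (lab p'), path_edge lab nx v p'), \<not> snd (lab p'))"
    have sub: "{?h1, ?h2} \<subseteq> ?h y"
      using p p' by (auto simp: E_def endp_def path_edge_def)
    \<comment> \<open>Were they equal, the letters at \<open>p\<close> and \<open>p'\<close> would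
      have the same index and opposite flags, so the letter at \<open>p\<close> would be the inverse
      of its predecessor.\<close>
    have "?h1 \<noteq> ?h2"
      using reduced[OF p'(1)] p'(2) by (auto simp: prod_eq_iff)
    then have "card {?h1, ?h2} = 2" by simp
    moreover have "finite (?h y)" using finE by simp
    ultimately show ?thesis using card_mono[OF _ sub] by simp
  qed
  then have "(\<Sum>y\<in>v ` I. 2) \<le> (\<Sum>y\<in>v ` I. card (?h y))"
    by (intro sum_mono) auto
  also have "\<dots> = card (\<Union>y\<in>v ` I. ?h y)"
    using finE assms(1) by (subst card_UN_disjoint) auto
  also have "\<dots> \<le> card (E \<times> (UNIV :: bool set))"
    using finE by (intro card_mono) auto
  finally show ?thesis by (simp add: card_E card_cartesian_product)
qed

text \<open>A fixed path prescribes as many values of the permutations as it has distinct edges, so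
  it is compatible with at most a fraction x^(number of edges) of them. This exponent is at least
  the number of vertices, and the sum over all paths is then bounded.\<close>

lemma closed_paths_bound:
  fixes lab :: "'p \<Rightarrow> 'r \<times> bool"
  assumes "finite I" "finite J" "fst ` lab ` I \<subseteq> J" "nx ` I = I" "I \<noteq> {}"
    and reduced: "\<And>p. p \<in> I \<Longrightarrow> lab (nx p) \<noteq> apsnd Not (lab p)"
    and N: "2 * card I \<le> N"
  shows "(\<Sum>v\<in>I \<rightarrow>\<^sub>E {..<N}. real (card {\<sigma>\<in>J \<rightarrow>\<^sub>E {\<sigma>. \<sigma> permutes {..<N}}.
            \<forall>p\<in>I. case path_edge lab nx v p of (a, b) \<Rightarrow> \<sigma> (fst (lab p)) a = b}))
         \<le> (real (card I) + 2) ^ card I * fact N ^ card J" (is "?L \<le> _")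
proof -
  define n where "n = card I"
  \<comment> \<open>As N is at least 2n, each prescribed value costs a factor N - n, which is at
    least N/2 = 1/x. In the final bound N * x = 2.\<close>
  define x where "x = 2 / real N"
  have n: "n > 0" using assms by (simp add: n_def card_gt_0_iff)
  have x: "0 \<le> x" "x \<le> 1" using N n by (auto simp: x_def n_def)
  have "?L \<le> (\<Sum>v\<in>I \<rightarrow>\<^sub>E {..<N}. fact N ^ card J * x ^ card (v ` I))"
  proof (rule sum_mono)
    fix v assume v: "v \<in> I \<rightarrow>\<^sub>E {..<N}"
    let ?E = "path_edges lab nx I v"
    let ?S = "\<lambda>E. {\<sigma>. \<sigma> permutes {..<N} \<and> (\<forall>(a, b)\<in>E. \<sigma> a = b)}"
    have E: "finite (?E r)" "?E r \<subseteq> {..<N} \<times> {..<N}" "card (?E r) \<le> n" for r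
    proof -
      show "finite (?E r)" using assms by (simp add: path_edges_def)
      show "?E r \<subseteq> {..<N} \<times> {..<N}"
        using v assms(4) by (force simp: path_edges_def path_edge_def)
      have "card (?E r) \<le> card {p\<in>I. fst (lab p) = r}"
        unfolding path_edges_def using assms by (intro card_image_le) auto
      also have "\<dots> \<le> n" unfolding n_def using assms by (intro card_mono) auto
      finally show "card (?E r) \<le> n" .
    qed
    have S: "real (card (?S (?E r))) \<le> fact N * x ^ card (?E r)" for r
    proof -
      have "real (card (?S (?E r)) * (N - n) ^ card (?E r)) \<le> real (fact N)"
        using card_permutes_extending[OF E] by (intro of_nat_mono)
      then have 1: "real (card (?S (?E r))) * (real N - real n) ^ card (?E r) \<le> fact N"
        using N n by (simp add: n_def of_nat_diff)
      have "1 / x \<le> real N - real n" using N n by (simp add: x_def n_def)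
      then have "(1 / x) ^ card (?E r) \<le> (real N - real n) ^ card (?E r)"
        using x by (intro power_mono) auto
      then have "real (card (?S (?E r))) * (1 / x) ^ card (?E r) \<le> fact N"
        using 1 by (meson mult_left_mono of_nat_0_le_iff order_trans)
      then show ?thesis using N n by (simp add: power_divide field_simps x_def n_def)
    qed
    \<comment> \<open>Constraints with different labels concern different permutations, so the set
      of compatible families is a product over \<open>J\<close>.\<close>
    have "{\<sigma>\<in>J \<rightarrow>\<^sub>E {\<sigma>. \<sigma> permutes {..<N}}.
        \<forall>p\<in>I. case path_edge lab nx v p of (a, b) \<Rightarrow> \<sigma> (fst (lab p)) a = b} = (\<Pi>\<^sub>E r\<in>J. ?S (?E r))"
    proof -
      let ?Q = "\<lambda>\<sigma> p. case path_edge lab nx v p of (a, b) \<Rightarrow> \<sigma> a = b"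
      have iff: "(\<forall>(a, b)\<in>?E r. \<sigma> a = b) \<longleftrightarrow> (\<forall>p\<in>I. fst (lab p) = r \<longrightarrow> ?Q \<sigma> p)"
        for r and \<sigma> :: "nat \<Rightarrow> nat"
        by (auto simp: path_edges_def)
      show ?thesis
      proof (intro Set.set_eqI iffI)
        fix \<sigma> assume "\<sigma> \<in> {\<sigma>\<in>J \<rightarrow>\<^sub>E {\<sigma>. \<sigma> permutes {..<N}}. \<forall>p\<in>I. ?Q (\<sigma> (fst (lab p))) p}"
        then show "\<sigma> \<in> (\<Pi>\<^sub>E r\<in>J. ?S (?E r))" unfolding iff PiE_iff by auto
      next
        fix \<sigma> assume "\<sigma> \<in> (\<Pi>\<^sub>E r\<in>J. ?S (?E r))"
        then have *: "\<forall>r\<in>J. \<sigma> r permutes {..<N} \<and> (\<forall>p\<in>I. fst (lab p) = r \<longrightarrow> ?Q (\<sigma> r) p)" "\<sigma> \<in> extensional J"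
          unfolding iff PiE_iff by simp_all
        then have "\<sigma> \<in> J \<rightarrow>\<^sub>E {\<sigma>. \<sigma> permutes {..<N}}"
          unfolding PiE_iff by blast
        moreover have "\<forall>p\<in>I. ?Q (\<sigma> (fst (lab p))) p"
        proof
          fix p assume p: "p \<in> I"
          then have "fst (lab p) \<in> J" using assms(3) by blast
          then show "?Q (\<sigma> (fst (lab p))) p"
            by (rule *(1)[THEN bspec, THEN conjunct2, THEN bspec, OF _ p, THEN mp, OF _ refl])
        qed
        ultimately show "\<sigma> \<in> {\<sigma>\<in>J \<rightarrow>\<^sub>E {\<sigma>. \<sigma> permutes {..<N}}. \<forall>p\<in>I. ?Q (\<sigma> (fst (lab p))) p}"
          by (intro CollectI conjI)
      qed
    qed
    then have "real (card {\<sigma>\<in>J \<rightarrow>\<^sub>E {\<sigma>. \<sigma> permutes {..<N}}.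
        \<forall>p\<in>I. case path_edge lab nx v p of (a, b) \<Rightarrow> \<sigma> (fst (lab p)) a = b}) =
        (\<Prod>r\<in>J. real (card (?S (?E r))))"
      using assms(2) by (simp add: card_PiE)
    also have "\<dots> \<le> (\<Prod>r\<in>J. fact N * x ^ card (?E r))"
      by (intro prod_mono conjI S) auto
    also have "\<dots> = fact N ^ card J * x ^ (\<Sum>r\<in>J. card (?E r))"
      by (simp add: prod.distrib power_sum)
    also have "\<dots> \<le> fact N ^ card J * x ^ card (v ` I)"
      using card_vertices_le_card_edges[OF assms(1-4) reduced] x
      by (intro mult_left_mono power_decreasing) auto
    finally show "real (card {\<sigma>\<in>J \<rightarrow>\<^sub>E {\<sigma>. \<sigma> permutes {..<N}}.
        \<forall>p\<in>I. case path_edge lab nx v p of (a, b) \<Rightarrow> \<sigma> (fst (lab p)) a = b})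
        \<le> fact N ^ card J * x ^ card (v ` I)" .
  qed
  also have "\<dots> = fact N ^ card J * (\<Sum>v\<in>I \<rightarrow>\<^sub>E {..<N}. x ^ card (v ` I))"
    by (simp add: sum_distrib_left)
  also have "\<dots> \<le> fact N ^ card J * (real n + real N * x) ^ n"
    using sum_power_card_image_le[OF assms(1) _ x(1), of n N] by (intro mult_left_mono) (auto simp: n_def)
  also have "real N * x = 2" using N n by (simp add: x_def n_def)
  finally show ?thesis by (simp add: n_def mult_ac)
qed

section \<open>Fixed points of words as closed paths\<close>

definition perm_action :: "('r \<Rightarrow> nat \<Rightarrow> nat) \<Rightarrow> ('r \<times> bool) list \<Rightarrow> nat \<Rightarrow> nat" where
  "perm_action \<sigma> w = foldr (\<lambda>(r, b). (\<circ>) (if b then inv_into UNIV (\<sigma> r) else \<sigma> r)) w id"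

lemma perm_action_simps [simp]:
  "perm_action \<sigma> [] = id"
  "perm_action \<sigma> ((r, b) # w) = (if b then inv_into UNIV (\<sigma> r) else \<sigma> r) \<circ> perm_action \<sigma> w"
  by (auto simp: perm_action_def)

lemma perm_action_permutes:
  assumes "\<And>r. r \<in> fst ` set w \<Longrightarrow> \<sigma> r permutes A"
  shows "perm_action \<sigma> w permutes A"
  using assms
proof (induction w)
  case (Cons l w)
  obtain r b where l: "l = (r, b)" by (cases l)
  have "(if b then inv_into UNIV (\<sigma> r) else \<sigma> r) permutes A"
    using Cons.prems by (auto simp: l intro: permutes_inv)
  moreover have "perm_action \<sigma> w permutes A"
    using Cons by simp
  ultimately show ?case unfolding l perm_action_simps by (rule permutes_compose[rotated])
qed (auto simp: permutes_id)

text \<open>The last letter is compared with the first. The empty word and all words of one letter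
  qualify, as no letter is its own inverse.\<close>

definition cyclically_reduced :: "('i \<times> bool) list \<Rightarrow> bool" where
  "cyclically_reduced w \<longleftrightarrow> (\<forall>t<length w. w ! (Suc t mod length w) \<noteq> apsnd Not (w ! t))"

text \<open>The square of the number of fixed points counts pairs of fixed points, and each pair
  gives two closed paths along \<open>w\<close>. Treated as one path system with
  \<open>2 * length w\<close> positions, these are covered by the bound for closed paths.\<close>

lemma fixed_points_second_moment:
  fixes w :: "('r \<times> bool) list"
  assumes "finite J" "fst ` set w \<subseteq> J" "w \<noteq> []" "cyclically_reduced w" "4 * length w \<le> N"
  shows "(\<Sum>\<sigma>\<in>J \<rightarrow>\<^sub>E {\<sigma>. \<sigma> permutes {..<N}}. real (card {x\<in>{..<N}. perm_action \<sigma> w x = x}) ^ 2)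
    \<le> (real (2 * length w) + 2) ^ (2 * length w) * fact N ^ card J"
proof -
  let ?\<Sigma> = "J \<rightarrow>\<^sub>E {\<sigma>. \<sigma> permutes {..<N}}"
  define m where "m = length w"
  have m: "m > 0" using assms by (simp add: m_def)
  \<comment> \<open>Two disjoint cycles of positions, one for each fixed point of the pair.\<close>
  define I where "I = {..<m} \<times> (UNIV :: bool set)"
  define lab where "lab = (\<lambda>p :: nat \<times> bool. w ! fst p)"
  define nx where "nx = (\<lambda>p :: nat \<times> bool. (Suc (fst p) mod m, snd p))"
  have I: "finite I" "I \<noteq> {}" "card I = 2 * m"
    using m by (auto simp: I_def card_cartesian_product)
  have labJ: "fst ` lab ` I \<subseteq> J"
    using assms(2) by (auto simp: lab_def I_def m_def image_subset_iff)
  have nx: "nx ` I = I"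
  proof (intro equalityI subsetI)
    fix p assume "p \<in> I"
    obtain t c where p: "p = (t, c)" by (cases p)
    have t: "t < m" using \<open>p \<in> I\<close> by (simp add: I_def p)
    \<comment> \<open>Adding m - 1 gives the predecessor modulo m also for t = 0, where
      \<open>t - 1\<close> would be truncated.\<close>
    have "p = nx ((t + (m - 1)) mod m, c)"
      using t m by (simp add: nx_def p mod_Suc_eq)
    then show "p \<in> nx ` I" using m by (auto simp: I_def)
  qed (use m in \<open>auto simp: nx_def I_def\<close>)
  have red: "lab (nx p) \<noteq> apsnd Not (lab p)" if "p \<in> I" for p
    using assms(4) that by (auto simp: cyclically_reduced_def lab_def nx_def I_def m_def)
  let ?C = "\<lambda>\<sigma> v. \<forall>p\<in>I. case path_edge lab nx v p of (a, b) \<Rightarrow> \<sigma> (fst (lab p)) a = b"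
  have fin\<Sigma>: "finite ?\<Sigma>" using assms by (intro finite_PiE) (auto simp: finite_permutations)
  have finV: "finite (I \<rightarrow>\<^sub>E {..<N})" using I by (intro finite_PiE) auto
  have "(\<Sum>\<sigma>\<in>?\<Sigma>. real (card {x\<in>{..<N}. perm_action \<sigma> w x = x}) ^ 2)
      \<le> (\<Sum>\<sigma>\<in>?\<Sigma>. real (card {v\<in>I \<rightarrow>\<^sub>E {..<N}. ?C \<sigma> v}))"
  proof (rule sum_mono)
    fix \<sigma> assume \<sigma>: "\<sigma> \<in> ?\<Sigma>"
    let ?F = "{x\<in>{..<N}. perm_action \<sigma> w x = x}"
    \<comment> \<open>A word acts from the right, so the vertex at position t is the image of the
      fixed point under the suffix from t on.\<close>
    define v where "v = (\<lambda>z. \<lambda>p\<in>I. perm_action \<sigma> (drop (fst p) w) (if snd p then fst z else snd z :: nat))"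
    have perm: "\<sigma> r permutes {..<N}" if "r \<in> fst ` set w" for r
      using \<sigma> that assms(2) by (auto simp: PiE_iff)
    have "card (?F \<times> ?F) \<le> card {v\<in>I \<rightarrow>\<^sub>E {..<N}. ?C \<sigma> v}"
    proof (rule card_inj_on_le[where f = v])
      show "inj_on v (?F \<times> ?F)"
      proof (rule inj_onI)
        fix z z' assume z: "z \<in> ?F \<times> ?F" "z' \<in> ?F \<times> ?F" and eq: "v z = v z'"
        \<comment> \<open>At position 0 the whole word acts and fixes its starting point, so a path
          determines the pair it comes from.\<close>
        have v0: "v z (0, c) = (if c then fst z else snd z)" if "z \<in> ?F \<times> ?F" for z c
          using that m by (auto simp: v_def I_def)
        show "z = z'"
          using v0[OF z(1), of True] v0[OF z(2), of True] v0[OF z(1), of False] v0[OF z(2), of False] eq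
          by (simp add: prod_eq_iff)
      qed
      show "v ` (?F \<times> ?F) \<subseteq> {v\<in>I \<rightarrow>\<^sub>E {..<N}. ?C \<sigma> v}"
      proof
        fix u assume "u \<in> v ` (?F \<times> ?F)"
        then obtain x y where u: "u = v (x, y)"
          and xy: "x < N" "perm_action \<sigma> w x = x" "y < N" "perm_action \<sigma> w y = y" by auto
        have "perm_action \<sigma> (drop t w) permutes {..<N}" for t
          using perm by (intro perm_action_permutes) (auto dest: in_set_dropD)
        then have u_in: "u \<in> I \<rightarrow>\<^sub>E {..<N}"
          using xy permutes_in_image[of _ "{..<N}"] by (auto simp: v_def u)
        have C: "case path_edge lab nx u (t, c) of (a, b) \<Rightarrow> \<sigma> (fst (lab (t, c))) a = b"
          if p: "(t, c) \<in> I" for t c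
        proof -
        define z where "z = (if c then x else y)"
        have z: "perm_action \<sigma> w z = z" using xy by (simp add: z_def)
        have t: "t < m" using p by (simp add: I_def)
        obtain r d where rd: "w ! t = (r, d)" by (cases "w ! t")
        have drop: "drop t w = (r, d) # drop (Suc t) w"
          using Cons_nth_drop_Suc[of t w] t rd by (simp add: m_def)
        have v1: "v (x, y) (t, c) = perm_action \<sigma> (drop t w) z"
          using p by (simp add: v_def z_def)
        \<comment> \<open>Closing the path is where the fixed-point property enters: at t = m - 1
          the next position is 0, with the whole word in place of the empty suffix.\<close>
        have v2: "v (x, y) (nx (t, c)) = perm_action \<sigma> (drop (Suc t) w) z"
        proof (cases "Suc t = m")
          case True
          then show ?thesis using xy m by (cases c) (simp_all add: v_def nx_def I_def z_def m_def)
        next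
          case False
          then show ?thesis using t by (simp add: v_def nx_def I_def z_def)
        qed
        have "\<sigma> r permutes {..<N}"
          using nth_mem[of t w] rd t by (intro perm rev_image_eqI[of "(r, d)"]) (simp_all add: m_def)
        then have inv: "\<sigma> r (inv_into UNIV (\<sigma> r) y) = y" for y
          by (rule permutes_inverses(1))
        show ?thesis
          unfolding path_edge_def u v1 v2 by (auto simp: lab_def rd drop inv)
        qed
        have "?C \<sigma> u"
        proof
          fix p assume "p \<in> I"
          then show "case path_edge lab nx u p of (a, b) \<Rightarrow> \<sigma> (fst (lab p)) a = b"
            using C[of "fst p" "snd p"] by simp
        qed
        with u_in show "u \<in> {v\<in>I \<rightarrow>\<^sub>E {..<N}. ?C \<sigma> v}" by (intro CollectI conjI)
      qed
    qed (use finV in simp)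
    then show "real (card ?F) ^ 2 \<le> real (card {v\<in>I \<rightarrow>\<^sub>E {..<N}. ?C \<sigma> v})"
      by (simp add: card_cartesian_product power2_eq_square del: of_nat_mult flip: of_nat_mult)
  qed
  also have "\<dots> = (\<Sum>\<sigma>\<in>?\<Sigma>. \<Sum>v\<in>I \<rightarrow>\<^sub>E {..<N}. of_bool (?C \<sigma> v))"
    using finV by (simp add: Int_def)
  also have "\<dots> = (\<Sum>v\<in>I \<rightarrow>\<^sub>E {..<N}. \<Sum>\<sigma>\<in>?\<Sigma>. of_bool (?C \<sigma> v))"
    by (rule sum.swap)
  also have "\<dots> = (\<Sum>v\<in>I \<rightarrow>\<^sub>E {..<N}. real (card {\<sigma>\<in>?\<Sigma>. ?C \<sigma> v}))"
    using fin\<Sigma> by (simp add: Int_def)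
  also have "\<dots> \<le> (real (card I) + 2) ^ card I * fact N ^ card J"
    using closed_paths_bound[OF I(1) assms(1) labJ nx I(2) red, of N] assms(5) by (simp add: I m_def)
  finally show ?thesis by (simp add: I(3) m_def)
qed

section \<open>Gaussian integration by parts\<close>

text \<open>Integration by parts on monomials, for variance 1/2. It is read off from the closed form
  of the even moments, consecutive ones having quotient (2k+1)/2. For n = 0 the factor
  \<open>real n\<close> makes the value of \<open>n - 1\<close> irrelevant.\<close>

lemma gaussian_half_moments:
  assumes "prob_space P" "distributed P lborel X (normal_density 0 (sqrt (1/2)))"
  shows "integrable P (\<lambda>\<omega>. X \<omega> ^ n)"
    and "(\<integral>\<omega>. X \<omega> ^ Suc n \<partial>P) = real n / 2 * (\<integral>\<omega>. X \<omega> ^ (n - 1) \<partial>P)"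
proof -
  interpret prob_space P by fact
  let ?\<sigma> = "sqrt (1/2)"
  have int: "has_bochner_integral lborel (\<lambda>x. normal_density 0 ?\<sigma> x * x ^ (2 * k)) (fact (2 * k) / (4 ^ k * fact k))" for k
    using normal_moment_even[of ?\<sigma> 0 k] by simp
  have int': "has_bochner_integral lborel (\<lambda>x. normal_density 0 ?\<sigma> x * x ^ Suc (2 * k)) 0" for k
    using normal_moment_odd[of ?\<sigma> 0 k] by simp
  have "integrable lborel (\<lambda>x. normal_density 0 ?\<sigma> x * x ^ n)" for n
  proof (cases "even n")
    case True
    then show ?thesis using int by (auto elim!: evenE intro: integrable.intros)
  next
    case False
    then obtain k where "n = Suc (2 * k)" by (auto elim!: oddE)
    then show ?thesis using integrable.intros[OF int'[of k]] by simp
  qed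
  then show "integrable P (\<lambda>\<omega>. X \<omega> ^ n)"
    using distributed_integrable[OF assms(2), of "\<lambda>x. x ^ n"] by simp
  have E: "(\<integral>\<omega>. X \<omega> ^ n \<partial>P) = (\<integral>x. normal_density 0 ?\<sigma> x * x ^ n \<partial>lborel)" for n
    using distributed_integral[OF assms(2), of "\<lambda>x. x ^ n"] by simp
  have even: "(\<integral>\<omega>. X \<omega> ^ (2 * k) \<partial>P) = fact (2 * k) / (4 ^ k * fact k)" for k
    unfolding E using int by (rule has_bochner_integral_integral_eq)
  have odd: "(\<integral>\<omega>. X \<omega> ^ Suc (2 * k) \<partial>P) = 0" for k
    unfolding E using int' by (rule has_bochner_integral_integral_eq)
  show "(\<integral>\<omega>. X \<omega> ^ Suc n \<partial>P) = real n / 2 * (\<integral>\<omega>. X \<omega> ^ (n - 1) \<partial>P)"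
  proof (cases "even n")
    case True
    then obtain k where k: "n = 2 * k" by (elim evenE)
    show ?thesis
    proof (cases k)
      case 0
      then show ?thesis using odd[of 0] k by simp
    next
      case (Suc j)
      then show ?thesis using odd[of k] odd[of j] k by simp
    qed
  next
    case False
    then obtain k where k: "n = Suc (2 * k)" by (auto elim!: oddE)
    have "(\<integral>\<omega>. X \<omega> ^ Suc n \<partial>P) = fact (2 * Suc k) / (4 ^ Suc k * fact (Suc k))"
      using even[of "Suc k"] by (simp add: k)
    also have "\<dots> = real (Suc (2 * k)) / 2 * (fact (2 * k) / (4 ^ k * fact k))"
    proof -
      have "fact (2 * Suc k) = 2 * real (Suc k) * real (Suc (2 * k)) * fact (2 * k)"
        by (simp add: algebra_simps)
      moreover have "fact (Suc k) = real (Suc k) * fact k" by simp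
      ultimately show ?thesis
        by (simp only: power_Suc) (simp add: divide_simps del: fact_Suc of_nat_Suc)
    qed
    also have "\<dots> = real n / 2 * (\<integral>\<omega>. X \<omega> ^ (n - 1) \<partial>P)"
      using even[of k] by (simp add: k)
    finally show ?thesis .
  qed
qed

text \<open>
  Integration by parts in the real and in the imaginary part of \<open>z\<close>, for mixed monomials in
  \<open>Re z\<close>, \<open>Im z\<close>, \<open>z\<close> and \<open>cnj z\<close>: this makes an induction on the degree in \<open>z\<close>, \<open>cnj z\<close> possible.
\<close>

lemma complex_gaussian_mixed_moments:
  fixes z :: "'w \<Rightarrow> complex"
  assumes "prob_space P" "complex_std_gaussian P z"
  defines "F \<equiv> \<lambda>p q a b \<omega>. complex_of_real (Re (z \<omega>)) ^ p * complex_of_real (Im (z \<omega>)) ^ q * z \<omega> ^ a * cnj (z \<omega>) ^ b"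
  shows "integrable P (F p q a b)"
    and "integral\<^sup>L P (F (Suc p) q a b) = of_nat p / 2 * integral\<^sup>L P (F (p - 1) q a b) +
      of_nat a / 2 * integral\<^sup>L P (F p q (a - 1) b) + of_nat b / 2 * integral\<^sup>L P (F p q a (b - 1))"
    and "integral\<^sup>L P (F p (Suc q) a b) = of_nat q / 2 * integral\<^sup>L P (F p (q - 1) a b) +
      \<i> * of_nat a / 2 * integral\<^sup>L P (F p q (a - 1) b) - \<i> * of_nat b / 2 * integral\<^sup>L P (F p q a (b - 1))"
proof -
  interpret prob_space P by fact
  define X where "X = (\<lambda>\<omega>. Re (z \<omega>))"
  define Y where "Y = (\<lambda>\<omega>. Im (z \<omega>))"
  have ind: "indep_var borel X borel Y"
    and X: "distributed P lborel X (normal_density 0 (sqrt (1/2)))"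
    and Y: "distributed P lborel Y (normal_density 0 (sqrt (1/2)))"
    using assms(2) by (auto simp: complex_std_gaussian_def X_def Y_def)
  note mX = gaussian_half_moments[OF assms(1) X]
  note mY = gaussian_half_moments[OF assms(1) Y]
  have ind': "indep_var borel (\<lambda>\<omega>. complex_of_real (X \<omega>) ^ p) borel (\<lambda>\<omega>. complex_of_real (Y \<omega>) ^ q)" for p q
    using indep_var_compose[OF ind, of "\<lambda>x. complex_of_real x ^ p" borel "\<lambda>x. complex_of_real x ^ q" borel]
    by (simp add: comp_def)
  have iX: "integrable P (\<lambda>\<omega>. complex_of_real (X \<omega>) ^ p)" for p
    by (subst of_real_power[symmetric]) (rule integrable_of_real[OF mX(1)])
  have iY: "integrable P (\<lambda>\<omega>. complex_of_real (Y \<omega>) ^ p)" for p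
    by (subst of_real_power[symmetric]) (rule integrable_of_real[OF mY(1)])
  have EX: "(\<integral>\<omega>. complex_of_real (X \<omega>) ^ p \<partial>P) = complex_of_real (\<integral>\<omega>. X \<omega> ^ p \<partial>P)" for p
    using integral_complex_of_real[of P "\<lambda>\<omega>. X \<omega> ^ p"] by simp
  have EY: "(\<integral>\<omega>. complex_of_real (Y \<omega>) ^ p \<partial>P) = complex_of_real (\<integral>\<omega>. Y \<omega> ^ p \<partial>P)" for p
    using integral_complex_of_real[of P "\<lambda>\<omega>. Y \<omega> ^ p"] by simp
  have E: "(\<integral>\<omega>. complex_of_real (X \<omega>) ^ p * complex_of_real (Y \<omega>) ^ q \<partial>P) =
      complex_of_real (\<integral>\<omega>. X \<omega> ^ p \<partial>P) * complex_of_real (\<integral>\<omega>. Y \<omega> ^ q \<partial>P)" for p q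
    using indep_var_lebesgue_integral[OF ind' iX iY] by (simp add: EX EY)
  have zXY: "z \<omega> = complex_of_real (X \<omega>) + \<i> * complex_of_real (Y \<omega>)"
    "cnj (z \<omega>) = complex_of_real (X \<omega>) - \<i> * complex_of_real (Y \<omega>)" for \<omega>
    by (auto simp: X_def Y_def complex_eq_iff)
  have F0: "F p q 0 0 = (\<lambda>\<omega>. complex_of_real (X \<omega>) ^ p * complex_of_real (Y \<omega>) ^ q)" for p q
    by (simp add: F_def X_def Y_def)
  \<comment> \<open>Writing z = X + iY trades one factor z for X or Y; this lowers the degree in z
    and its conjugate, until independence of X and Y can be used.\<close>
  have Fa: "F p q (Suc a) b = (\<lambda>\<omega>. F (Suc p) q a b \<omega> + \<i> * F p (Suc q) a b \<omega>)"
    and Fb: "F p q a (Suc b) = (\<lambda>\<omega>. F (Suc p) q a b \<omega> - \<i> * F p (Suc q) a b \<omega>)" for p q a b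
    by (auto simp: F_def zXY fun_eq_iff algebra_simps simp flip: X_def Y_def)
  have int0: "integrable P (F p q 0 0)" for p q
    unfolding F0 using indep_var_integrable[OF ind' iX iY] .
  have int1: "integrable P (F p q a 0)" for p q a
    by (induction a arbitrary: p q) (auto simp: int0 Fa)
  have int: "integrable P (F p q a b)" for p q a b
    by (induction b arbitrary: p q) (auto simp: int1 Fb)
  then show "integrable P (F p q a b)" .
  define e where "e p q a b = integral\<^sup>L P (F p q a b)" for p q a b
  have ea: "e p q (Suc a) b = e (Suc p) q a b + \<i> * e p (Suc q) a b"
    and eb: "e p q a (Suc b) = e (Suc p) q a b - \<i> * e p (Suc q) a b" for p q a b
    by (simp_all add: e_def Fa Fb int)
  \<comment> \<open>The coefficients in front absorb the truncation of \<open>p - 1\<close> and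
    \<open>q - 1\<close> at 0.\<close>
  have h1: "of_nat p * e (p - 1) q (Suc a) b = of_nat p * (e p q a b + \<i> * e (p - 1) (Suc q) a b)"
    "of_nat q * e p (q - 1) (Suc a) b = of_nat q * (e (Suc p) (q - 1) a b + \<i> * e p q a b)"
    "of_nat p * e (p - 1) q a (Suc b) = of_nat p * (e p q a b - \<i> * e (p - 1) (Suc q) a b)"
    "of_nat q * e p (q - 1) a (Suc b) = of_nat q * (e (Suc p) (q - 1) a b - \<i> * e p q a b)" for p q a b
       apply (cases p; simp add: ea)
      apply (cases q; simp add: ea)
     apply (cases p; simp add: eb)
    apply (cases q; simp add: eb)
    done
  have h2: "of_nat a * e p q a b = of_nat a * (e (Suc p) q (a - 1) b + \<i> * e p (Suc q) (a - 1) b)"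
    "of_nat b * e p q a b = of_nat b * (e (Suc p) q a (b - 1) - \<i> * e p (Suc q) a (b - 1))" for p q a b
     apply (cases a; simp add: ea)
    apply (cases b; simp add: eb)
    done
  \<comment> \<open>The two equations need a common induction: expanding z raises p in one term and
    q in the other.\<close>
  have "2 * e (Suc p) q a b = of_nat p * e (p - 1) q a b +
      of_nat a * e p q (a - 1) b + of_nat b * e p q a (b - 1) \<and>
     2 * e p (Suc q) a b = of_nat q * e p (q - 1) a b +
      \<i> * of_nat a * e p q (a - 1) b - \<i> * of_nat b * e p q a (b - 1)" for p q a b
  proof (induction b arbitrary: p q)
    case 0
    show ?case
    proof (induction a arbitrary: p q)
      case 0
      have "2 * e (Suc p) q 0 0 = of_nat p * e (p - 1) q 0 0"
        unfolding e_def F0 E mX(2) by simp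
      moreover have "2 * e p (Suc q) 0 0 = of_nat q * e p (q - 1) 0 0"
        unfolding e_def F0 E mY(2) by simp
      ultimately show ?case by simp
    next
      case (Suc a)
      have IH: "2 * e (Suc (Suc p)) q a 0 = (of_nat p + 1) * e p q a 0 + of_nat a * e (Suc p) q (a - 1) 0"
        "2 * e (Suc p) (Suc q) a 0 = of_nat p * e (p - 1) (Suc q) a 0 + of_nat a * e p (Suc q) (a - 1) 0"
        "2 * e (Suc p) (Suc q) a 0 = of_nat q * e (Suc p) (q - 1) a 0 + \<i> * of_nat a * e (Suc p) q (a - 1) 0"
        "2 * e p (Suc (Suc q)) a 0 = (of_nat q + 1) * e p q a 0 + \<i> * of_nat a * e p (Suc q) (a - 1) 0"
        using Suc.IH[of "Suc p" q] Suc.IH[of p "Suc q"] by (simp_all add: algebra_simps)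
      have "2 * e (Suc p) q (Suc a) 0 = of_nat p * e (p - 1) q (Suc a) 0 + (of_nat a + 1) * e p q a 0"
      proof -
        have "2 * e (Suc p) q (Suc a) 0 = 2 * e (Suc (Suc p)) q a 0 + \<i> * (2 * e (Suc p) (Suc q) a 0)"
          by (simp add: ea distrib_left)
        also have "\<dots> = of_nat p * (e p q a 0 + \<i> * e (p - 1) (Suc q) a 0) +
            of_nat a * (e (Suc p) q (a - 1) 0 + \<i> * e p (Suc q) (a - 1) 0) + e p q a 0"
          unfolding IH(1,2) by (simp add: algebra_simps)
        finally show ?thesis unfolding h1 h2(1)[symmetric] by (simp add: algebra_simps)
      qed
      moreover have "2 * e p (Suc q) (Suc a) 0 = of_nat q * e p (q - 1) (Suc a) 0 + \<i> * (of_nat a + 1) * e p q a 0"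
      proof -
        have "2 * e p (Suc q) (Suc a) 0 = 2 * e (Suc p) (Suc q) a 0 + \<i> * (2 * e p (Suc (Suc q)) a 0)"
          by (simp add: ea distrib_left)
        also have "\<dots> = of_nat q * (e (Suc p) (q - 1) a 0 + \<i> * e p q a 0) +
            \<i> * (of_nat a * (e (Suc p) q (a - 1) 0 + \<i> * e p (Suc q) (a - 1) 0)) + \<i> * e p q a 0"
          unfolding IH(3,4) by (simp add: algebra_simps)
        finally show ?thesis unfolding h1 h2(1)[symmetric] by (simp add: algebra_simps)
      qed
      ultimately show ?case by (simp add: add.commute)
    qed
  next
    case (Suc b)
    have IH: "2 * e (Suc (Suc p)) q a b = (of_nat p + 1) * e p q a b +
        of_nat a * e (Suc p) q (a - 1) b + of_nat b * e (Suc p) q a (b - 1)"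
      "2 * e (Suc p) (Suc q) a b = of_nat p * e (p - 1) (Suc q) a b +
        of_nat a * e p (Suc q) (a - 1) b + of_nat b * e p (Suc q) a (b - 1)"
      "2 * e (Suc p) (Suc q) a b = of_nat q * e (Suc p) (q - 1) a b +
        \<i> * of_nat a * e (Suc p) q (a - 1) b - \<i> * of_nat b * e (Suc p) q a (b - 1)"
      "2 * e p (Suc (Suc q)) a b = (of_nat q + 1) * e p q a b +
        \<i> * of_nat a * e p (Suc q) (a - 1) b - \<i> * of_nat b * e p (Suc q) a (b - 1)"
      using Suc.IH[of "Suc p" q] Suc.IH[of p "Suc q"] by (simp_all add: algebra_simps)
    have "2 * e (Suc p) q a (Suc b) = of_nat p * e (p - 1) q a (Suc b) +
        of_nat a * e p q (a - 1) (Suc b) + (of_nat b + 1) * e p q a b"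
    proof -
      have "2 * e (Suc p) q a (Suc b) = 2 * e (Suc (Suc p)) q a b - \<i> * (2 * e (Suc p) (Suc q) a b)"
        by (simp add: eb right_diff_distrib)
      also have "\<dots> = of_nat p * (e p q a b - \<i> * e (p - 1) (Suc q) a b) +
          of_nat a * (e (Suc p) q (a - 1) b - \<i> * e p (Suc q) (a - 1) b) +
          of_nat b * (e (Suc p) q a (b - 1) - \<i> * e p (Suc q) a (b - 1)) + e p q a b"
        unfolding IH(1,2) by (simp add: algebra_simps)
      also have "e (Suc p) q (a - 1) b - \<i> * e p (Suc q) (a - 1) b = e p q (a - 1) (Suc b)"
        by (simp add: eb)
      finally show ?thesis unfolding h1 h2(2)[symmetric] by (simp add: algebra_simps)
    qed
    moreover have "2 * e p (Suc q) a (Suc b) = of_nat q * e p (q - 1) a (Suc b) +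
        \<i> * of_nat a * e p q (a - 1) (Suc b) - \<i> * (of_nat b + 1) * e p q a b"
    proof -
      have "2 * e p (Suc q) a (Suc b) = 2 * e (Suc p) (Suc q) a b - \<i> * (2 * e p (Suc (Suc q)) a b)"
        by (simp add: eb right_diff_distrib)
      also have "\<dots> = of_nat q * (e (Suc p) (q - 1) a b - \<i> * e p q a b) +
          \<i> * (of_nat a * (e (Suc p) q (a - 1) b - \<i> * e p (Suc q) (a - 1) b)) -
          \<i> * (of_nat b * (e (Suc p) q a (b - 1) - \<i> * e p (Suc q) a (b - 1))) - \<i> * e p q a b"
        unfolding IH(3,4) by (simp add: algebra_simps)
      also have "e (Suc p) q (a - 1) b - \<i> * e p (Suc q) (a - 1) b = e p q (a - 1) (Suc b)"
        by (simp add: eb)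
      finally show ?thesis unfolding h1 h2(2)[symmetric] by (simp add: algebra_simps)
    qed
    ultimately show ?case by (simp add: add.commute)
  qed
  then have *: "2 * e (Suc p) q a b = of_nat p * e (p - 1) q a b +
      of_nat a * e p q (a - 1) b + of_nat b * e p q a (b - 1)"
     "2 * e p (Suc q) a b = of_nat q * e p (q - 1) a b +
      \<i> * of_nat a * e p q (a - 1) b - \<i> * of_nat b * e p q a (b - 1)"
    by blast+
  have half: "x = y / 2" if "2 * x = y" for x y :: complex
    using that by (simp add: mult.commute)
  show "integral\<^sup>L P (F (Suc p) q a b) = of_nat p / 2 * integral\<^sup>L P (F (p - 1) q a b) +
      of_nat a / 2 * integral\<^sup>L P (F p q (a - 1) b) + of_nat b / 2 * integral\<^sup>L P (F p q a (b - 1))"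
    and "integral\<^sup>L P (F p (Suc q) a b) = of_nat q / 2 * integral\<^sup>L P (F p (q - 1) a b) +
      \<i> * of_nat a / 2 * integral\<^sup>L P (F p q (a - 1) b) - \<i> * of_nat b / 2 * integral\<^sup>L P (F p q a (b - 1))"
    using half[OF *(1)] half[OF *(2)] by (simp_all add: e_def add_divide_distrib diff_divide_distrib)
qed

text \<open>In the combination Re + i Im or Re - i Im of the two real identities, one of the
  derivatives in z and in its conjugate cancels and the other doubles. So z contracts only with its
  conjugate, with weight 2 * 1/2 = 1.\<close>

lemma complex_gaussian_moments:
  fixes z :: "'w \<Rightarrow> complex"
  assumes "prob_space P" "complex_std_gaussian P z"
  shows "integrable P (\<lambda>\<omega>. z \<omega> ^ a * cnj (z \<omega>) ^ b)"
    and "(\<integral>\<omega>. z \<omega> ^ a * cnj (z \<omega>) ^ Suc b \<partial>P) = of_nat a * (\<integral>\<omega>. z \<omega> ^ (a - 1) * cnj (z \<omega>) ^ b \<partial>P)"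
    and "(\<integral>\<omega>. z \<omega> ^ Suc a * cnj (z \<omega>) ^ b \<partial>P) = of_nat b * (\<integral>\<omega>. z \<omega> ^ a * cnj (z \<omega>) ^ (b - 1) \<partial>P)"
proof -
  note M = complex_gaussian_mixed_moments[OF assms]
  show "integrable P (\<lambda>\<omega>. z \<omega> ^ a * cnj (z \<omega>) ^ b)"
    using M(1)[of 0 0 a b] by simp
  define A where "A = (\<integral>\<omega>. z \<omega> ^ (a - 1) * cnj (z \<omega>) ^ b \<partial>P)"
  define B where "B = (\<integral>\<omega>. z \<omega> ^ a * cnj (z \<omega>) ^ (b - 1) \<partial>P)"
  have int: "integrable P (\<lambda>\<omega>. complex_of_real (Re (z \<omega>)) * z \<omega> ^ a * cnj (z \<omega>) ^ b)"
    "integrable P (\<lambda>\<omega>. complex_of_real (Im (z \<omega>)) * z \<omega> ^ a * cnj (z \<omega>) ^ b)"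
    using M(1)[of 1 0 a b] M(1)[of 0 1 a b] by simp_all
  have E: "(\<integral>\<omega>. complex_of_real (Re (z \<omega>)) * z \<omega> ^ a * cnj (z \<omega>) ^ b \<partial>P) = of_nat a / 2 * A + of_nat b / 2 * B"
    "(\<integral>\<omega>. complex_of_real (Im (z \<omega>)) * z \<omega> ^ a * cnj (z \<omega>) ^ b \<partial>P) =
      \<i> * of_nat a / 2 * A - \<i> * of_nat b / 2 * B"
    using M(2)[of 0 0 a b] M(3)[of 0 0 a b] by (simp_all add: A_def B_def)
  have cnj_z: "cnj (z \<omega>) = complex_of_real (Re (z \<omega>)) - \<i> * complex_of_real (Im (z \<omega>))" for \<omega>
    by (auto simp: complex_eq_iff)
  have z: "z \<omega> = complex_of_real (Re (z \<omega>)) + \<i> * complex_of_real (Im (z \<omega>))" for \<omega>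
    by (auto simp: complex_eq_iff)
  have "(\<integral>\<omega>. z \<omega> ^ a * cnj (z \<omega>) ^ Suc b \<partial>P) =
     (\<integral>\<omega>. complex_of_real (Re (z \<omega>)) * z \<omega> ^ a * cnj (z \<omega>) ^ b -
       \<i> * (complex_of_real (Im (z \<omega>)) * z \<omega> ^ a * cnj (z \<omega>) ^ b) \<partial>P)"
    by (intro Bochner_Integration.integral_cong refl) (subst power_Suc, subst cnj_z, simp add: algebra_simps)
  also have "\<dots> = of_nat a * (\<integral>\<omega>. z \<omega> ^ (a - 1) * cnj (z \<omega>) ^ b \<partial>P)"
    unfolding A_def[symmetric] B_def[symmetric] by (simp add: int E) (simp add: field_simps)?
  finally show "(\<integral>\<omega>. z \<omega> ^ a * cnj (z \<omega>) ^ Suc b \<partial>P) = of_nat a * (\<integral>\<omega>. z \<omega> ^ (a - 1) * cnj (z \<omega>) ^ b \<partial>P)" .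
  have "(\<integral>\<omega>. z \<omega> ^ Suc a * cnj (z \<omega>) ^ b \<partial>P) =
     (\<integral>\<omega>. complex_of_real (Re (z \<omega>)) * z \<omega> ^ a * cnj (z \<omega>) ^ b +
       \<i> * (complex_of_real (Im (z \<omega>)) * z \<omega> ^ a * cnj (z \<omega>) ^ b) \<partial>P)"
  proof (intro Bochner_Integration.integral_cong refl)
    fix \<omega>
    have "z \<omega> ^ Suc a * cnj (z \<omega>) ^ b = z \<omega> * (z \<omega> ^ a * cnj (z \<omega>) ^ b)" by simp
    also have "\<dots> = (complex_of_real (Re (z \<omega>)) + \<i> * complex_of_real (Im (z \<omega>))) * (z \<omega> ^ a * cnj (z \<omega>) ^ b)"
      by (simp flip: z)
    finally show "z \<omega> ^ Suc a * cnj (z \<omega>) ^ b = complex_of_real (Re (z \<omega>)) * z \<omega> ^ a * cnj (z \<omega>) ^ b +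
       \<i> * (complex_of_real (Im (z \<omega>)) * z \<omega> ^ a * cnj (z \<omega>) ^ b)"
      by (simp add: algebra_simps)
  qed
  also have "\<dots> = of_nat b * (\<integral>\<omega>. z \<omega> ^ a * cnj (z \<omega>) ^ (b - 1) \<partial>P)"
    unfolding A_def[symmetric] B_def[symmetric] by (simp add: int E) (simp add: field_simps)?
  finally show "(\<integral>\<omega>. z \<omega> ^ Suc a * cnj (z \<omega>) ^ b \<partial>P) = of_nat b * (\<integral>\<omega>. z \<omega> ^ a * cnj (z \<omega>) ^ (b - 1) \<partial>P)" .
qed

section \<open>Wick calculus for polynomials in independent Gaussian variables\<close>

locale gaussian_family = prob_space P
  for P :: "'w measure" +
  fixes z :: "'k \<Rightarrow> 'w \<Rightarrow> complex" and K :: "'k set"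
  assumes gauss: "k \<in> K \<Longrightarrow> complex_std_gaussian P (z k)"
    and indep: "indep_vars (\<lambda>_. borel) z K"
begin

definition gletter :: "'k \<times> bool \<Rightarrow> 'w \<Rightarrow> complex" where
  "gletter l \<omega> = (if snd l then cnj (z (fst l) \<omega>) else z (fst l) \<omega>)"

definition gmonom :: "('k \<times> bool) list \<Rightarrow> 'w \<Rightarrow> complex" where
  "gmonom L \<omega> = (\<Prod>l\<leftarrow>L. gletter l \<omega>)"

text \<open>A Wirtinger derivative: a variable and its conjugate count as independent
  letters.\<close>

fun dgmonom :: "'k \<times> bool \<Rightarrow> ('k \<times> bool) list \<Rightarrow> 'w \<Rightarrow> complex" where
  "dgmonom l [] \<omega> = 0"
| "dgmonom l (m # L) \<omega> = (if l = m then gmonom L \<omega> else 0) + gletter m \<omega> * dgmonom l L \<omega>"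

lemma gmonom_simps [simp]:
  "gmonom [] \<omega> = 1" "gmonom (l # L) \<omega> = gletter l \<omega> * gmonom L \<omega>"
  "gmonom (L @ L') \<omega> = gmonom L \<omega> * gmonom L' \<omega>"
  by (auto simp: gmonom_def)

lemma dgmonom_append:
  "dgmonom l (L @ L') \<omega> = dgmonom l L \<omega> * gmonom L' \<omega> + gmonom L \<omega> * dgmonom l L' \<omega>"
  by (induction L) (auto simp: algebra_simps)

text \<open>The entries commute, so all nonzero terms of the Leibniz sum are equal. In this form of
  the power rule only exponents matter, and moments of single variables can be used.\<close>

lemma dgmonom_eq: "dgmonom l L \<omega> = of_nat (count_list L l) * gmonom (remove1 l L) \<omega>"
proof (induction L)
  case (Cons m L)
  show ?case
  proof (cases "l = m")
    case True
    have "gletter m \<omega> * dgmonom m L \<omega> = of_nat (count_list L m) * gmonom L \<omega>"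
    proof (cases "m \<in> set L")
      case True
      then obtain A B where "L = A @ m # B" "m \<notin> set A" by (meson split_list_first)
      then show ?thesis using Cons True \<open>l = m\<close> by (simp add: remove1_append mult_ac)
    qed (use Cons True in \<open>simp add: count_list_0_iff\<close>)
    then show ?thesis using True by (simp add: algebra_simps)
  qed (use Cons in auto)
qed simp

lemma gmonom_eq_prod:
  assumes "finite K'" "fst ` set L \<subseteq> K'"
  shows "gmonom L \<omega> = (\<Prod>k\<in>K'. z k \<omega> ^ count_list L (k, False) * cnj (z k \<omega>) ^ count_list L (k, True))"
  using assms(2)
proof (induction L)
  case (Cons l L)
  obtain k b where l: "l = (k, b)" by (cases l)
  have k: "k \<in> K'" using Cons.prems by (simp add: l)
  let ?f = "\<lambda>L k. z k \<omega> ^ count_list L (k, False) * cnj (z k \<omega>) ^ count_list L (k, True)"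
  have "(\<Prod>k\<in>K' - {k}. ?f (l # L) k) = (\<Prod>k\<in>K' - {k}. ?f L k)"
    by (intro prod.cong) (auto simp: l)
  moreover have "?f (l # L) k = gletter l \<omega> * ?f L k"
    by (cases b) (simp_all add: l gletter_def)
  ultimately have "(\<Prod>k\<in>K'. ?f (l # L) k) = gletter l \<omega> * (\<Prod>k\<in>K'. ?f L k)"
    by (simp add: prod.remove[OF assms(1) k])
  then show ?case using Cons by simp
qed simp

lemma gmonom_moment:
  assumes "finite K'" "fst ` set L \<subseteq> K'" "K' \<subseteq> K"
  shows "integrable P (gmonom L)"
    and "integral\<^sup>L P (gmonom L) =
      (\<Prod>k\<in>K'. \<integral>\<omega>. z k \<omega> ^ count_list L (k, False) * cnj (z k \<omega>) ^ count_list L (k, True) \<partial>P)"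
proof -
  let ?Y = "\<lambda>k x. x ^ count_list L (k, False) * cnj x ^ count_list L (k, True)"
  have ind: "indep_vars (\<lambda>_. borel) (\<lambda>k \<omega>. ?Y k (z k \<omega>)) K'"
    by (rule indep_vars_compose2[OF indep_vars_subset[OF indep assms(3)]])
       (intro borel_measurable_continuous_onI continuous_intros)
  have int: "integrable P (\<lambda>\<omega>. ?Y k (z k \<omega>))" if "k \<in> K'" for k
    using complex_gaussian_moments(1)[OF prob_space_axioms gauss] that assms(3) by blast
  have eq: "gmonom L = (\<lambda>\<omega>. \<Prod>k\<in>K'. ?Y k (z k \<omega>))"
    using gmonom_eq_prod[OF assms(1,2)] by auto
  show "integrable P (gmonom L)"
    unfolding eq by (rule indep_vars_integrable[OF assms(1) ind int])
  show "integral\<^sup>L P (gmonom L) = (\<Prod>k\<in>K'. \<integral>\<omega>. ?Y k (z k \<omega>) \<partial>P)"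
    unfolding eq by (rule indep_vars_lebesgue_integral[OF assms(1) ind int])
qed

lemma integrable_gmonom [intro]:
  assumes "fst ` set L \<subseteq> K"
  shows "integrable P (gmonom L)"
  using gmonom_moment(1)[of "fst ` set L" L] assms by auto

text \<open>By independence both sides factor over the variables. All factors but that of
  \<open>k\<close> agree and are collected in \<open>?R\<close>; the remaining one is the moment
  identity of a single variable.\<close>

lemma integral_gletter_gmonom:
  assumes "fst ` set L \<subseteq> K" "fst l \<in> K"
  shows "integral\<^sup>L P (gmonom (apsnd Not l # L)) = integral\<^sup>L P (dgmonom l L)"
proof -
  obtain k b where l: "l = (k, b)" by (cases l)
  let ?K = "insert k (fst ` set L)"
  have K: "finite ?K" "?K \<subseteq> K" using assms l by auto
  have "set (remove1 l L) \<subseteq> set L" by (rule set_remove1_subset)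
  then have sub: "fst ` set (remove1 l L) \<subseteq> ?K" by auto
  have cnt: "count_list (remove1 l L) m = count_list L m - (if l = m then 1 else 0)" for m
    by (induction L) auto
  define \<mu> where "\<mu> k a b = (\<integral>\<omega>. z k \<omega> ^ a * cnj (z k \<omega>) ^ b \<partial>P)" for k a b
  have \<mu>1: "\<mu> k a (Suc b) = of_nat a * \<mu> k (a - 1) b"
    and \<mu>2: "\<mu> k (Suc a) b = of_nat b * \<mu> k a (b - 1)" for a b
    using complex_gaussian_moments(2,3)[OF prob_space_axioms gauss[of k]] assms(2) l by (simp_all add: \<mu>_def)
  let ?R = "\<Prod>k'\<in>?K - {k}. \<mu> k' (count_list L (k', False)) (count_list L (k', True))"
  have "integral\<^sup>L P (gmonom (apsnd Not l # L)) =
      (\<Prod>k'\<in>?K. \<mu> k' (count_list (apsnd Not l # L) (k', False)) (count_list (apsnd Not l # L) (k', True)))"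
    unfolding \<mu>_def using K by (intro gmonom_moment) (auto simp: l)
  also have "\<dots> = \<mu> k (count_list (apsnd Not l # L) (k, False)) (count_list (apsnd Not l # L) (k, True)) * ?R"
  proof -
    have "(\<Prod>k'\<in>?K - {k}. \<mu> k' (count_list (apsnd Not l # L) (k', False)) (count_list (apsnd Not l # L) (k', True))) = ?R"
      by (intro prod.cong) (auto simp: l)
    then show ?thesis by (simp only: prod.remove[OF K(1) insertI1])
  qed
  finally have 1: "integral\<^sup>L P (gmonom (apsnd Not l # L)) = \<dots>" .
  have "integral\<^sup>L P (gmonom (remove1 l L)) =
      (\<Prod>k'\<in>?K. \<mu> k' (count_list (remove1 l L) (k', False)) (count_list (remove1 l L) (k', True)))"
    unfolding \<mu>_def using K sub by (intro gmonom_moment) auto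
  also have "\<dots> = \<mu> k (count_list (remove1 l L) (k, False)) (count_list (remove1 l L) (k, True)) * ?R"
  proof -
    have "(\<Prod>k'\<in>?K - {k}. \<mu> k' (count_list (remove1 l L) (k', False)) (count_list (remove1 l L) (k', True))) = ?R"
      by (intro prod.cong) (auto simp: l cnt)
    then show ?thesis by (simp only: prod.remove[OF K(1) insertI1])
  qed
  finally have 2: "integral\<^sup>L P (gmonom (remove1 l L)) = \<dots>" .
  have "integral\<^sup>L P (dgmonom l L) = of_nat (count_list L l) * integral\<^sup>L P (gmonom (remove1 l L))"
    by (simp add: dgmonom_eq[abs_def])
  then show ?thesis unfolding 1 2 by (cases b) (simp_all add: l cnt[unfolded l] \<mu>1 \<mu>2)
qed

text \<open>
  Formal differentiation of a polynomial in the variables and their conjugates with respect to the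
  letter \<open>l\<close>.  It is a relation since a random variable may have several such representations.
\<close>

definition wick_deriv :: "'k \<times> bool \<Rightarrow> ('w \<Rightarrow> complex) \<Rightarrow> ('w \<Rightarrow> complex) \<Rightarrow> bool" where
  "wick_deriv l F F' \<longleftrightarrow> (\<exists>Q. (\<forall>x\<in>set Q. fst ` set (snd x) \<subseteq> K) \<and>
     (\<forall>\<omega>. F \<omega> = (\<Sum>x\<leftarrow>Q. fst x * gmonom (snd x) \<omega>)) \<and> (\<forall>\<omega>. F' \<omega> = (\<Sum>x\<leftarrow>Q. fst x * dgmonom l (snd x) \<omega>)))"

lemma wick_derivE:
  assumes "wick_deriv l F F'"
  obtains Q where "\<And>x. x \<in> set Q \<Longrightarrow> fst ` set (snd x) \<subseteq> K"
    "\<And>\<omega>. F \<omega> = (\<Sum>x\<leftarrow>Q. fst x * gmonom (snd x) \<omega>)" "\<And>\<omega>. F' \<omega> = (\<Sum>x\<leftarrow>Q. fst x * dgmonom l (snd x) \<omega>)"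
  using assms unfolding wick_deriv_def by blast

lemma wick_deriv_const: "wick_deriv l (\<lambda>_. c) (\<lambda>_. 0)"
  unfolding wick_deriv_def by (rule exI[of _ "[(c, [])]"]) auto

lemma wick_deriv_gletter: "fst m \<in> K \<Longrightarrow> wick_deriv l (gletter m) (\<lambda>_. if l = m then 1 else 0)"
  unfolding wick_deriv_def by (rule exI[of _ "[(1, [m])]"]) auto

lemma wick_deriv_add:
  assumes "wick_deriv l F F'" "wick_deriv l G G'"
  shows "wick_deriv l (\<lambda>\<omega>. F \<omega> + G \<omega>) (\<lambda>\<omega>. F' \<omega> + G' \<omega>)"
proof -
  from assms(1) obtain Q where Q: "\<And>x. x \<in> set Q \<Longrightarrow> fst ` set (snd x) \<subseteq> K"
    "\<And>\<omega>. F \<omega> = (\<Sum>x\<leftarrow>Q. fst x * gmonom (snd x) \<omega>)" "\<And>\<omega>. F' \<omega> = (\<Sum>x\<leftarrow>Q. fst x * dgmonom l (snd x) \<omega>)"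
    by (rule wick_derivE) blast
  from assms(2) obtain R where R: "\<And>x. x \<in> set R \<Longrightarrow> fst ` set (snd x) \<subseteq> K"
    "\<And>\<omega>. G \<omega> = (\<Sum>x\<leftarrow>R. fst x * gmonom (snd x) \<omega>)" "\<And>\<omega>. G' \<omega> = (\<Sum>x\<leftarrow>R. fst x * dgmonom l (snd x) \<omega>)"
    by (rule wick_derivE) blast
  have "\<forall>x\<in>set (Q @ R). fst ` set (snd x) \<subseteq> K" using Q(1) R(1) by (simp add: ball_Un)
  then show ?thesis
    unfolding wick_deriv_def by (intro exI[of _ "Q @ R"]) (simp add: Q(2,3) R(2,3))
qed

lemma wick_deriv_mult:
  assumes "wick_deriv l F F'" "wick_deriv l G G'"
  shows "wick_deriv l (\<lambda>\<omega>. F \<omega> * G \<omega>) (\<lambda>\<omega>. F' \<omega> * G \<omega> + F \<omega> * G' \<omega>)"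
proof -
  from assms(1) obtain Q where Q: "\<And>x. x \<in> set Q \<Longrightarrow> fst ` set (snd x) \<subseteq> K"
    "\<And>\<omega>. F \<omega> = (\<Sum>x\<leftarrow>Q. fst x * gmonom (snd x) \<omega>)" "\<And>\<omega>. F' \<omega> = (\<Sum>x\<leftarrow>Q. fst x * dgmonom l (snd x) \<omega>)"
    by (rule wick_derivE) blast
  from assms(2) obtain R where R: "\<And>x. x \<in> set R \<Longrightarrow> fst ` set (snd x) \<subseteq> K"
    "\<And>\<omega>. G \<omega> = (\<Sum>x\<leftarrow>R. fst x * gmonom (snd x) \<omega>)" "\<And>\<omega>. G' \<omega> = (\<Sum>x\<leftarrow>R. fst x * dgmonom l (snd x) \<omega>)"
    by (rule wick_derivE) blast
  let ?S = "\<lambda>Q. concat (map (\<lambda>x. map (\<lambda>y. (fst x * fst y, snd x @ snd y)) R) Q)"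
  have 1: "(\<Sum>x\<leftarrow>?S Q. fst x * gmonom (snd x) \<omega>) = (\<Sum>x\<leftarrow>Q. fst x * gmonom (snd x) \<omega>) * G \<omega>" for Q \<omega>
  proof (induction Q)
    case (Cons x Q)
    have "(\<Sum>y\<leftarrow>R. fst x * fst y * gmonom (snd x @ snd y) \<omega>) = fst x * gmonom (snd x) \<omega> * G \<omega>"
      by (simp add: R(2) mult_ac flip: sum_list_const_mult)
    with Cons show ?case by (simp add: comp_def distrib_right)
  qed simp
  have 2: "(\<Sum>x\<leftarrow>?S Q. fst x * dgmonom l (snd x) \<omega>) =
      (\<Sum>x\<leftarrow>Q. fst x * dgmonom l (snd x) \<omega>) * G \<omega> + (\<Sum>x\<leftarrow>Q. fst x * gmonom (snd x) \<omega>) * G' \<omega>" for Q \<omega>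
  proof (induction Q)
    case (Cons x Q)
    have "(\<Sum>y\<leftarrow>R. fst x * fst y * dgmonom l (snd x @ snd y) \<omega>) =
        fst x * dgmonom l (snd x) \<omega> * G \<omega> + fst x * gmonom (snd x) \<omega> * G' \<omega>"
      by (simp add: R(2,3) dgmonom_append algebra_simps flip: sum_list_const_mult sum_list_addf)
    with Cons show ?case by (simp add: comp_def distrib_right)
  qed simp
  have "\<forall>x\<in>set (?S Q). fst ` set (snd x) \<subseteq> K"
    using Q(1) R(1) by (simp add: image_Un)
  then show ?thesis
    unfolding wick_deriv_def by (intro exI[of _ "?S Q"]) (simp only: 1 2 Q(2,3) simp_thms)
qed

lemma wick_deriv_cmult: "wick_deriv l F F' \<Longrightarrow> wick_deriv l (\<lambda>\<omega>. c * F \<omega>) (\<lambda>\<omega>. c * F' \<omega>)"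
  using wick_deriv_mult[OF wick_deriv_const] by simp

lemma wick_deriv_sum:
  assumes "\<And>x. x \<in> A \<Longrightarrow> wick_deriv l (F x) (F' x)"
  shows "wick_deriv l (\<lambda>\<omega>. \<Sum>x\<in>A. F x \<omega>) (\<lambda>\<omega>. \<Sum>x\<in>A. F' x \<omega>)"
  using assms by (induction A rule: infinite_finite_induct) (auto intro: wick_deriv_add wick_deriv_const)

text \<open>All moments are finite, so every summand is integrable, and linearity carries the
  identity for monomials over to the representation \<open>Q\<close>.\<close>

lemma wick_deriv_integral:
  assumes "wick_deriv l F F'" "fst l \<in> K"
  shows "integrable P F" "integrable P F'"
    and "integrable P (\<lambda>\<omega>. gletter (apsnd Not l) \<omega> * F \<omega>)"
    and "(\<integral>\<omega>. gletter (apsnd Not l) \<omega> * F \<omega> \<partial>P) = integral\<^sup>L P F'"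
proof -
  from assms(1) obtain Q where Q: "\<And>x. x \<in> set Q \<Longrightarrow> fst ` set (snd x) \<subseteq> K"
    and F: "F = (\<lambda>\<omega>. \<Sum>x\<leftarrow>Q. fst x * gmonom (snd x) \<omega>)" and F': "F' = (\<lambda>\<omega>. \<Sum>x\<leftarrow>Q. fst x * dgmonom l (snd x) \<omega>)"
    by (rule wick_derivE) blast
  have mult_F: "(\<lambda>\<omega>. gletter (apsnd Not l) \<omega> * F \<omega>) = (\<lambda>\<omega>. \<Sum>x\<leftarrow>Q. fst x * gmonom (apsnd Not l # snd x) \<omega>)"
    by (simp add: F algebra_simps flip: sum_list_const_mult)
  have dint: "integrable P (dgmonom l L)" if "fst ` set L \<subseteq> K" for L
  proof -
    have "fst ` set (remove1 l L) \<subseteq> K" using set_remove1_subset[of l L] that by auto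
    from integrable_gmonom[OF this] show ?thesis
      by (simp add: dgmonom_eq[abs_def])
  qed
  have int: "integrable P (gmonom (snd x))" "integrable P (gmonom (apsnd Not l # snd x))"
    "integrable P (dgmonom l (snd x))" if "x \<in> set Q" for x
    using Q[OF that] assms(2) by (auto intro!: integrable_gmonom dint simp del: gmonom_simps simp: image_subset_iff)
  have "integrable P (\<lambda>\<omega>. \<Sum>x\<leftarrow>R. fst x * gmonom (snd x) \<omega>) \<and>
      integrable P (\<lambda>\<omega>. \<Sum>x\<leftarrow>R. fst x * dgmonom l (snd x) \<omega>) \<and>
      integrable P (\<lambda>\<omega>. \<Sum>x\<leftarrow>R. fst x * gmonom (apsnd Not l # snd x) \<omega>) \<and>
      (\<integral>\<omega>. (\<Sum>x\<leftarrow>R. fst x * gmonom (apsnd Not l # snd x) \<omega>) \<partial>P) =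
      (\<integral>\<omega>. (\<Sum>x\<leftarrow>R. fst x * dgmonom l (snd x) \<omega>) \<partial>P)" if "set R \<subseteq> set Q" for R
    using that
  proof (induction R)
    case (Cons x R)
    have "fst ` set (snd x) \<subseteq> K" using Cons.prems Q by auto
    from integral_gletter_gmonom[OF this assms(2)] Cons int[of x]
    show ?case by (simp del: gmonom_simps)
  qed simp
  from this[OF subset_refl] show "integrable P F" "integrable P F'"
    "integrable P (\<lambda>\<omega>. gletter (apsnd Not l) \<omega> * F \<omega>)"
    "(\<integral>\<omega>. gletter (apsnd Not l) \<omega> * F \<omega> \<partial>P) = integral\<^sup>L P F'"
    unfolding mult_F by (simp_all add: F F')
qed

end

section \<open>Schwinger-Dyson equations for random matrices\<close>

text \<open>
  Here matrices are functions of two indices, of which only the values below \<open>N\<close> matter; this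
  spares the dimension conditions of the type of matrices.
\<close>

definition letter_entry :: "('i \<Rightarrow> nat \<Rightarrow> nat \<Rightarrow> complex) \<Rightarrow> 'i \<times> bool \<Rightarrow> nat \<Rightarrow> nat \<Rightarrow> complex" where
  "letter_entry X l x y = (if snd l then cnj (X (fst l) y x) else X (fst l) x y)"

fun word_entry :: "nat \<Rightarrow> ('i \<Rightarrow> nat \<Rightarrow> nat \<Rightarrow> complex) \<Rightarrow> ('i \<times> bool) list \<Rightarrow> nat \<Rightarrow> nat \<Rightarrow> complex" where
  "word_entry N X [] x y = (if x = y then 1 else 0)"
| "word_entry N X (l # w) x y = (\<Sum>z<N. letter_entry X l x z * word_entry N X w z y)"

definition word_trace :: "nat \<Rightarrow> ('i \<Rightarrow> nat \<Rightarrow> nat \<Rightarrow> complex) \<Rightarrow> ('i \<times> bool) list \<Rightarrow> complex" where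
  "word_trace N X w = (\<Sum>x<N. word_entry N X w x x) / of_nat N"

lemma word_entry_append:
  "x < N \<Longrightarrow> word_entry N X (v @ w) x y = (\<Sum>z<N. word_entry N X v x z * word_entry N X w z y)"
proof (induction v arbitrary: x)
  case Nil
  have "(\<Sum>z<N. word_entry N X [] x z * word_entry N X w z y) = (\<Sum>z<N. if x = z then word_entry N X w z y else 0)"
    by (intro sum.cong) auto
  then show ?case using Nil by simp
next
  case (Cons l v)
  have "word_entry N X ((l # v) @ w) x y =
      (\<Sum>u<N. \<Sum>z<N. letter_entry X l x u * word_entry N X v u z * word_entry N X w z y)"
    by (simp add: Cons.IH sum_distrib_left mult.assoc)
  also have "\<dots> = (\<Sum>z<N. \<Sum>u<N. letter_entry X l x u * word_entry N X v u z * word_entry N X w z y)"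
    by (rule sum.swap)
  finally show ?case by (simp add: sum_distrib_right)
qed

lemma sum_word_entry_mult:
  "(\<Sum>x<N. \<Sum>y<N. word_entry N X v x y * word_entry N X w y x) = of_nat N * word_trace N X (v @ w)"
proof -
  have "(\<Sum>x<N. \<Sum>y<N. word_entry N X v x y * word_entry N X w y x) = (\<Sum>x<N. word_entry N X (v @ w) x x)"
    by (intro sum.cong refl) (simp add: word_entry_append)
  then show ?thesis by (cases "N = 0") (simp_all add: word_trace_def)
qed

lemma word_trace_rotate: "word_trace N X (v @ w) = word_trace N X (w @ v)"
proof (cases "N = 0")
  case False
  have "(\<Sum>x<N. \<Sum>y<N. word_entry N X v x y * word_entry N X w y x) =
    (\<Sum>x<N. \<Sum>y<N. word_entry N X w x y * word_entry N X v y x)"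
    by (subst sum.swap) (simp add: mult.commute)
  then show ?thesis using False by (simp add: sum_word_entry_mult)
qed (simp add: word_trace_def)

definition adjoint_word :: "('i \<times> bool) list \<Rightarrow> ('i \<times> bool) list" where
  "adjoint_word w = rev (map (apsnd Not) w)"

lemma cnj_word_entry:
  "x < N \<Longrightarrow> y < N \<Longrightarrow> cnj (word_entry N X w x y) = word_entry N X (adjoint_word w) y x"
proof (induction w arbitrary: x)
  case (Cons l w)
  have 1: "word_entry N X [apsnd Not l] z x = cnj (letter_entry X l x z)" for z
  proof -
    have "word_entry N X [apsnd Not l] z x = (\<Sum>u<N. if x = u then letter_entry X (apsnd Not l) z u else 0)"
      unfolding word_entry.simps by (intro sum.cong) auto
    then show ?thesis using Cons.prems by (simp add: letter_entry_def)
  qed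
  have "cnj (word_entry N X (l # w) x y) = (\<Sum>z<N. word_entry N X (adjoint_word w) y z * word_entry N X [apsnd Not l] z x)"
    unfolding 1 using Cons by (simp add: mult.commute)
  also have "\<dots> = word_entry N X (adjoint_word (l # w)) y x"
    using Cons.prems by (simp add: adjoint_word_def word_entry_append del: word_entry.simps)
  finally show ?case .
qed (auto simp: adjoint_word_def)

lemma cnj_word_trace: "cnj (word_trace N X w) = word_trace N X (adjoint_word w)"
  by (simp add: word_trace_def cnj_word_entry)

definition trace_prod :: "nat \<Rightarrow> ('i \<Rightarrow> nat \<Rightarrow> nat \<Rightarrow> complex) \<Rightarrow> ('i \<times> bool) list list \<Rightarrow> complex" where
  "trace_prod N X L = (\<Prod>w\<leftarrow>L. word_trace N X w)"

lemma trace_prod_simps [simp]: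
  "trace_prod N X [] = 1" "trace_prod N X (w # L) = word_trace N X w * trace_prod N X L"
  by (auto simp: trace_prod_def)

lemma sum_list_swap_sum: "(\<Sum>x\<leftarrow>xs. \<Sum>y\<in>A. f x y) = (\<Sum>y\<in>A. \<Sum>x\<leftarrow>xs. f x y)"
  for f :: "'x \<Rightarrow> 'y \<Rightarrow> 'z :: comm_monoid_add"
  by (induction xs) (simp_all add: sum.distrib)

section \<open>Derivatives of matrix words and of products of traces\<close>

context gaussian_family
begin

text \<open>By assumption the derivative of a letter of \<open>H\<close> is a matrix of rank one,
  the vector \<open>e\<close> placed in column \<open>x0\<close>, and that of any other letter of
  \<open>V\<close> is zero. So cutting the word at such a letter leaves the vector B e and row
  \<open>x0\<close> of C.\<close>

lemma wick_deriv_word_entry: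
  assumes letters: "\<And>l y t. l \<in> V \<Longrightarrow> y < N \<Longrightarrow> t < N \<Longrightarrow>
      wick_deriv k (\<lambda>\<omega>. letter_entry (X \<omega>) l y t) (\<lambda>\<omega>. if l \<in> H \<and> t = x0 then e y \<omega> else 0)"
    and "x0 < N" "w \<in> lists V" "y < N" "t < N"
  shows "wick_deriv k (\<lambda>\<omega>. word_entry N (X \<omega>) w y t)
    (\<lambda>\<omega>. \<Sum>(B, C)\<leftarrow>splits H w. (\<Sum>u<N. word_entry N (X \<omega>) B y u * e u \<omega>) * word_entry N (X \<omega>) C x0 t)"
  using assms(3,4)
proof (induction w arbitrary: y rule: list.induct)
  case Nil
  then show ?case by (simp add: wick_deriv_const)
next
  case (Cons l w)
  let ?D = "\<lambda>y \<omega>. \<Sum>x\<leftarrow>splits H w. (\<Sum>u<N. word_entry N (X \<omega>) (fst x) y u * e u \<omega>) * word_entry N (X \<omega>) (snd x) x0 t"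
  have "wick_deriv k (\<lambda>\<omega>. word_entry N (X \<omega>) (l # w) y t)
    (\<lambda>\<omega>. \<Sum>v<N. (if l \<in> H \<and> v = x0 then e y \<omega> else 0) * word_entry N (X \<omega>) w v t + letter_entry (X \<omega>) l y v * ?D v \<omega>)"
    unfolding word_entry.simps
  proof (intro wick_deriv_sum wick_deriv_mult)
    fix v assume "v \<in> {..<N}"
    then show "wick_deriv k (\<lambda>\<omega>. letter_entry (X \<omega>) l y v) (\<lambda>\<omega>. if l \<in> H \<and> v = x0 then e y \<omega> else 0)"
      using Cons.prems by (intro letters) (auto simp: lists_eq_set)
    show "wick_deriv k (\<lambda>\<omega>. word_entry N (X \<omega>) w v t) (?D v)"
      using Cons.prems \<open>v \<in> _\<close> by (intro Cons.IH[unfolded case_prod_unfold]) (auto simp: lists_eq_set)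
  qed
  moreover have "(\<Sum>v<N. (if l \<in> H \<and> v = x0 then e y \<omega> else 0) * word_entry N (X \<omega>) w v t + letter_entry (X \<omega>) l y v * ?D v \<omega>) =
      (\<Sum>(B, C)\<leftarrow>splits H (l # w). (\<Sum>u<N. word_entry N (X \<omega>) B y u * e u \<omega>) * word_entry N (X \<omega>) C x0 t)" for \<omega>
  proof -
    have "(\<Sum>v<N. (if l \<in> H \<and> v = x0 then e y \<omega> else 0) * word_entry N (X \<omega>) w v t) =
        (\<Sum>v<N. if v = x0 then (if l \<in> H then e y \<omega> * word_entry N (X \<omega>) w v t else 0) else 0)"
      by (intro sum.cong) auto
    also have "\<dots> = (if l \<in> H then e y \<omega> * word_entry N (X \<omega>) w x0 t else 0)"
      using assms(2) by simp
    finally have 1: "(\<Sum>v<N. (if l \<in> H \<and> v = x0 then e y \<omega> else 0) * word_entry N (X \<omega>) w v t) = \<dots>" .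
    have 2: "(\<Sum>v<N. letter_entry (X \<omega>) l y v * ?D v \<omega>) =
        (\<Sum>x\<leftarrow>splits H w. (\<Sum>u<N. word_entry N (X \<omega>) (l # fst x) y u * e u \<omega>) * word_entry N (X \<omega>) (snd x) x0 t)"
    proof -
      have "(\<Sum>v<N. letter_entry (X \<omega>) l y v * ?D v \<omega>) = (\<Sum>x\<leftarrow>splits H w. \<Sum>v<N. \<Sum>u<N.
          letter_entry (X \<omega>) l y v * word_entry N (X \<omega>) (fst x) v u * e u \<omega> * word_entry N (X \<omega>) (snd x) x0 t)"
        by (simp add: sum_list_swap_sum sum_distrib_left sum_distrib_right mult.assoc flip: sum_list_const_mult)
      also have "\<dots> = (\<Sum>x\<leftarrow>splits H w. \<Sum>u<N. \<Sum>v<N.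
          letter_entry (X \<omega>) l y v * word_entry N (X \<omega>) (fst x) v u * e u \<omega> * word_entry N (X \<omega>) (snd x) x0 t)"
        by (intro arg_cong[of _ _ sum_list] map_cong refl sum.swap)
      finally show ?thesis by (simp add: sum_distrib_right mult.assoc)
    qed
    have 3: "(\<Sum>u<N. word_entry N (X \<omega>) [] y u * e u \<omega>) = e y \<omega>"
    proof -
      have "(\<Sum>u<N. word_entry N (X \<omega>) [] y u * e u \<omega>) = (\<Sum>u<N. if y = u then e u \<omega> else 0)"
        by (intro sum.cong) auto
      then show ?thesis using Cons.prems by simp
    qed
    show ?thesis
      unfolding sum.distrib 1 2 using 3 by (auto simp: case_prod_unfold comp_def simp del: word_entry.simps)
  qed
  ultimately show ?case by simp
qed

text \<open>Summation over the diagonal glues the outer ends of the two pieces together: B and C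
  become the single word \<open>C @ B\<close>, running from the cut around the cycle and back to
  it.\<close>

lemma wick_deriv_word_trace:
  assumes letters: "\<And>l y t. l \<in> V \<Longrightarrow> y < N \<Longrightarrow> t < N \<Longrightarrow>
      wick_deriv k (\<lambda>\<omega>. letter_entry (X \<omega>) l y t) (\<lambda>\<omega>. if l \<in> H \<and> t = x0 then e y \<omega> else 0)"
    and "x0 < N" "w \<in> lists V"
  shows "wick_deriv k (\<lambda>\<omega>. word_trace N (X \<omega>) w)
    (\<lambda>\<omega>. \<Sum>(B, C)\<leftarrow>splits H w. (\<Sum>u<N. word_entry N (X \<omega>) (C @ B) x0 u * e u \<omega>) / of_nat N)"
proof -
  have "wick_deriv k (\<lambda>\<omega>. 1 / of_nat N * (\<Sum>x<N. word_entry N (X \<omega>) w x x))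
    (\<lambda>\<omega>. 1 / of_nat N * (\<Sum>x<N. \<Sum>(B, C)\<leftarrow>splits H w. (\<Sum>u<N. word_entry N (X \<omega>) B x u * e u \<omega>) * word_entry N (X \<omega>) C x0 x))"
    by (intro wick_deriv_cmult wick_deriv_sum wick_deriv_word_entry[OF letters assms(2,3)]) auto
  moreover have "(\<Sum>x<N. \<Sum>(B, C)\<leftarrow>splits H w. (\<Sum>u<N. word_entry N (X \<omega>) B x u * e u \<omega>) * word_entry N (X \<omega>) C x0 x) =
      (\<Sum>(B, C)\<leftarrow>splits H w. \<Sum>u<N. word_entry N (X \<omega>) (C @ B) x0 u * e u \<omega>)" for \<omega>
  proof -
    have "(\<Sum>x<N. (\<Sum>u<N. word_entry N (X \<omega>) B x u * e u \<omega>) * word_entry N (X \<omega>) C x0 x) =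
      (\<Sum>u<N. word_entry N (X \<omega>) (C @ B) x0 u * e u \<omega>)" for B C
    proof -
      have "(\<Sum>x<N. (\<Sum>u<N. word_entry N (X \<omega>) B x u * e u \<omega>) * word_entry N (X \<omega>) C x0 x) =
          (\<Sum>x<N. \<Sum>u<N. word_entry N (X \<omega>) C x0 x * word_entry N (X \<omega>) B x u * e u \<omega>)"
        by (simp add: sum_distrib_left sum_distrib_right mult_ac)
      also have "\<dots> = (\<Sum>u<N. \<Sum>x<N. word_entry N (X \<omega>) C x0 x * word_entry N (X \<omega>) B x u * e u \<omega>)"
        by (rule sum.swap)
      finally show ?thesis using assms(2) by (simp add: word_entry_append sum_distrib_right)
    qed
    then show ?thesis by (simp add: case_prod_unfold flip: sum_list_swap_sum)
  qed
  moreover have "1 / of_nat N * (\<Sum>(B, C)\<leftarrow>splits H w. \<Sum>u<N. word_entry N (X \<omega>) (C @ B) x0 u * e u \<omega>) =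
      (\<Sum>(B, C)\<leftarrow>splits H w. (\<Sum>u<N. word_entry N (X \<omega>) (C @ B) x0 u * e u \<omega>) / of_nat N)" for \<omega>
    by (simp add: case_prod_unfold divide_inverse flip: sum_list_const_mult) (simp add: mult.commute)
  ultimately show ?thesis
    by (simp add: word_trace_def)
qed

lemma wick_deriv_trace_prod:
  assumes letters: "\<And>l y t. l \<in> V \<Longrightarrow> y < N \<Longrightarrow> t < N \<Longrightarrow>
      wick_deriv k (\<lambda>\<omega>. letter_entry (X \<omega>) l y t) (\<lambda>\<omega>. if l \<in> H \<and> t = x0 then e y \<omega> else 0)"
    and "x0 < N" "L \<in> lists (lists V)"
  shows "wick_deriv k (\<lambda>\<omega>. trace_prod N (X \<omega>) L)
    (\<lambda>\<omega>. \<Sum>(v, L')\<leftarrow>splits_list H L. (\<Sum>u<N. word_entry N (X \<omega>) v x0 u * e u \<omega>) / of_nat N * trace_prod N (X \<omega>) L')"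
  using assms(3)
proof (induction L rule: list.induct)
  case Nil
  then show ?case by (simp add: wick_deriv_const)
next
  case (Cons w L)
  have "wick_deriv k (\<lambda>\<omega>. trace_prod N (X \<omega>) (w # L))
    (\<lambda>\<omega>. (\<Sum>(B, C)\<leftarrow>splits H w. (\<Sum>u<N. word_entry N (X \<omega>) (C @ B) x0 u * e u \<omega>) / of_nat N) * trace_prod N (X \<omega>) L +
      word_trace N (X \<omega>) w * (\<Sum>(v, L')\<leftarrow>splits_list H L. (\<Sum>u<N. word_entry N (X \<omega>) v x0 u * e u \<omega>) / of_nat N * trace_prod N (X \<omega>) L'))"
    unfolding trace_prod_simps
  proof (rule wick_deriv_mult)
    show "wick_deriv k (\<lambda>\<omega>. word_trace N (X \<omega>) w)
      (\<lambda>\<omega>. \<Sum>(B, C)\<leftarrow>splits H w. (\<Sum>u<N. word_entry N (X \<omega>) (C @ B) x0 u * e u \<omega>) / of_nat N)"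
      using Cons.prems by (intro wick_deriv_word_trace[OF letters assms(2)]) (auto simp: lists_eq_set)
  qed (use Cons in \<open>auto simp: lists_eq_set\<close>)
  then show ?case
    by (simp add: case_prod_unfold comp_def sum_list_mult_const[symmetric] sum_list_const_mult[symmetric] mult_ac)
qed

text \<open>
  Both models at once: a letter \<open>l\<close> is a sum of products of one Gaussian entry, to which Gaussian
  integration by parts is applied, and of a cofactor \<open>E m y\<close> (a constant for Ginibre matrices,
  another Gaussian entry for Wishart matrices).
\<close>

lemma schwinger_dyson_matrices:
  fixes X :: "'w \<Rightarrow> 'i \<Rightarrow> nat \<Rightarrow> nat \<Rightarrow> complex"
  assumes N: "N > 0" and M: "M > 0"
    and k: "\<And>m x. fst (k m x) \<in> K"
    and l: "\<And>x y \<omega>. x < N \<Longrightarrow> y < N \<Longrightarrow>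
      letter_entry (X \<omega>) l x y = (\<Sum>m<M. gletter (apsnd Not (k m x)) \<omega> * E m y \<omega>)"
    and E: "\<And>m x y. m < M \<Longrightarrow> x < N \<Longrightarrow> y < N \<Longrightarrow> wick_deriv (k m x) (E m y) (\<lambda>_. if x = y then \<epsilon> else 0)"
    and letters: "\<And>m x h y t. m < M \<Longrightarrow> x < N \<Longrightarrow> h \<in> V \<Longrightarrow> y < N \<Longrightarrow> t < N \<Longrightarrow>
      wick_deriv (k m x) (\<lambda>\<omega>. letter_entry (X \<omega>) h y t) (\<lambda>\<omega>. if h \<in> H \<and> t = x then e m y \<omega> else 0)"
    and eE: "\<And>y u \<omega>. y < N \<Longrightarrow> u < N \<Longrightarrow>
      (\<Sum>m<M. e m u \<omega> * E m y \<omega>) = word_entry N (X \<omega>) Z u y / of_nat N"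
    and V: "l \<in> V" "set Z \<subseteq> V" "A \<in> lists V" "L \<in> lists (lists V)"
  defines "T \<equiv> \<lambda>L. \<integral>\<omega>. trace_prod N (X \<omega>) L \<partial>P"
  shows "T ((l # A) # L) = of_nat M * \<epsilon> * T (A # L) +
      (\<Sum>(B, C)\<leftarrow>splits H A. T ((Z @ B) # C # L)) +
      (\<Sum>(v, L')\<leftarrow>splits_list H L. T ((Z @ A @ v) # L')) / of_nat N ^ 2"
    and "L' \<in> lists (lists V) \<Longrightarrow> integrable P (\<lambda>\<omega>. trace_prod N (X \<omega>) L')"
proof -
  have int: "integrable P (\<lambda>\<omega>. trace_prod N (X \<omega>) L)" if "L \<in> lists (lists V)" for L
    \<comment> \<open>Integrability is a by-product of differentiability in any one entry; the
      positivity of M and N supplies the entry with indices 0, 0.\<close>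
    by (rule wick_deriv_integral(1)[OF wick_deriv_trace_prod[OF letters[OF M N] N that] k])
  then show "L' \<in> lists (lists V) \<Longrightarrow> integrable P (\<lambda>\<omega>. trace_prod N (X \<omega>) L')" .
  let ?N = "of_nat N :: complex"
  \<comment> \<open>The product rule: the derivative falls on the cofactor \<open>E\<close>, on the
    word \<open>A\<close>, or on one of the other traces.\<close>
  define D where "D m x y \<omega> =
      ((if x = y then \<epsilon> else 0) * word_entry N (X \<omega>) A y x +
       E m y \<omega> * (\<Sum>(B, C)\<leftarrow>splits H A. (\<Sum>u<N. word_entry N (X \<omega>) B y u * e m u \<omega>) * word_entry N (X \<omega>) C x x)) *
        trace_prod N (X \<omega>) L +
      (E m y \<omega> * word_entry N (X \<omega>) A y x) *
       (\<Sum>(v, L')\<leftarrow>splits_list H L. (\<Sum>u<N. word_entry N (X \<omega>) v x u * e m u \<omega>) / ?N * trace_prod N (X \<omega>) L')"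
    for m x y \<omega>
  define F where "F m x y \<omega> = E m y \<omega> * word_entry N (X \<omega>) A y x * trace_prod N (X \<omega>) L" for m x y \<omega>
  have "wick_deriv (k m x) (F m x y) (D m x y)" if "m < M" "x < N" "y < N" for m x y
    unfolding F_def[abs_def] D_def[abs_def]
    by (intro wick_deriv_mult E wick_deriv_word_entry[OF letters _ V(3)] wick_deriv_trace_prod[OF letters _ V(4)] that)
  note WF = wick_deriv_integral[OF this k]
  have "trace_prod N (X \<omega>) ((l # A) # L) =
      (\<Sum>x<N. \<Sum>y<N. \<Sum>m<M. gletter (apsnd Not (k m x)) \<omega> * F m x y \<omega>) / ?N" for \<omega>
  proof -
    have "(\<Sum>x<N. word_entry N (X \<omega>) (l # A) x x) * trace_prod N (X \<omega>) L =
       (\<Sum>x<N. \<Sum>y<N. \<Sum>m<M. gletter (apsnd Not (k m x)) \<omega> * F m x y \<omega>)"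
      by (simp add: l F_def sum_distrib_left sum_distrib_right mult.assoc)
    then show ?thesis by (simp add: word_trace_def)
  qed
  then have "T ((l # A) # L) = (\<integral>\<omega>. (\<Sum>x<N. \<Sum>y<N. \<Sum>m<M. gletter (apsnd Not (k m x)) \<omega> * F m x y \<omega>) \<partial>P) / ?N"
    unfolding T_def by simp
  also have "(\<integral>\<omega>. (\<Sum>x<N. \<Sum>y<N. \<Sum>m<M. gletter (apsnd Not (k m x)) \<omega> * F m x y \<omega>) \<partial>P) =
      (\<Sum>x<N. \<Sum>y<N. \<Sum>m<M. \<integral>\<omega>. gletter (apsnd Not (k m x)) \<omega> * F m x y \<omega> \<partial>P)"
  proof -
    have int3: "integrable P (\<lambda>\<omega>. gletter (apsnd Not (k m x)) \<omega> * F m x y \<omega>)"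
      if "m \<in> {..<M}" "x \<in> {..<N}" "y \<in> {..<N}" for m x y
      by (rule WF(3)) (use that in auto)
    show ?thesis
      by (simp only: Bochner_Integration.integral_sum Bochner_Integration.integrable_sum int3 cong: sum.cong)
  qed
  also have "(\<Sum>x<N. \<Sum>y<N. \<Sum>m<M. \<integral>\<omega>. gletter (apsnd Not (k m x)) \<omega> * F m x y \<omega> \<partial>P) / ?N =
      (\<Sum>x<N. \<Sum>y<N. \<Sum>m<M. \<integral>\<omega>. D m x y \<omega> \<partial>P) / ?N"
    by (simp add: WF(4))
  also have "\<dots> = (\<integral>\<omega>. (\<Sum>x<N. \<Sum>y<N. \<Sum>m<M. D m x y \<omega>) / ?N \<partial>P)"
  proof -
    have intD: "integrable P (\<lambda>\<omega>. D m x y \<omega>)"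
      if "m \<in> {..<M}" "x \<in> {..<N}" "y \<in> {..<N}" for m x y
      using WF(2) that by simp
    have "(\<integral>\<omega>. (\<Sum>x<N. \<Sum>y<N. \<Sum>m<M. D m x y \<omega>) \<partial>P) = (\<Sum>x<N. \<Sum>y<N. \<Sum>m<M. \<integral>\<omega>. D m x y \<omega> \<partial>P)"
      by (simp only: Bochner_Integration.integral_sum Bochner_Integration.integrable_sum intD cong: sum.cong)
    then show ?thesis by simp
  qed
  also have "(\<lambda>\<omega>. (\<Sum>x<N. \<Sum>y<N. \<Sum>m<M. D m x y \<omega>) / ?N) = (\<lambda>\<omega>. of_nat M * \<epsilon> * trace_prod N (X \<omega>) (A # L) +
      (\<Sum>x\<leftarrow>splits H A. trace_prod N (X \<omega>) ((Z @ fst x) # snd x # L)) +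
      (\<Sum>x\<leftarrow>splits_list H L. trace_prod N (X \<omega>) ((Z @ A @ fst x) # snd x)) / ?N ^ 2)"
  proof
    fix \<omega>
    let ?W = "word_entry N (X \<omega>)" and ?R = "trace_prod N (X \<omega>) L"
    \<comment> \<open>The two leftover factors of a contraction combine into an entry of
      \<open>Z\<close>, at the price of 1/N.\<close>
    have contract: "(\<Sum>m<M. E m y \<omega> * (c * e m u \<omega>)) = c * ?W Z u y / ?N" if "y < N" "u < N" for c y u
    proof -
      have "(\<Sum>m<M. E m y \<omega> * (c * e m u \<omega>)) = c * (\<Sum>m<M. e m u \<omega> * E m y \<omega>)"
        by (simp add: sum_distrib_left mult_ac)
      then show ?thesis using eE[OF that] by simp
    qed
    have "(\<Sum>x<N. \<Sum>y<N. \<Sum>m<M. (if x = y then \<epsilon> else 0) * ?W A y x * ?R) = ?N * (of_nat M * \<epsilon> * trace_prod N (X \<omega>) (A # L))"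
    proof -
      have "(\<Sum>y<N. \<Sum>m<M. (if x = y then \<epsilon> else 0) * ?W A y x * ?R) = of_nat M * \<epsilon> * ?W A x x * ?R" if "x < N" for x
      proof -
        have "(\<Sum>y<N. \<Sum>m<M. (if x = y then \<epsilon> else 0) * ?W A y x * ?R) =
            (\<Sum>y<N. if x = y then of_nat M * \<epsilon> * ?W A x x * ?R else 0)"
          by (intro sum.cong) auto
        then show ?thesis using that by simp
      qed
      then have "(\<Sum>x<N. \<Sum>y<N. \<Sum>m<M. (if x = y then \<epsilon> else 0) * ?W A y x * ?R) = (\<Sum>x<N. of_nat M * \<epsilon> * ?W A x x * ?R)"
        by simp
      also have "\<dots> = of_nat M * \<epsilon> * (\<Sum>x<N. ?W A x x) * ?R"
        by (simp add: sum_distrib_left sum_distrib_right)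
      finally show ?thesis using N by (simp add: word_trace_def)
    qed
    \<comment> \<open>A split creates two cycles, worth N^2, against the 1/N of the contraction and
      the 1/N normalizing the first trace: no power of N survives.\<close>
    moreover have "(\<Sum>x<N. \<Sum>y<N. \<Sum>m<M. E m y \<omega> * (\<Sum>p\<leftarrow>splits H A. (\<Sum>u<N. ?W (fst p) y u * e m u \<omega>) * ?W (snd p) x x) * ?R) =
        ?N * (\<Sum>p\<leftarrow>splits H A. trace_prod N (X \<omega>) ((Z @ fst p) # snd p # L))"
    proof -
      have 1: "(\<Sum>y<N. \<Sum>m<M. E m y \<omega> * (\<Sum>u<N. ?W B y u * e m u \<omega>)) = word_trace N (X \<omega>) (Z @ B)" for B
      proof -
        have "(\<Sum>y<N. \<Sum>m<M. E m y \<omega> * (\<Sum>u<N. ?W B y u * e m u \<omega>)) = (\<Sum>y<N. \<Sum>m<M. \<Sum>u<N. E m y \<omega> * (?W B y u * e m u \<omega>))"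
          by (simp add: sum_distrib_left)
        also have "\<dots> = (\<Sum>y<N. \<Sum>u<N. \<Sum>m<M. E m y \<omega> * (?W B y u * e m u \<omega>))"
          by (intro sum.cong refl sum.swap)
        also have "\<dots> = (\<Sum>y<N. \<Sum>u<N. ?W B y u * ?W Z u y) / ?N"
          by (simp add: contract sum_divide_distrib)
        finally show ?thesis using N by (simp add: sum_word_entry_mult word_trace_rotate[of _ _ B])
      qed
      have "(\<Sum>x<N. \<Sum>y<N. \<Sum>m<M. E m y \<omega> * (\<Sum>p\<leftarrow>splits H A. (\<Sum>u<N. ?W (fst p) y u * e m u \<omega>) * ?W (snd p) x x) * ?R) =
        (\<Sum>p\<leftarrow>splits H A. \<Sum>x<N. \<Sum>y<N. \<Sum>m<M. E m y \<omega> * (\<Sum>u<N. ?W (fst p) y u * e m u \<omega>) * (?W (snd p) x x * ?R))"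
        by (simp add: sum_list_swap_sum mult.assoc flip: sum_list_const_mult sum_list_mult_const)
      also have "\<dots> = (\<Sum>p\<leftarrow>splits H A. \<Sum>x<N. word_trace N (X \<omega>) (Z @ fst p) * (?W (snd p) x x * ?R))"
        by (simp add: 1 flip: sum_distrib_right)
      also have "\<dots> = (\<Sum>p\<leftarrow>splits H A. word_trace N (X \<omega>) (Z @ fst p) * ((\<Sum>x<N. ?W (snd p) x x) * ?R))"
        by (simp add: sum_distrib_left sum_distrib_right)
      also have "\<dots> = (\<Sum>p\<leftarrow>splits H A. ?N * trace_prod N (X \<omega>) ((Z @ fst p) # snd p # L))"
        using N by (simp add: word_trace_def)
      finally show ?thesis by (simp add: sum_list_const_mult)
    qed
    \<comment> \<open>A joining leaves one cycle, worth N, against the contraction and the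
      normalization of both traces: 1/N^2 survives.\<close>
    moreover have "(\<Sum>x<N. \<Sum>y<N. \<Sum>m<M. (E m y \<omega> * ?W A y x) *
         (\<Sum>p\<leftarrow>splits_list H L. (\<Sum>u<N. ?W (fst p) x u * e m u \<omega>) / ?N * trace_prod N (X \<omega>) (snd p))) =
        ?N * ((\<Sum>p\<leftarrow>splits_list H L. trace_prod N (X \<omega>) ((Z @ A @ fst p) # snd p)) / ?N ^ 2)"
    proof -
      have 1: "(\<Sum>x<N. \<Sum>y<N. \<Sum>m<M. (E m y \<omega> * ?W A y x) * (\<Sum>u<N. ?W v x u * e m u \<omega>)) = word_trace N (X \<omega>) (Z @ A @ v)" for v
      proof -
        have "(\<Sum>x<N. \<Sum>y<N. \<Sum>m<M. (E m y \<omega> * ?W A y x) * (\<Sum>u<N. ?W v x u * e m u \<omega>)) =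
            (\<Sum>x<N. \<Sum>y<N. \<Sum>m<M. \<Sum>u<N. E m y \<omega> * (?W A y x * ?W v x u * e m u \<omega>))"
          by (simp add: sum_distrib_left mult_ac)
        also have "\<dots> = (\<Sum>x<N. \<Sum>y<N. \<Sum>u<N. \<Sum>m<M. E m y \<omega> * (?W A y x * ?W v x u * e m u \<omega>))"
          by (intro sum.cong refl sum.swap)
        also have "\<dots> = (\<Sum>x<N. \<Sum>y<N. \<Sum>u<N. ?W A y x * ?W v x u * ?W Z u y) / ?N"
          by (simp add: contract sum_divide_distrib)
        also have "(\<Sum>x<N. \<Sum>y<N. \<Sum>u<N. ?W A y x * ?W v x u * ?W Z u y) = (\<Sum>y<N. \<Sum>x<N. \<Sum>u<N. ?W A y x * ?W v x u * ?W Z u y)"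
          by (rule sum.swap)
        also have "\<dots> = (\<Sum>y<N. \<Sum>u<N. \<Sum>x<N. ?W A y x * ?W v x u * ?W Z u y)"
          by (intro sum.cong refl sum.swap)
        also have "\<dots> = (\<Sum>y<N. \<Sum>u<N. ?W (A @ v) y u * ?W Z u y)"
          by (simp add: word_entry_append sum_distrib_right)
        finally show ?thesis using N by (simp add: sum_word_entry_mult word_trace_rotate[of _ _ Z])
      qed
      have "(\<Sum>x<N. \<Sum>y<N. \<Sum>m<M. (E m y \<omega> * ?W A y x) *
         (\<Sum>p\<leftarrow>splits_list H L. (\<Sum>u<N. ?W (fst p) x u * e m u \<omega>) / ?N * trace_prod N (X \<omega>) (snd p))) =
        (\<Sum>p\<leftarrow>splits_list H L. \<Sum>x<N. \<Sum>y<N. \<Sum>m<M. (E m y \<omega> * ?W A y x) *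
          (\<Sum>u<N. ?W (fst p) x u * e m u \<omega>) * (trace_prod N (X \<omega>) (snd p) / ?N))"
        by (simp add: sum_list_swap_sum mult.assoc flip: sum_list_const_mult)
      also have "\<dots> = (\<Sum>p\<leftarrow>splits_list H L. word_trace N (X \<omega>) (Z @ A @ fst p) * (trace_prod N (X \<omega>) (snd p) / ?N))"
        by (simp add: 1 del: times_divide_eq_right flip: sum_distrib_right)
      also have "\<dots> = (\<Sum>p\<leftarrow>splits_list H L. trace_prod N (X \<omega>) ((Z @ A @ fst p) # snd p)) / ?N"
        by (simp add: divide_inverse flip: sum_list_mult_const) (simp add: mult_ac)
      finally show ?thesis using N by (simp add: power2_eq_square)
    qed
    ultimately show "(\<Sum>x<N. \<Sum>y<N. \<Sum>m<M. D m x y \<omega>) / ?N = of_nat M * \<epsilon> * trace_prod N (X \<omega>) (A # L) +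
      (\<Sum>x\<leftarrow>splits H A. trace_prod N (X \<omega>) ((Z @ fst x) # snd x # L)) +
      (\<Sum>x\<leftarrow>splits_list H L. trace_prod N (X \<omega>) ((Z @ A @ fst x) # snd x)) / ?N ^ 2"
      using N unfolding D_def distrib_right sum.distrib case_prod_unfold by (simp only:) (simp add: field_simps)
  qed
  also have "(\<integral>\<omega>. (of_nat M * \<epsilon> * trace_prod N (X \<omega>) (A # L) +
      (\<Sum>x\<leftarrow>splits H A. trace_prod N (X \<omega>) ((Z @ fst x) # snd x # L)) +
      (\<Sum>x\<leftarrow>splits_list H L. trace_prod N (X \<omega>) ((Z @ A @ fst x) # snd x)) / ?N ^ 2) \<partial>P) =
      of_nat M * \<epsilon> * T (A # L) + (\<Sum>x\<leftarrow>splits H A. T ((Z @ fst x) # snd x # L)) +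
      (\<Sum>x\<leftarrow>splits_list H L. T ((Z @ A @ fst x) # snd x)) / ?N ^ 2"
  proof -
    have sum: "integrable P (\<lambda>\<omega>. \<Sum>x\<leftarrow>xs. trace_prod N (X \<omega>) (f x)) \<and>
        (\<integral>\<omega>. (\<Sum>x\<leftarrow>xs. trace_prod N (X \<omega>) (f x)) \<partial>P) = (\<Sum>x\<leftarrow>xs. T (f x))"
      if "\<And>x. x \<in> set xs \<Longrightarrow> f x \<in> lists (lists V)" for f and xs :: "'x list"
      using that
    proof (induction xs)
      case (Cons x xs)
      have "integrable P (\<lambda>\<omega>. trace_prod N (X \<omega>) (f x))" by (rule int) (use Cons.prems in simp)
      then show ?case using Cons by (simp add: T_def)
    qed simp
    have "(Z @ fst x) # snd x # L \<in> lists (lists V)" if "x \<in> set (splits H A)" for x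
      using splitsD[of "fst x" "snd x" H A] that V by (auto simp: lists_eq_set)
    note S1 = sum[of "splits H A" "\<lambda>x. (Z @ fst x) # snd x # L", OF this]
    have "(Z @ A @ fst x) # snd x \<in> lists (lists V)" if x: "x \<in> set (splits_list H L)" for x
    proof -
      have "(fst x, snd x) \<in> set (splits_list H L)" using x by simp
      from splits_listD[OF this] obtain B C h where BC: "fst x = C @ B" "mset L = add_mset (B @ h # C) (mset (snd x))"
        by blast
      have "set L = insert (B @ h # C) (set (snd x))"
        using arg_cong[OF BC(2), of set_mset] by simp
      then show ?thesis using V BC(1) by (auto simp: lists_eq_set)
    qed
    note S2 = sum[of "splits_list H L" "\<lambda>x. (Z @ A @ fst x) # snd x", OF this]
    have "integrable P (\<lambda>\<omega>. trace_prod N (X \<omega>) (A # L))" using V by (intro int) auto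
    then show ?thesis using S1 S2 by (simp add: T_def del: trace_prod_simps)
  qed
  finally show "T ((l # A) # L) = of_nat M * \<epsilon> * T (A # L) +
      (\<Sum>(B, C)\<leftarrow>splits H A. T ((Z @ B) # C # L)) +
      (\<Sum>(v, L')\<leftarrow>splits_list H L. T ((Z @ A @ v) # L')) / of_nat N ^ 2"
    by (simp add: case_prod_unfold)
qed

end

section \<open>Averaging over the permutation matrices\<close>

lemma index_mat_adjoint:
  fixes A :: "complex mat"
  assumes "A \<in> carrier_mat m n" "i < n" "j < m"
  shows "mat_adjoint A $$ (i, j) = cnj (A $$ (j, i))"
  using assms by (simp add: mat_adjoint_def mat_of_rows_index)

lemma mat_adjoint_carrier:
  fixes A :: "complex mat"
  shows "A \<in> carrier_mat m n \<Longrightarrow> mat_adjoint A \<in> carrier_mat n m"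
  unfolding mat_adjoint_def mat_of_rows_def carrier_mat_def by simp

lemma eval_monomial_mat_entry:
  assumes "\<And>i. i \<in> fst ` set w \<Longrightarrow> X i \<in> carrier_mat N N"
  shows "eval_monomial_mat N X w \<in> carrier_mat N N \<and>
    (\<forall>x<N. \<forall>y<N. eval_monomial_mat N X w $$ (x, y) = word_entry N (\<lambda>i x y. X i $$ (x, y)) w x y)"
  using assms
proof (induction w)
  case Nil
  then show ?case by (simp add: eval_monomial_mat_def)
next
  case (Cons l w)
  let ?Y = "\<lambda>i x y. X i $$ (x, y)"
  obtain i b where l: "l = (i, b)" by (cases l)
  let ?A = "if b then mat_adjoint (X i) else X i"
  have i: "X i \<in> carrier_mat N N" using Cons.prems by (simp add: l)
  have A: "?A \<in> carrier_mat N N" using i mat_adjoint_carrier[OF i] by simp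
  have IH: "eval_monomial_mat N X w \<in> carrier_mat N N"
    "\<And>x y. x < N \<Longrightarrow> y < N \<Longrightarrow> eval_monomial_mat N X w $$ (x, y) = word_entry N ?Y w x y"
    using Cons by auto
  have eq: "eval_monomial_mat N X (l # w) = ?A * eval_monomial_mat N X w"
    by (simp add: eval_monomial_mat_def l)
  have "eval_monomial_mat N X (l # w) $$ (x, y) = word_entry N ?Y (l # w) x y" if xy: "x < N" "y < N" for x y
  proof -
    have "eval_monomial_mat N X (l # w) $$ (x, y) = (\<Sum>z<N. ?A $$ (x, z) * eval_monomial_mat N X w $$ (z, y))"
      using A IH(1) xy unfolding eq by (auto simp: scalar_prod_def atLeast0LessThan intro!: sum.cong)
    also have "\<dots> = (\<Sum>z<N. letter_entry ?Y l x z * word_entry N ?Y w z y)"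
      using xy by (intro sum.cong refl) (simp add: IH(2) l letter_entry_def index_mat_adjoint[OF i])
    finally show ?thesis by simp
  qed
  then show ?case unfolding eq using A IH(1) by auto
qed

lemma normalized_trace_eval_monomial_mat:
  assumes "\<And>i. i \<in> fst ` set w \<Longrightarrow> X i \<in> carrier_mat N N"
  shows "normalized_trace N (eval_monomial_mat N X w) = word_trace N (\<lambda>i x y. X i $$ (x, y)) w"
  using eval_monomial_mat_entry[of w X N, OF assms] by (simp add: normalized_trace_def word_trace_def)

lemma word_entry_cong:
  assumes "\<And>i x y. i \<in> fst ` set w \<Longrightarrow> x < N \<Longrightarrow> y < N \<Longrightarrow> X i x y = Y i x y"
  shows "x < N \<Longrightarrow> y < N \<Longrightarrow> word_entry N X w x y = word_entry N Y w x y"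
  using assms
proof (induction w arbitrary: x)
  case (Cons l w)
  show ?case
    unfolding word_entry.simps
  proof (intro sum.cong refl arg_cong2[of _ _ _ _ "(*)"])
    fix z assume z: "z \<in> {..<N}"
    show "letter_entry X l x z = letter_entry Y l x z"
      using Cons.prems z by (simp add: letter_entry_def)
    show "word_entry N X w z y = word_entry N Y w z y"
      using Cons.prems z by (intro Cons.IH) auto
  qed
qed simp

lemma trace_prod_cong:
  assumes "\<And>i x y. i \<in> fst ` (\<Union>w\<in>set L. set w) \<Longrightarrow> x < N \<Longrightarrow> y < N \<Longrightarrow> X i x y = Y i x y"
  shows "trace_prod N X L = trace_prod N Y L"
proof -
  have "word_trace N X w = word_trace N Y w" if "w \<in> set L" for w
  proof -
    have "word_entry N X w x x = word_entry N Y w x x" if "x < N" for x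
      using \<open>w \<in> set L\<close> that by (intro word_entry_cong assms) auto
    then show ?thesis by (simp add: word_trace_def)
  qed
  then show ?thesis unfolding trace_prod_def by (metis (mono_tags, lifting) map_eq_conv)
qed

lemma trace_prod_measurable:
  assumes "\<And>i x y. i \<in> fst ` (\<Union>w\<in>set L. set w) \<Longrightarrow> x < N \<Longrightarrow> y < N \<Longrightarrow> (\<lambda>h. F h i x y) \<in> borel_measurable M"
  shows "(\<lambda>h. trace_prod N (F h) L) \<in> borel_measurable M"
proof -
  have cnj: "(\<lambda>h. cnj (G h)) \<in> borel_measurable M" if "G \<in> borel_measurable M" for G :: "_ \<Rightarrow> complex"
    using that by (rule measurable_compose[OF _ borel_measurable_continuous_onI]) (intro continuous_intros)
  have entry: "(\<lambda>h. word_entry N (F h) w x y) \<in> borel_measurable M"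
    if "\<And>i x y. i \<in> fst ` set w \<Longrightarrow> x < N \<Longrightarrow> y < N \<Longrightarrow> (\<lambda>h. F h i x y) \<in> borel_measurable M" "x < N" "y < N" for w x y
    using that
  proof (induction w arbitrary: x)
    case (Cons l w)
    have "(\<lambda>h. letter_entry (F h) l x z) \<in> borel_measurable M" if "z < N" for z
      using Cons.prems that by (cases "snd l") (auto simp: letter_entry_def intro!: cnj)
    moreover have "(\<lambda>h. word_entry N (F h) w z y) \<in> borel_measurable M" if "z < N" for z
      using Cons.prems that by (intro Cons.IH) auto
    ultimately show ?case by (auto intro!: borel_measurable_sum borel_measurable_times)
  qed simp
  have "(\<lambda>h. word_trace N (F h) w) \<in> borel_measurable M" if "w \<in> set L" for w
    unfolding word_trace_def using that
    by (intro borel_measurable_divide borel_measurable_sum entry assms) auto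
  then show ?thesis by (induction L) auto
qed

section \<open>Permutation matrices and independence\<close>

definition perm_entry :: "(nat \<Rightarrow> nat) \<Rightarrow> nat \<Rightarrow> nat \<Rightarrow> complex" where
  "perm_entry \<sigma> x y = (if x = \<sigma> y then 1 else 0)"

definition perm_mat :: "nat \<Rightarrow> (nat \<Rightarrow> nat) \<Rightarrow> complex mat" where
  "perm_mat N \<sigma> = mat N N (\<lambda>(i, j). if i = \<sigma> j then 1 else 0)"

lemma perm_mat_inj: "inj_on (perm_mat N) {\<sigma>. \<sigma> permutes {..<N}}"
proof (rule inj_onI)
  fix \<sigma> \<tau> assume \<sigma>: "\<sigma> \<in> {\<sigma>. \<sigma> permutes {..<N}}" "\<tau> \<in> {\<sigma>. \<sigma> permutes {..<N}}" and eq: "perm_mat N \<sigma> = perm_mat N \<tau>"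
  show "\<sigma> = \<tau>"
  proof
    fix j
    show "\<sigma> j = \<tau> j"
    proof (cases "j < N")
      case True
      then have "\<sigma> j < N" using \<sigma> permutes_in_image[of \<sigma> "{..<N}" j] by simp
      then have "perm_mat N \<sigma> $$ (\<sigma> j, j) = 1" using True by (simp add: perm_mat_def)
      then have "perm_mat N \<tau> $$ (\<sigma> j, j) = 1" by (simp add: eq)
      then show ?thesis using True \<open>\<sigma> j < N\<close> by (auto simp: perm_mat_def split: if_splits)
    next
      case False
      then show ?thesis using \<sigma> permutes_not_in[of \<sigma> "{..<N}" j] permutes_not_in[of \<tau> "{..<N}" j] by simp
    qed
  qed
qed

lemma permutation_mats_eq: "permutation_mats N = perm_mat N ` {\<sigma>. \<sigma> permutes {..<N}}"
  by (auto simp: permutation_mats_def perm_mat_def image_def)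

lemma card_permutation_mats: "card (permutation_mats N) = fact N" "finite (permutation_mats N)"
  unfolding permutation_mats_eq using card_permutations[OF refl, of "{..<N}"]
  by (simp_all add: card_image[OF perm_mat_inj] finite_permutations)

lemma perm_mat_carrier: "perm_mat N \<sigma> \<in> carrier_mat N N"
  by (simp add: perm_mat_def)

lemma space_mat_borel: "space (mat_borel m n) = carrier_mat m n"
  by (simp add: mat_borel_def)

lemma measurable_mat_entry:
  assumes "i < m" "j < n"
  shows "(\<lambda>A. A $$ (i, j)) \<in> borel_measurable (mat_borel m n)"
proof -
  let ?f = "\<lambda>A :: complex mat. \<lambda>ij\<in>{..<m} \<times> {..<n}. A $$ ij"
  have "?f \<in> measurable (mat_borel m n) (Pi\<^sub>M ({..<m} \<times> {..<n}) (\<lambda>_. borel))"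
    unfolding mat_borel_def by (rule measurable_vimage_algebra1) (auto simp: space_PiM)
  moreover have "(\<lambda>h. h (i, j)) \<in> measurable (Pi\<^sub>M ({..<m} \<times> {..<n}) (\<lambda>_. borel)) borel"
    using assms by (intro measurable_component_singleton) auto
  ultimately have "(\<lambda>A. ?f A (i, j)) \<in> borel_measurable (mat_borel m n)"
    by (rule measurable_compose)
  then show ?thesis using assms by simp
qed

text \<open>Makes the event that a random matrix equals a given permutation matrix measurable for
  the sigma-algebra in which independence is stated.\<close>

lemma mat_borel_singleton:
  assumes "A \<in> carrier_mat m n"
  shows "{A} \<in> sets (mat_borel m n)"
proof -
  have "{A} = {B \<in> space (mat_borel m n). \<forall>i\<in>{..<m}. \<forall>j\<in>{..<n}. B $$ (i, j) = A $$ (i, j)}"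
    using assms by (auto simp: space_mat_borel intro!: eq_matI)
  also have "\<dots> \<in> sets (mat_borel m n)"
  proof (intro sets.sets_Collect_finite_All)
    fix i j assume "i \<in> {..<m}" "j \<in> {..<n}"
    then have "(\<lambda>B. B $$ (i, j)) \<in> borel_measurable (mat_borel m n)" by (intro measurable_mat_entry) auto
    then have "(\<lambda>B. B $$ (i, j)) -` {A $$ (i, j)} \<inter> space (mat_borel m n) \<in> sets (mat_borel m n)"
      by (rule measurable_sets) simp
    also have "(\<lambda>B. B $$ (i, j)) -` {A $$ (i, j)} \<inter> space (mat_borel m n) =
        {B \<in> space (mat_borel m n). B $$ (i, j) = A $$ (i, j)}" by auto
    finally show "{B \<in> space (mat_borel m n). B $$ (i, j) = A $$ (i, j)} \<in> sets (mat_borel m n)" .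
  qed auto
  finally show ?thesis .
qed

lemma (in prob_space) prob_uniform_permutation_mat:
  assumes "uniform_permutation_mat M N X" "A \<in> permutation_mats N"
  shows "prob {\<omega>\<in>space M. X \<omega> = A} = 1 / fact N"
proof -
  have X: "X \<in> measurable M (count_space (permutation_mats N))"
    and distr: "distr M (count_space (permutation_mats N)) X = uniform_count_measure (permutation_mats N)"
    using assms(1) by (auto simp: uniform_permutation_mat_def)
  have "{\<omega>\<in>space M. X \<omega> = A} = X -` {A} \<inter> space M" by auto
  then have "prob {\<omega>\<in>space M. X \<omega> = A} = measure (distr M (count_space (permutation_mats N)) X) {A}"
    using assms(2) by (subst measure_distr[OF X]) auto
  also have "\<dots> = 1 / fact N"
    unfolding distr using assms(2) by (simp add: measure_uniform_count_measure card_permutation_mats)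
  finally show ?thesis .
qed

text \<open>
  Conditioning on the permutation matrices: by independence they may be averaged over separately.
\<close>

lemma (in prob_space) expectation_trace_prod_permutations:
  fixes U Y :: "'r \<Rightarrow> 'a \<Rightarrow> complex mat"
  assumes J: "finite J"
    and U: "\<And>r. r \<in> J \<Longrightarrow> uniform_permutation_mat M N (U r)"
    and indep: "indep_vars (\<lambda>_. mat_borel N N) (case_sum U Y) (J <+> J)"
    and L: "L \<in> lists (lists ((J <+> J) \<times> UNIV))"
  defines "F \<equiv> \<lambda>\<sigma> \<omega>. case_sum (\<lambda>r. perm_entry (\<sigma> r)) (\<lambda>r x y. Y r \<omega> $$ (x, y))"
  defines "Q \<equiv> J \<rightarrow>\<^sub>E {\<sigma>. \<sigma> permutes {..<N}}"
  assumes int: "\<And>\<sigma>. \<sigma> \<in> Q \<Longrightarrow> integrable M (\<lambda>\<omega>. trace_prod N (F \<sigma> \<omega>) L)"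
  shows "integrable M (\<lambda>\<omega>. trace_prod N (\<lambda>i x y. case_sum U Y i \<omega> $$ (x, y)) L)"
    and "(\<integral>\<omega>. trace_prod N (\<lambda>i x y. case_sum U Y i \<omega> $$ (x, y)) L \<partial>M) =
      (\<Sum>\<sigma>\<in>Q. \<integral>\<omega>. trace_prod N (F \<sigma> \<omega>) L \<partial>M) / fact N ^ card J"
proof -
  let ?X = "\<lambda>\<omega> i x y. case_sum U Y i \<omega> $$ (x, y)"
  \<comment> \<open>The indicator that the random permutation matrices are those of
    \<open>\<sigma>\<close>; as a product over \<open>J\<close> its expectation factors by
    independence.\<close>
  define ind where "ind \<sigma> \<omega> = (\<Prod>r\<in>J. if U r \<omega> = perm_mat N (\<sigma> r) then 1 else 0 :: complex)" for \<sigma> \<omega>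
  have idx: "i \<in> J <+> J" if "i \<in> fst ` (\<Union>w\<in>set L. set w)" for i
    using that L by (force simp: lists_eq_set)
  have fin: "finite Q"
    unfolding Q_def using J by (intro finite_PiE) (auto simp: finite_permutations)
  have expand: "trace_prod N (?X \<omega>) L = (\<Sum>\<sigma>\<in>Q. ind \<sigma> \<omega> * trace_prod N (F \<sigma> \<omega>) L)" if \<omega>: "\<omega> \<in> space M" for \<omega>
  proof -
    have "\<exists>\<sigma>. \<sigma> permutes {..<N} \<and> U r \<omega> = perm_mat N \<sigma>" if "r \<in> J" for r
    proof -
      have "U r \<omega> \<in> permutation_mats N"
        using U[OF that] \<omega> measurable_space[of "U r" M "count_space (permutation_mats N)" \<omega>]
        by (auto simp: uniform_permutation_mat_def)
      then show ?thesis by (auto simp: permutation_mats_eq)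
    qed
    then obtain \<tau> where \<tau>: "\<And>r. r \<in> J \<Longrightarrow> \<tau> r permutes {..<N} \<and> U r \<omega> = perm_mat N (\<tau> r)" by metis
    define \<tau>' where "\<tau>' = restrict \<tau> J"
    have \<tau>'Q: "\<tau>' \<in> Q" using \<tau> by (auto simp: Q_def \<tau>'_def)
    have U\<tau>': "U r \<omega> = perm_mat N (\<tau>' r)" if "r \<in> J" for r using \<tau> that by (simp add: \<tau>'_def)
    have "ind \<sigma> \<omega> = (if \<sigma> = \<tau>' then 1 else 0)" if \<sigma>: "\<sigma> \<in> Q" for \<sigma>
    proof (cases "\<sigma> = \<tau>'")
      case True
      then show ?thesis using U\<tau>' by (simp add: ind_def)
    next
      case False
      then obtain r where r: "r \<in> J" "\<sigma> r \<noteq> \<tau>' r"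
        using \<sigma> \<tau>'Q unfolding Q_def by (meson PiE_ext)
      then have "perm_mat N (\<sigma> r) \<noteq> perm_mat N (\<tau>' r)"
        using inj_onD[OF perm_mat_inj, of N "\<sigma> r" "\<tau>' r"] \<sigma> \<tau>'Q by (auto simp: Q_def PiE_iff)
      then show ?thesis using r U\<tau>' J False by (auto simp: ind_def)
    qed
    then have "(\<Sum>\<sigma>\<in>Q. ind \<sigma> \<omega> * trace_prod N (F \<sigma> \<omega>) L) = (\<Sum>\<sigma>\<in>Q. if \<sigma> = \<tau>' then trace_prod N (F \<tau>' \<omega>) L else 0)"
      by (intro sum.cong) auto
    also have "\<dots> = trace_prod N (F \<tau>' \<omega>) L" using fin \<tau>'Q by simp
    also have "\<dots> = trace_prod N (?X \<omega>) L"
    proof (rule trace_prod_cong)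
      fix i x y assume "i \<in> fst ` (\<Union>w\<in>set L. set w)" and xy: "x < N" "y < N"
      then show "F \<tau>' \<omega> i x y = ?X \<omega> i x y"
        using idx[of i] U\<tau>' by (auto simp: F_def perm_entry_def perm_mat_def)
    qed
    finally show ?thesis ..
  qed
  have "integrable M (\<lambda>\<omega>. ind \<sigma> \<omega> * trace_prod N (F \<sigma> \<omega>) L) \<and>
      (\<integral>\<omega>. ind \<sigma> \<omega> * trace_prod N (F \<sigma> \<omega>) L \<partial>M) = (\<integral>\<omega>. trace_prod N (F \<sigma> \<omega>) L \<partial>M) / fact N ^ card J"
    if \<sigma>: "\<sigma> \<in> Q" for \<sigma>
  proof -
    let ?g = "\<lambda>r A. if A = perm_mat N (\<sigma> r) then 1 else 0 :: complex"
    have g: "?g r \<in> borel_measurable (mat_borel N N)" for r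
      using mat_borel_singleton[OF perm_mat_carrier[of N "\<sigma> r"]]
      by (intro measurable_If) (auto simp: pred_def space_mat_borel perm_mat_carrier Collect_conv_if)
    let ?g' = "\<lambda>i :: 'r + 'r. ?g (projl i)"
    have indU: "indep_vars (\<lambda>_. borel) (\<lambda>i \<omega>. ?g' i (case_sum U Y i \<omega>)) (Inl ` J)"
      by (rule indep_vars_compose2[OF indep_vars_subset[OF indep] g]) auto
    have Um: "U r \<in> measurable M (mat_borel N N)" if "r \<in> J" for r
      using indep that unfolding indep_vars_def by force
    have gint: "integrable M (\<lambda>\<omega>. ?g r (U r \<omega>))" if "r \<in> J" for r
      using measurable_compose[OF Um[OF that] g]
      by (intro integrable_const_bound[where B = 1]) auto
    have Eg: "(\<integral>\<omega>. ?g r (U r \<omega>) \<partial>M) = 1 / fact N" if r: "r \<in> J" for r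
    proof -
      have S: "{\<omega>\<in>space M. U r \<omega> = perm_mat N (\<sigma> r)} \<in> sets M"
      proof -
        have "U r -` {perm_mat N (\<sigma> r)} \<inter> space M \<in> sets M"
          using Um[OF r] mat_borel_singleton[OF perm_mat_carrier] by (rule measurable_sets)
        moreover have "U r -` {perm_mat N (\<sigma> r)} \<inter> space M = {\<omega>\<in>space M. U r \<omega> = perm_mat N (\<sigma> r)}" by auto
        ultimately show ?thesis by simp
      qed
      have "(\<integral>\<omega>. ?g r (U r \<omega>) \<partial>M) = (\<integral>\<omega>. complex_of_real (indicat_real {\<omega>\<in>space M. U r \<omega> = perm_mat N (\<sigma> r)} \<omega>) \<partial>M)"
        by (intro Bochner_Integration.integral_cong) auto
      also have "\<dots> = complex_of_real (prob {\<omega>\<in>space M. U r \<omega> = perm_mat N (\<sigma> r)})"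
        unfolding integral_complex_of_real using S by simp
      also have "prob {\<omega>\<in>space M. U r \<omega> = perm_mat N (\<sigma> r)} = 1 / fact N"
        using \<sigma> r by (intro prob_uniform_permutation_mat U) (auto simp: permutation_mats_eq Q_def PiE_iff)
      finally show ?thesis by simp
    qed
    have ind_eq: "ind \<sigma> = (\<lambda>\<omega>. \<Prod>i\<in>Inl ` J. ?g' i (case_sum U Y i \<omega>))"
      by (simp add: ind_def fun_eq_iff prod.reindex)
    have gint': "integrable M (\<lambda>\<omega>. ?g' i (case_sum U Y i \<omega>))" if "i \<in> Inl ` J" for i
      using that gint by auto
    have finJ: "finite (Inl ` J)" using J by simp
    have ind_int: "integrable M (ind \<sigma>)"
      unfolding ind_eq by (rule indep_vars_integrable[OF finJ indU gint'])
    have "(\<integral>\<omega>. ind \<sigma> \<omega> \<partial>M) = (\<Prod>i\<in>Inl ` J. \<integral>\<omega>. ?g' i (case_sum U Y i \<omega>) \<partial>M)"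
      unfolding ind_eq by (rule indep_vars_lebesgue_integral[OF finJ indU gint'])
    also have "\<dots> = (\<Prod>r\<in>J. 1 / fact N)"
      unfolding prod.reindex[OF inj_on_subset[OF inj_Inl subset_UNIV]] comp_def
      by (intro prod.cong refl) (use Eg in simp)
    finally have E_ind: "(\<integral>\<omega>. ind \<sigma> \<omega> \<partial>M) = 1 / fact N ^ card J"
      by (simp add: power_divide)
    define Kb where "Kb = (\<lambda>b. if b then Inl ` J else Inr ` J :: ('r + 'r) set)"
    have "indep_vars (\<lambda>b. PiM (Kb b) (\<lambda>_. mat_borel N N)) (\<lambda>b \<omega>. restrict (\<lambda>i. case_sum U Y i \<omega>) (Kb b)) UNIV"
      by (rule indep_vars_restrict[OF indep]) (auto simp: Kb_def disjoint_family_on_def)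
    moreover have "(\<lambda>b. PiM (Kb b) (\<lambda>_. mat_borel N N)) = case_bool (PiM (Kb True) (\<lambda>_. mat_borel N N)) (PiM (Kb False) (\<lambda>_. mat_borel N N))"
      "(\<lambda>b \<omega>. restrict (\<lambda>i. case_sum U Y i \<omega>) (Kb b)) =
        case_bool (\<lambda>\<omega>. restrict (\<lambda>i. case_sum U Y i \<omega>) (Kb True)) (\<lambda>\<omega>. restrict (\<lambda>i. case_sum U Y i \<omega>) (Kb False))"
      by (auto simp: fun_eq_iff split: bool.split)
    ultimately have iv: "indep_var (PiM (Kb True) (\<lambda>_. mat_borel N N)) (\<lambda>\<omega>. restrict (\<lambda>i. case_sum U Y i \<omega>) (Kb True))
        (PiM (Kb False) (\<lambda>_. mat_borel N N)) (\<lambda>\<omega>. restrict (\<lambda>i. case_sum U Y i \<omega>) (Kb False))"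
      unfolding indep_var_def by simp
    let ?f1 = "\<lambda>h :: 'r + 'r \<Rightarrow> complex mat. \<Prod>r\<in>J. ?g r (h (Inl r))"
    let ?f2 = "\<lambda>h :: 'r + 'r \<Rightarrow> complex mat. trace_prod N (case_sum (\<lambda>r. perm_entry (\<sigma> r)) (\<lambda>r x y. h (Inr r) $$ (x, y))) L"
    have f1: "?f1 \<in> borel_measurable (PiM (Kb True) (\<lambda>_. mat_borel N N))"
    proof (intro borel_measurable_prod)
      fix r assume "r \<in> J"
      then have "(\<lambda>h. h (Inl r)) \<in> measurable (PiM (Kb True) (\<lambda>_. mat_borel N N)) (mat_borel N N)"
        by (intro measurable_component_singleton) (auto simp: Kb_def)
      from measurable_compose[OF this g]
      show "(\<lambda>h. ?g r (h (Inl r))) \<in> borel_measurable (PiM (Kb True) (\<lambda>_. mat_borel N N))" .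
    qed
    have f2: "?f2 \<in> borel_measurable (PiM (Kb False) (\<lambda>_. mat_borel N N))"
    proof (rule trace_prod_measurable)
      fix i x y assume i: "i \<in> fst ` (\<Union>w\<in>set L. set w)" and xy: "x < N" "y < N"
      show "(\<lambda>h. case_sum (\<lambda>r. perm_entry (\<sigma> r)) (\<lambda>r x y. h (Inr r) $$ (x, y)) i x y)
        \<in> borel_measurable (PiM (Kb False) (\<lambda>_. mat_borel N N))"
      proof (cases i)
        case (Inr r)
        then have "r \<in> J" using idx[OF i] by auto
        then have "(\<lambda>h. h (Inr r)) \<in> measurable (PiM (Kb False) (\<lambda>_. mat_borel N N)) (mat_borel N N)"
          by (intro measurable_component_singleton) (auto simp: Kb_def)
        from measurable_compose[OF this measurable_mat_entry[OF xy]]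
        show ?thesis by (simp add: Inr)
      qed simp
    qed
    from indep_var_compose[OF iv f1 f2]
    have "indep_var borel (\<lambda>\<omega>. ?f1 (restrict (\<lambda>i. case_sum U Y i \<omega>) (Kb True))) borel
        (\<lambda>\<omega>. ?f2 (restrict (\<lambda>i. case_sum U Y i \<omega>) (Kb False)))"
      by (simp add: comp_def)
    moreover have "?f1 (restrict (\<lambda>i. case_sum U Y i \<omega>) (Kb True)) = ind \<sigma> \<omega>" for \<omega>
      unfolding ind_def by (intro prod.cong) (auto simp: Kb_def)
    moreover have "?f2 (restrict (\<lambda>i. case_sum U Y i \<omega>) (Kb False)) = trace_prod N (F \<sigma> \<omega>) L" for \<omega>
      unfolding F_def
    proof (rule trace_prod_cong)
      fix i x y assume "i \<in> fst ` (\<Union>w\<in>set L. set w)"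
      then show "case_sum (\<lambda>r. perm_entry (\<sigma> r)) (\<lambda>r x y. restrict (\<lambda>i. case_sum U Y i \<omega>) (Kb False) (Inr r) $$ (x, y)) i x y =
        case_sum (\<lambda>r. perm_entry (\<sigma> r)) (\<lambda>r x y. Y r \<omega> $$ (x, y)) i x y"
        using idx[of i] by (auto simp: Kb_def)
    qed
    ultimately have "indep_var borel (ind \<sigma>) borel (\<lambda>\<omega>. trace_prod N (F \<sigma> \<omega>) L)"
      by simp
    note ind2 = this ind_int int[OF \<sigma>]
    show ?thesis
      using indep_var_integrable[OF ind2] indep_var_lebesgue_integral[OF ind2] by (simp add: E_ind)
  qed
  note S = this
  have "integrable M (\<lambda>\<omega>. \<Sum>\<sigma>\<in>Q. ind \<sigma> \<omega> * trace_prod N (F \<sigma> \<omega>) L)"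
    using S by (intro Bochner_Integration.integrable_sum) auto
  then show "integrable M (\<lambda>\<omega>. trace_prod N (?X \<omega>) L)"
    using expand by (subst Bochner_Integration.integrable_cong[OF refl]) auto
  have "(\<integral>\<omega>. trace_prod N (?X \<omega>) L \<partial>M) = (\<integral>\<omega>. (\<Sum>\<sigma>\<in>Q. ind \<sigma> \<omega> * trace_prod N (F \<sigma> \<omega>) L) \<partial>M)"
    using expand by (intro Bochner_Integration.integral_cong) auto
  also have "\<dots> = (\<Sum>\<sigma>\<in>Q. \<integral>\<omega>. ind \<sigma> \<omega> * trace_prod N (F \<sigma> \<omega>) L \<partial>M)"
    using S by (intro Bochner_Integration.integral_sum) auto
  finally show "(\<integral>\<omega>. trace_prod N (?X \<omega>) L \<partial>M) = (\<Sum>\<sigma>\<in>Q. \<integral>\<omega>. trace_prod N (F \<sigma> \<omega>) L \<partial>M) / fact N ^ card J"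
    using S by (simp add: sum_divide_distrib)
qed

section \<open>Moments of circular and free Poisson elements\<close>

text \<open>Arbitrary sets of positions are allowed, since the recursion produces gaps and end
  segments and not only initial segments.\<close>

definition ncp :: "nat set \<Rightarrow> nat set set set" where
  "ncp A = {\<pi>. partition_on A \<pi> \<and>
     (\<forall>V\<in>\<pi>. \<forall>W\<in>\<pi>. \<forall>a\<in>V. \<forall>b\<in>W. \<forall>c\<in>V. \<forall>d\<in>W. a < b \<and> b < c \<and> c < d \<longrightarrow> V = W)}"

definition nc_sum :: "(nat set \<Rightarrow> complex) \<Rightarrow> nat set \<Rightarrow> complex" where
  "nc_sum K A = (\<Sum>\<pi>\<in>ncp A. \<Prod>V\<in>\<pi>. K V)"

lemma ncp_crossD:
  "\<pi> \<in> ncp A \<Longrightarrow> V \<in> \<pi> \<Longrightarrow> W \<in> \<pi> \<Longrightarrow> a \<in> V \<Longrightarrow> b \<in> W \<Longrightarrow> c \<in> V \<Longrightarrow> d \<in> W \<Longrightarrow>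
     a < b \<Longrightarrow> b < c \<Longrightarrow> c < d \<Longrightarrow> V = W"
  unfolding ncp_def by blast

lemma ncpD:
  assumes "\<pi> \<in> ncp A"
  shows "partition_on A \<pi>" "\<Union>\<pi> = A" "{} \<notin> \<pi>"
    "\<And>V W x. V \<in> \<pi> \<Longrightarrow> W \<in> \<pi> \<Longrightarrow> x \<in> V \<Longrightarrow> x \<in> W \<Longrightarrow> V = W"
    "\<And>V. V \<in> \<pi> \<Longrightarrow> V \<subseteq> A"
proof -
  show *: "partition_on A \<pi>" using assms by (simp add: ncp_def)
  show "\<Union>\<pi> = A" "{} \<notin> \<pi>" using * by (auto simp: partition_on_def)
  show "\<And>V W x. V \<in> \<pi> \<Longrightarrow> W \<in> \<pi> \<Longrightarrow> x \<in> V \<Longrightarrow> x \<in> W \<Longrightarrow> V = W"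
    using partition_onD2[OF *] by (auto simp: disjoint_def)
  show "\<And>V. V \<in> \<pi> \<Longrightarrow> V \<subseteq> A" using * by (auto simp: partition_on_def)
qed

lemma ncpI:
  assumes "\<Union>\<pi> = A" "{} \<notin> \<pi>" "\<And>V W x. V \<in> \<pi> \<Longrightarrow> W \<in> \<pi> \<Longrightarrow> x \<in> V \<Longrightarrow> x \<in> W \<Longrightarrow> V = W"
    "\<And>V W a b c d. V \<in> \<pi> \<Longrightarrow> W \<in> \<pi> \<Longrightarrow> a \<in> V \<Longrightarrow> b \<in> W \<Longrightarrow> c \<in> V \<Longrightarrow> d \<in> W \<Longrightarrow>
      a < b \<Longrightarrow> b < c \<Longrightarrow> c < d \<Longrightarrow> V = W"
  shows "\<pi> \<in> ncp A"
proof -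
  have "disjoint \<pi>" unfolding disjoint_def using assms(3) by blast
  then have "partition_on A \<pi>" using assms(1,2) by (simp add: partition_on_def)
  then show ?thesis unfolding ncp_def using assms(4) by blast
qed

lemma finite_ncp: "finite A \<Longrightarrow> finite (ncp A)"
  unfolding ncp_def by (rule finite_subset[OF _ finitely_many_partition_on]) auto

lemma finite_ncp_member: "finite A \<Longrightarrow> \<pi> \<in> ncp A \<Longrightarrow> finite \<pi>"
  using ncpD(5) by (meson PowI finite_Pow_iff finite_subset subsetI)

lemma nc_sum_empty [simp]: "nc_sum K {} = 1"
proof -
  have "ncp {} = {{}}" by (auto simp: ncp_def partition_on_def)
  then show ?thesis by (simp add: nc_sum_def)
qed

lemma nc_sum_cong:
  assumes "\<And>V. V \<subseteq> A \<Longrightarrow> V \<noteq> {} \<Longrightarrow> K V = K' V"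
  shows "nc_sum K A = nc_sum K' A"
  unfolding nc_sum_def
proof (intro sum.cong prod.cong refl)
  fix \<pi> V assume "\<pi> \<in> ncp A" "V \<in> \<pi>"
  then show "K V = K' V" using ncpD(3,5)[of \<pi> A] assms[of V] by auto
qed

lemma nc_sum_eq_0:
  assumes "j \<in> A" "finite A" "\<And>V. V \<subseteq> A \<Longrightarrow> j \<in> V \<Longrightarrow> K V = 0"
  shows "nc_sum K A = 0"
  unfolding nc_sum_def
proof (intro sum.neutral ballI)
  fix \<pi> assume \<pi>: "\<pi> \<in> ncp A"
  then obtain V where "V \<in> \<pi>" "j \<in> V" using assms(1) ncpD(2) by blast
  then show "(\<Prod>V\<in>\<pi>. K V) = 0"
    using ncpD(5)[OF \<pi>] assms(3) finite_ncp_member[OF assms(2) \<pi>] by (intro prod_zero bexI[of _ V]) auto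
qed

lemma ncp_image:
  assumes "strict_mono_on A r" "\<pi> \<in> ncp A"
  shows "(`) r ` \<pi> \<in> ncp (r ` A)"
proof -
  note \<pi> = ncpD[OF assms(2)]
  have inj: "inj_on r A" using assms(1) by (rule strict_mono_on_imp_inj_on)
  have less: "a < b" if "r a < r b" "a \<in> A" "b \<in> A" for a b
    using assms(1) that by (metis linorder_neqE_nat order_less_asym strict_mono_onD)
  show ?thesis
  proof (rule ncpI)
    show "\<Union> ((`) r ` \<pi>) = r ` A" using \<pi>(2) by auto
    show "{} \<notin> (`) r ` \<pi>" using \<pi>(3) by auto
  next
    fix V W x assume "V \<in> (`) r ` \<pi>" "W \<in> (`) r ` \<pi>" "x \<in> V" "x \<in> W"
    then obtain V' W' a b where *: "V = r ` V'" "W = r ` W'" "V' \<in> \<pi>" "W' \<in> \<pi>" "a \<in> V'" "b \<in> W'" "r a = r b"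
      by (auto simp: image_iff)
    then have "a = b" using inj \<pi>(5) by (meson inj_onD subsetD)
    then show "V = W" using * \<pi>(4) by blast
  next
    fix V W a b c d assume "V \<in> (`) r ` \<pi>" "W \<in> (`) r ` \<pi>" "a \<in> V" "b \<in> W" "c \<in> V" "d \<in> W"
      and l: "a < b" "b < c" "c < d"
    then obtain V' W' where VW: "V = r ` V'" "W = r ` W'" "V' \<in> \<pi>" "W' \<in> \<pi>" by auto
    obtain a' where a': "a = r a'" "a' \<in> V'" using \<open>a \<in> V\<close> VW by auto
    obtain b' where b': "b = r b'" "b' \<in> W'" using \<open>b \<in> W\<close> VW by auto
    obtain c' where c': "c = r c'" "c' \<in> V'" using \<open>c \<in> V\<close> VW by auto
    obtain d' where d': "d = r d'" "d' \<in> W'" using \<open>d \<in> W\<close> VW by auto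
    have "V' \<subseteq> A" "W' \<subseteq> A" using \<pi>(5) VW by auto
    then have "a' < b'" "b' < c'" "c' < d'"
      using l a' b' c' d' by (auto intro!: less)
    then have "V' = W'"
      using ncp_crossD[OF assms(2) VW(3,4)] a' b' c' d' by blast
    then show "V = W" using VW by simp
  qed
qed

text \<open>Crossings depend only on the order, so an increasing relabelling is a bijection of
  non-crossing partitions. It carries statements about initial segments over to other finite
  sets.\<close>

lemma nc_sum_reindex:
  assumes "strict_mono_on A r"
  shows "nc_sum K (r ` A) = nc_sum (\<lambda>V. K (r ` V)) A"
proof -
  have inj: "inj_on r A" using assms by (rule strict_mono_on_imp_inj_on)
  let ?s = "the_inv_into A r"
  have s: "?s (r x) = x" if "x \<in> A" for x
    using that inj by (rule the_inv_into_f_f[rotated])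
  have mono_s: "strict_mono_on (r ` A) ?s"
  proof (rule strict_mono_onI)
    fix x y assume "x \<in> r ` A" "y \<in> r ` A" "x < y"
    then show "?s x < ?s y"
      using assms s by (metis imageE linorder_neqE_nat order_less_asym strict_mono_onD)
  qed
  have sr: "?s ` r ` V = V" if "V \<subseteq> A" for V
  proof -
    have "?s ` r ` V = (\<lambda>x. x) ` V" unfolding image_image using that s by (intro image_cong) auto
    then show ?thesis by simp
  qed
  have rs: "r ` ?s ` V = V" if "V \<subseteq> r ` A" for V
    using that sr by (metis subset_imageE)
  have img_id: "(`) g ` (`) f ` \<pi> = \<pi>" if "\<And>V. V \<in> \<pi> \<Longrightarrow> g ` f ` V = V"
    for f g :: "nat \<Rightarrow> nat" and \<pi>
    using that by (force simp: image_iff)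
  have "nc_sum (\<lambda>V. K (r ` V)) A = (\<Sum>\<pi>\<in>ncp (r ` A). \<Prod>V\<in>\<pi>. K V)"
    unfolding nc_sum_def
  proof (rule sum.reindex_bij_witness[where i = "(`) ((`) ?s)" and j = "(`) ((`) r)"])
    fix \<pi> assume \<pi>: "\<pi> \<in> ncp A"
    then show "(`) r ` \<pi> \<in> ncp (r ` A)" by (rule ncp_image[OF assms])
    show "(`) ?s ` (`) r ` \<pi> = \<pi>" using ncpD(5)[OF \<pi>] sr by (intro img_id) auto
    have "inj_on ((`) r) \<pi>"
      using inj_on_image[of r \<pi>] inj ncpD(2)[OF \<pi>] by simp
    then show "(\<Prod>V\<in>(`) r ` \<pi>. K V) = (\<Prod>V\<in>\<pi>. K (r ` V))"
      by (simp add: prod.reindex)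
  next
    fix \<pi> assume \<pi>: "\<pi> \<in> ncp (r ` A)"
    show "(`) r ` (`) ?s ` \<pi> = \<pi>" using ncpD(5)[OF \<pi>] rs by (intro img_id) auto
    show "(`) ?s ` \<pi> \<in> ncp A"
      using ncp_image[OF mono_s \<pi>] sr[of A] by simp
  qed
  then show ?thesis by (simp add: nc_sum_def)
qed

text \<open>
  A non-crossing partition of a set with minimum \<open>a\<close> either has \<open>{a}\<close> as a block, or the next
  element \<open>j\<close> of the block of \<open>a\<close> cuts it into a non-crossing partition of the gap between \<open>a\<close>
  and \<open>j\<close>, and one of the elements from \<open>j\<close> on, where \<open>a\<close> is to be added to the block of \<open>j\<close>.
\<close>

lemma nc_sum_first_gap:
  assumes fin: "finite A" and a: "a \<in> A" and min: "\<And>x. x \<in> A \<Longrightarrow> a \<le> x"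
  shows "nc_sum K A = K {a} * nc_sum K (A - {a}) +
    (\<Sum>j\<in>A - {a}. nc_sum K {x\<in>A. a < x \<and> x < j} *
       nc_sum (\<lambda>V. if j \<in> V then K (insert a V) else K V) {x\<in>A. j \<le> x})"
proof -
  define P0 where "P0 = {\<pi>\<in>ncp A. {a} \<in> \<pi>}"
  define P where "P j = {\<pi>\<in>ncp A. \<exists>V\<in>\<pi>. a \<in> V \<and> j \<in> V \<and> (\<forall>x\<in>V. x = a \<or> j \<le> x)}" for j
  let ?A = "A - {a}"
  have fin0: "finite P0" and finP: "finite (P j)" for j
    using finite_ncp[OF fin] by (auto simp: P0_def P_def)
  have "ncp A = P0 \<union> (\<Union>j\<in>?A. P j)"
  proof (intro equalityI subsetI)
    fix \<pi> assume \<pi>: "\<pi> \<in> ncp A"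
    then obtain V where V: "V \<in> \<pi>" "a \<in> V" using a ncpD(2) by blast
    show "\<pi> \<in> P0 \<union> (\<Union>j\<in>?A. P j)"
    proof (cases "V = {a}")
      case False
      have finV: "finite (V - {a})" using ncpD(5)[OF \<pi> V(1)] fin by (auto intro: finite_subset)
      have neV: "V - {a} \<noteq> {}" using False V(2) by auto
      have "Min (V - {a}) \<in> V - {a}" using finV neV by (rule Min_in)
      moreover have "Min (V - {a}) \<le> x" if "x \<in> V" "x \<noteq> a" for x
        using finV that by (intro Min_le) auto
      ultimately have "\<pi> \<in> P (Min (V - {a}))" "Min (V - {a}) \<in> ?A"
        using \<pi> V ncpD(5)[OF \<pi> V(1)] unfolding P_def by blast+
      then show ?thesis by blast
    qed (use \<pi> V in \<open>auto simp: P0_def\<close>)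
  qed (auto simp: P0_def P_def)
  moreover have "P0 \<inter> (\<Union>j\<in>?A. P j) = {}"
  proof -
    have False if P: "\<pi> \<in> P0" "\<pi> \<in> P j" "j \<in> ?A" for \<pi> j
    proof -
      obtain V where "\<pi> \<in> ncp A" "{a} \<in> \<pi>" "V \<in> \<pi>" "a \<in> V" "j \<in> V"
        using P unfolding P0_def P_def by blast
      then have "V = {a}" using ncpD(4)[of \<pi> A V "{a}" a] by simp
      then show False using \<open>j \<in> V\<close> P(3) by simp
    qed
    then show ?thesis by blast
  qed
  ultimately have split: "nc_sum K A = (\<Sum>\<pi>\<in>P0. \<Prod>V\<in>\<pi>. K V) + (\<Sum>\<pi>\<in>(\<Union>j\<in>?A. P j). \<Prod>V\<in>\<pi>. K V)"
    unfolding nc_sum_def using fin0 finP fin by (simp add: sum.union_disjoint)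
  have "(\<Sum>\<pi>\<in>(\<Union>j\<in>?A. P j). \<Prod>V\<in>\<pi>. K V) = (\<Sum>j\<in>?A. \<Sum>\<pi>\<in>P j. \<Prod>V\<in>\<pi>. K V)"
  proof (rule sum.UNION_disjoint)
    have False if P: "\<pi> \<in> P i" "\<pi> \<in> P j" "i \<in> ?A" "j \<in> ?A" "i \<noteq> j" for \<pi> i j
    proof -
      obtain V W where "\<pi> \<in> ncp A" "V \<in> \<pi>" "a \<in> V" "i \<in> V" "\<forall>x\<in>V. x = a \<or> i \<le> x"
        "W \<in> \<pi>" "a \<in> W" "j \<in> W" "\<forall>x\<in>W. x = a \<or> j \<le> x"
        using P unfolding P_def by blast
      moreover from this have "V = W" using ncpD(4) by blast
      ultimately show False using P by (metis Diff_iff insertCI order_antisym)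
    qed
    then show "\<forall>i\<in>?A. \<forall>j\<in>?A. i \<noteq> j \<longrightarrow> P i \<inter> P j = {}" by blast
  qed (use fin finP in auto)
  moreover have "(\<Sum>\<pi>\<in>P0. \<Prod>V\<in>\<pi>. K V) = K {a} * nc_sum K ?A"
  proof -
    have "(\<Sum>\<pi>\<in>P0. \<Prod>V\<in>\<pi>. K V) = (\<Sum>\<pi>\<in>ncp ?A. K {a} * (\<Prod>V\<in>\<pi>. K V))"
    proof (rule sum.reindex_bij_witness[where i = "insert {a}" and j = "\<lambda>\<pi>. \<pi> - {{a}}"])
      fix \<pi> assume "\<pi> \<in> P0"
      then have \<pi>: "\<pi> \<in> ncp A" "{a} \<in> \<pi>" by (auto simp: P0_def)
      show "insert {a} (\<pi> - {{a}}) = \<pi>" using \<pi> by auto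
      have "V = {a}" if "V \<in> \<pi>" "a \<in> V" for V using ncpD(4)[OF \<pi>(1) that(1) \<pi>(2) that(2)] by simp
      then have U: "\<Union>(\<pi> - {{a}}) = ?A" using ncpD(2)[OF \<pi>(1)] by blast
      show "\<pi> - {{a}} \<in> ncp ?A"
      proof (rule ncpI)
        show "\<Union>(\<pi> - {{a}}) = ?A" by (rule U)
        show "{} \<notin> \<pi> - {{a}}" using ncpD(3)[OF \<pi>(1)] by blast
      next
        fix V W x assume "V \<in> \<pi> - {{a}}" "W \<in> \<pi> - {{a}}" "x \<in> V" "x \<in> W"
        then show "V = W" using ncpD(4)[OF \<pi>(1), of V W x] by blast
      next
        fix V W p q r t assume "V \<in> \<pi> - {{a}}" "W \<in> \<pi> - {{a}}" "p \<in> V" "q \<in> W" "r \<in> V" "t \<in> W"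
          "p < q" "q < r" "r < t"
        then show "V = W" using ncp_crossD[OF \<pi>(1), of V W p q r t] by blast
      qed
      show "K {a} * (\<Prod>V\<in>\<pi> - {{a}}. K V) = (\<Prod>V\<in>\<pi>. K V)"
        using prod.remove[OF finite_ncp_member[OF fin \<pi>(1)] \<pi>(2), of K] by simp
    next
      fix \<pi> assume \<pi>: "\<pi> \<in> ncp ?A"
      have na: "a \<notin> V" if "V \<in> \<pi>" for V using ncpD(5)[OF \<pi> that] by auto
      then show "insert {a} \<pi> - {{a}} = \<pi>" by auto
      have "insert {a} \<pi> \<in> ncp A"
      proof (rule ncpI)
        show "\<Union>(insert {a} \<pi>) = A" using ncpD(2)[OF \<pi>] a by auto
        show "{} \<notin> insert {a} \<pi>" using ncpD(3)[OF \<pi>] by auto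
      next
        fix V W x assume "V \<in> insert {a} \<pi>" "W \<in> insert {a} \<pi>" "x \<in> V" "x \<in> W"
        then show "V = W" using na ncpD(4)[OF \<pi>] by blast
      next
        fix V W p q r t assume VW: "V \<in> insert {a} \<pi>" "W \<in> insert {a} \<pi>" "p \<in> V" "q \<in> W" "r \<in> V" "t \<in> W"
          and l: "p < q" "q < r" "r < t"
        have "V \<noteq> {a}" "W \<noteq> {a}" using VW l by auto
        then show "V = W" using VW l ncp_crossD[OF \<pi>, of V W p q r t] by blast
      qed
      then show "insert {a} \<pi> \<in> P0" by (simp add: P0_def)
    qed
    then show ?thesis by (simp add: nc_sum_def sum_distrib_left)
  qed
  moreover have "(\<Sum>\<pi>\<in>P j. \<Prod>V\<in>\<pi>. K V) = nc_sum K {x\<in>A. a < x \<and> x < j} *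
       nc_sum (\<lambda>V. if j \<in> V then K (insert a V) else K V) {x\<in>A. j \<le> x}" if j: "j \<in> ?A" for j
  proof -
    let ?B = "{x\<in>A. a < x \<and> x < j}" and ?C = "{x\<in>A. j \<le> x}"
    let ?K = "\<lambda>V. if j \<in> V then K (insert a V) else K V"
    define g where "g V = (if j \<in> V then insert a V else V)" for V
    have aj: "a < j" using min[of j] j by auto
    have fin': "finite ?B" "finite ?C" using fin by auto
    have A_eq: "A = insert a (?B \<union> ?C)" using a min aj by force
    \<comment> \<open>The blocks inside the gap form \<open>\<rho>\<close>; the other blocks, freed
      of \<open>a\<close>, form \<open>\<tau>\<close>. Conversely \<open>g\<close> puts
      \<open>a\<close> back into the block of \<open>j\<close>.\<close>
    have "(\<Sum>(\<rho>, \<tau>)\<in>ncp ?B \<times> ncp ?C. (\<Prod>V\<in>\<rho>. K V) * (\<Prod>V\<in>\<tau>. ?K V)) = (\<Sum>\<pi>\<in>P j. \<Prod>V\<in>\<pi>. K V)"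
    proof (rule sum.reindex_bij_witness[where j = "\<lambda>(\<rho>, \<tau>). \<rho> \<union> g ` \<tau>"
          and i = "\<lambda>\<pi>. ({V\<in>\<pi>. V \<subseteq> ?B}, (\<lambda>V. V - {a}) ` {V\<in>\<pi>. \<not> V \<subseteq> ?B})"])
      fix x assume "x \<in> ncp ?B \<times> ncp ?C"
      then obtain \<rho> \<tau> where x: "x = (\<rho>, \<tau>)" and \<rho>: "\<rho> \<in> ncp ?B" and \<tau>: "\<tau> \<in> ncp ?C" by auto
      have \<rho>B: "V \<subseteq> ?B" if "V \<in> \<rho>" for V using ncpD(5)[OF \<rho> that] .
      have \<tau>C: "V \<subseteq> ?C" if "V \<in> \<tau>" for V using ncpD(5)[OF \<tau> that] .
      have g_sub: "V \<subseteq> g V" "g V \<subseteq> insert a V" for V by (auto simp: g_def)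
      have na: "a \<notin> V" if "V \<in> \<tau>" for V using \<tau>C[OF that] aj by auto
      have g_inv: "g V - {a} = V" if "V \<in> \<tau>" for V using na[OF that] by (auto simp: g_def)
      have not_B: "\<not> g V \<subseteq> ?B" if V: "V \<in> \<tau>" for V
      proof -
        have "V \<noteq> {}" using V ncpD(3)[OF \<tau>] by auto
        then obtain y where "y \<in> V" by blast
        then have "y \<in> g V" "y \<notin> ?B" using \<tau>C[OF V] g_sub(1)[of V] by auto
        then show ?thesis by blast
      qed
      have "{V \<in> \<rho> \<union> g ` \<tau>. V \<subseteq> ?B} = \<rho>" "{V \<in> \<rho> \<union> g ` \<tau>. \<not> V \<subseteq> ?B} = g ` \<tau>"
        using \<rho>B not_B by blast+
      moreover have "(\<lambda>V. V - {a}) ` g ` \<tau> = \<tau>"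
        unfolding image_image using g_inv by simp
      ultimately show "(case case x of (\<rho>, \<tau>) \<Rightarrow> \<rho> \<union> g ` \<tau> of
          \<pi> \<Rightarrow> ({V\<in>\<pi>. V \<subseteq> ?B}, (\<lambda>V. V - {a}) ` {V\<in>\<pi>. \<not> V \<subseteq> ?B})) = x"
        by (simp add: x)
      have "j \<in> \<Union>\<tau>" using ncpD(2)[OF \<tau>] j by simp
      then obtain V0 where V0: "V0 \<in> \<tau>" "j \<in> V0" by (rule UnionE)
      have gU: "\<Union>(g ` \<tau>) = insert a ?C"
      proof -
        have "y \<in> insert a ?C" if "V \<in> \<tau>" "y \<in> g V" for V y
        proof -
          have "y \<in> insert a V" using g_sub(2)[of V] that(2) by (rule subsetD)
          then show ?thesis using subsetD[OF \<tau>C[OF that(1)], of y] by auto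
        qed
        moreover have "y \<in> \<Union>(g ` \<tau>)" if y: "y \<in> ?C" for y
        proof -
          have "y \<in> \<Union>\<tau>" using y ncpD(2)[OF \<tau>] by simp
          then obtain V where V: "V \<in> \<tau>" "y \<in> V" by (rule UnionE)
          then have "y \<in> g V" using g_sub(1) by blast
          then show ?thesis using V(1) by blast
        qed
        moreover have "a \<in> \<Union>(g ` \<tau>)"
          using V0 by (intro UN_I[of V0]) (simp_all add: g_def)
        ultimately show ?thesis by blast
      qed
      have gV: "g V = g W" if "V \<in> \<tau>" "W \<in> \<tau>" "y \<in> g V" "y \<in> g W" for V W y
      proof (cases "y = a")
        case True
        then have "j \<in> V" "j \<in> W" using that na by (auto simp: g_def split: if_splits)
        then show ?thesis using ncpD(4)[OF \<tau>] that by blast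
      next
        case False
        then have "y \<in> V" "y \<in> W" using that by (auto simp: g_def split: if_splits)
        then show ?thesis using ncpD(4)[OF \<tau>] that by blast
      qed
      have gC: "g V \<subseteq> insert a ?C" if "V \<in> \<tau>" for V using gU that by blast
      have "\<rho> \<union> g ` \<tau> \<in> ncp A"
      proof (rule ncpI)
        show "\<Union>(\<rho> \<union> g ` \<tau>) = A"
          using ncpD(2)[OF \<rho>] gU A_eq by (simp add: Union_Un_distrib)
        show "{} \<notin> \<rho> \<union> g ` \<tau>" using ncpD(3)[OF \<rho>] not_B by auto
      next
        fix V W y assume "V \<in> \<rho> \<union> g ` \<tau>" "W \<in> \<rho> \<union> g ` \<tau>" and y: "y \<in> V" "y \<in> W"
        moreover have False if "V \<in> \<rho>" "W \<in> g ` \<tau>" "y \<in> V" "y \<in> W" for V W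
        proof -
          have "y \<in> ?B" "y \<in> insert a ?C" using that \<rho>B gC by blast+
          then show False by auto
        qed
        ultimately show "V = W" using ncpD(4)[OF \<rho>] gV by blast
      next
        fix V W p q r t assume VW: "V \<in> \<rho> \<union> g ` \<tau>" "W \<in> \<rho> \<union> g ` \<tau>"
          and e: "p \<in> V" "q \<in> W" "r \<in> V" "t \<in> W" and l: "p < q" "q < r" "r < t"
        consider "V \<in> \<rho>" "W \<in> \<rho>" | "V \<in> \<rho>" "W \<in> g ` \<tau>" | "V \<in> g ` \<tau>" "W \<in> \<rho>" | "V \<in> g ` \<tau>" "W \<in> g ` \<tau>"
          using VW by blast
        then show "V = W"
        proof cases
          case 1
          then show ?thesis using ncp_crossD[OF \<rho>] e l by blast
        next
          case 2
          then have "p \<in> ?B" "r \<in> ?B" "q \<in> insert a ?C" using \<rho>B gC e by blast+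
          then show ?thesis using l by auto
        next
          case 3
          then have "q \<in> ?B" "t \<in> ?B" "r \<in> insert a ?C" using \<rho>B gC e by blast+
          then show ?thesis using l by auto
        next
          case 4
          then obtain V' W' where V': "V = g V'" "V' \<in> \<tau>" and W': "W = g W'" "W' \<in> \<tau>" by auto
          have "p \<in> insert a ?C" "q \<in> insert a ?C" "r \<in> insert a ?C" "t \<in> insert a ?C"
            using V' W' gC e by blast+
          then have C: "q \<in> ?C" "r \<in> ?C" "t \<in> ?C" using l min by fastforce+
          then have "q \<noteq> a" "r \<noteq> a" "t \<noteq> a" using aj by auto
          then have q: "q \<in> W'" "r \<in> V'" "t \<in> W'" using e V' W' by (auto simp: g_def split: if_splits)
          show ?thesis
          \<comment> \<open>A crossing that starts at the added point \<open>a\<close> becomes one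
            in \<open>\<tau>\<close> that starts at \<open>j\<close>, an element of the same block;
            if q = j, the two blocks already share \<open>j\<close>.\<close>
          proof (cases "p = a")
            case True
            then have jV: "j \<in> V'" using e V' na by (auto simp: g_def split: if_splits)
            show ?thesis
            proof (cases "q = j")
              case True
              then show ?thesis using q jV ncpD(4)[OF \<tau>] V' W' by blast
            next
              case False
              then have "j < q" using C by auto
              then show ?thesis using ncp_crossD[OF \<tau> V'(2) W'(2) jV q(1,2,3)] l V' W' by simp
            qed
          next
            case False
            then have "p \<in> V'" using e V' by (auto simp: g_def split: if_splits)
            then show ?thesis using ncp_crossD[OF \<tau> V'(2) W'(2) _ q(1,2,3)] l V' W' by simp
          qed
        qed
      qed
      moreover have "g V0 \<in> g ` \<tau>" "a \<in> g V0" "j \<in> g V0" "\<forall>x\<in>g V0. x = a \<or> j \<le> x"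
        using V0 \<tau>C[OF V0(1)] by (auto simp: g_def)
      ultimately show "(case x of (\<rho>, \<tau>) \<Rightarrow> \<rho> \<union> g ` \<tau>) \<in> P j"
        unfolding x P_def prod.case by (intro CollectI conjI bexI[of _ "g V0"] UnI2) simp_all
      have inj_g: "inj_on g \<tau>" using g_inv by (metis inj_onI)
      have "\<rho> \<inter> g ` \<tau> = {}" using \<rho>B not_B by blast
      moreover have "finite \<rho>" "finite \<tau>" using finite_ncp_member[OF _ \<rho>] finite_ncp_member[OF _ \<tau>] fin' by auto
      ultimately have "(\<Prod>V\<in>\<rho> \<union> g ` \<tau>. K V) = (\<Prod>V\<in>\<rho>. K V) * (\<Prod>V\<in>\<tau>. K (g V))"
        by (simp add: prod.union_disjoint prod.reindex[OF inj_g])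
      moreover have "(\<Prod>V\<in>\<tau>. K (g V)) = (\<Prod>V\<in>\<tau>. ?K V)"
        by (intro prod.cong) (auto simp: g_def)
      ultimately show "(\<Prod>V\<in>(case x of (\<rho>, \<tau>) \<Rightarrow> \<rho> \<union> g ` \<tau>). K V) =
          (case x of (\<rho>, \<tau>) \<Rightarrow> (\<Prod>V\<in>\<rho>. K V) * (\<Prod>V\<in>\<tau>. ?K V))"
        by (simp add: x)
    next
      fix \<pi> assume "\<pi> \<in> P j"
      then obtain V0 where \<pi>: "\<pi> \<in> ncp A" and V0: "V0 \<in> \<pi>" "a \<in> V0" "j \<in> V0" "\<forall>x\<in>V0. x = a \<or> j \<le> x"
        by (auto simp: P_def)
      let ?R = "{V\<in>\<pi>. V \<subseteq> ?B}" and ?T = "{V\<in>\<pi>. \<not> V \<subseteq> ?B}"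
      \<comment> \<open>A block different from that of \<open>a\<close> which had points b < j < c
        on both sides of \<open>j\<close> would cross it, because a < b < j < c.\<close>
      have BC: "V \<subseteq> ?C" if V: "V \<in> ?T" "V \<noteq> V0" for V
      proof (rule ccontr)
        assume not_C: "\<not> V \<subseteq> ?C"
        have VA: "V \<in> \<pi>" "V \<subseteq> A" using V(1) ncpD(5)[OF \<pi>] by auto
        have aV: "a \<notin> V" "j \<notin> V"
          using ncpD(4)[OF \<pi> VA(1) V0(1) _ V0(2)] ncpD(4)[OF \<pi> VA(1) V0(1) _ V0(3)] V(2) by auto
        have in_BC: "x \<in> ?B \<or> x \<in> ?C" if "x \<in> V" for x
        proof -
          have "x \<in> insert a (?B \<union> ?C)" using VA(2) A_eq that by auto
          then show ?thesis using that aV by auto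
        qed
        obtain b where b: "b \<in> V" "b \<notin> ?C" using not_C by blast
        obtain c where c: "c \<in> V" "c \<notin> ?B" using V(1) by blast
        have "b \<in> ?B" "c \<in> ?C" using in_BC b c by blast+
        moreover have "c \<noteq> j" using aV c by blast
        ultimately have "V0 = V"
          using ncp_crossD[OF \<pi> V0(1) VA(1) V0(2) b(1) V0(3) c(1)] by auto
        then show False using V(2) by simp
      qed
      have V0C: "V0 - {a} \<subseteq> ?C" using V0(4) ncpD(5)[OF \<pi> V0(1)] by auto
      have V0T: "V0 \<in> ?T" using V0 by auto
      have TC: "V - {a} \<subseteq> ?C" if "V \<in> ?T" for V using BC[OF that] V0C by blast
      have aT: "V = V0" if "V \<in> \<pi>" "a \<in> V" for V using ncpD(4)[OF \<pi> that(1) V0(1) that(2) V0(2)] .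
      have g_inv: "g (V - {a}) = V" if "V \<in> ?T" for V
      proof (cases "V = V0")
        case True
        then show ?thesis using V0 aj by (auto simp: g_def)
      next
        case False
        then have "a \<notin> V" "j \<notin> V" using aT that ncpD(4)[OF \<pi> _ V0(1) _ V0(3)] by blast+
        then show ?thesis by (simp add: g_def)
      qed
      have "g ` (\<lambda>V. V - {a}) ` ?T = ?T" unfolding image_image using g_inv by simp
      then show "(case ({V\<in>\<pi>. V \<subseteq> ?B}, (\<lambda>V. V - {a}) ` {V\<in>\<pi>. \<not> V \<subseteq> ?B}) of (\<rho>, \<tau>) \<Rightarrow> \<rho> \<union> g ` \<tau>) = \<pi>"
        by auto
      have U: "\<Union>\<pi> = A" by (rule ncpD(2)[OF \<pi>])
      have UR: "\<Union>?R = ?B"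
      proof (intro equalityI subsetI)
        fix y assume y: "y \<in> ?B"
        then obtain V where V: "V \<in> \<pi>" "y \<in> V" using U by blast
        have "V \<subseteq> ?B"
        proof (rule ccontr)
          assume "\<not> V \<subseteq> ?B"
          then have "y \<in> ?C \<or> y = a" using TC[of V] V by blast
          then show False using y by auto
        qed
        then show "y \<in> \<Union>?R" using V by blast
      qed blast
      have "?R \<in> ncp ?B"
      proof (rule ncpI)
        show "\<Union>?R = ?B" by (rule UR)
        show "{} \<notin> ?R" using ncpD(3)[OF \<pi>] by blast
      next
        fix V W x assume "V \<in> ?R" "W \<in> ?R" "x \<in> V" "x \<in> W"
        then show "V = W" using ncpD(4)[OF \<pi>, of V W x] by blast
      next
        fix V W p q r t assume "V \<in> ?R" "W \<in> ?R" "p \<in> V" "q \<in> W" "r \<in> V" "t \<in> W"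
          "p < q" "q < r" "r < t"
        then show "V = W" using ncp_crossD[OF \<pi>, of V W p q r t] by blast
      qed
      moreover have "(\<lambda>V. V - {a}) ` ?T \<in> ncp ?C"
      proof (rule ncpI)
        show "\<Union>((\<lambda>V. V - {a}) ` ?T) = ?C"
        proof (intro equalityI subsetI)
          fix y assume y: "y \<in> ?C"
          then obtain V where V: "V \<in> \<pi>" "y \<in> V" using U by blast
          then have "V \<in> ?T" "y \<in> V - {a}" using y aj by auto
          then show "y \<in> \<Union>((\<lambda>V. V - {a}) ` ?T)" by blast
        qed (use TC in blast)
        have "V - {a} \<noteq> {}" if "V \<in> ?T" for V
        proof (cases "V = V0")
          case True
          then show ?thesis using V0(3) aj by auto
        next
          case False
          then have "a \<notin> V" using aT that by blast
          then show ?thesis using ncpD(3)[OF \<pi>] that by auto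
        qed
        then show "{} \<notin> (\<lambda>V. V - {a}) ` ?T" by blast
      next
        fix V W y assume "V \<in> (\<lambda>V. V - {a}) ` ?T" "W \<in> (\<lambda>V. V - {a}) ` ?T" "y \<in> V" "y \<in> W"
        then show "V = W" using ncpD(4)[OF \<pi>] by blast
      next
        fix V W p q r t assume "V \<in> (\<lambda>V. V - {a}) ` ?T" "W \<in> (\<lambda>V. V - {a}) ` ?T"
          "p \<in> V" "q \<in> W" "r \<in> V" "t \<in> W" "p < q" "q < r" "r < t"
        then show "V = W" using ncp_crossD[OF \<pi>, of _ _ p q r t] by blast
      qed
      ultimately show "({V\<in>\<pi>. V \<subseteq> ?B}, (\<lambda>V. V - {a}) ` {V\<in>\<pi>. \<not> V \<subseteq> ?B}) \<in> ncp ?B \<times> ncp ?C"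
        by simp
    qed
    then show ?thesis
      by (simp add: nc_sum_def sum_product sum.cartesian_product)
  qed
  ultimately show ?thesis unfolding split by simp
qed

section \<open>Moment recursions for circular and free Poisson elements\<close>

text \<open>The moment-cumulant formula for a sublist, with the cumulants still indexed by positions
  in the whole list; the rank function \<open>r\<close> translates positions. The empty set is
  treated apart: there \<open>nc_sum\<close> is 1, and the dummy cumulant of the empty list does not
  enter.\<close>

lemma state_eq_nc_sum:
  fixes \<phi> :: "'a::monoid_mult \<Rightarrow> complex"
  assumes "\<phi> 1 = 1" "A \<subseteq> {..<length xs}"
  shows "\<phi> (prod_list (nths xs A)) = nc_sum (\<lambda>V. free_cumulant \<phi> (nths xs V)) A"
proof (cases "A = {}")
  case False
  have fin: "finite A" using assms(2) finite_subset by blast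
  define r where "r i = card {i'\<in>A. i' < i}" for i
  have mono: "strict_mono_on A r"
  proof (rule strict_mono_onI)
    fix i j assume "i \<in> A" "j \<in> A" "i < j"
    then have "{i'\<in>A. i' < i} \<subset> {i'\<in>A. i' < j}" by auto
    then show "r i < r j" unfolding r_def using fin by (intro psubset_card_mono) auto
  qed
  have len: "length (nths xs A) = card A"
  proof -
    have "{i. i < length xs \<and> i \<in> A} = A" using assms(2) by auto
    then show ?thesis by (simp add: length_nths)
  qed
  have rA: "r ` A = {..<card A}"
  proof (rule card_subset_eq)
    show "r ` A \<subseteq> {..<card A}"
    proof safe
      fix i assume "i \<in> A"
      then have "{i'\<in>A. i' < i} \<subset> A" by auto
      then show "r i < card A" unfolding r_def using fin by (intro psubset_card_mono)
    qed
    show "card (r ` A) = card {..<card A}"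
      using card_image[OF strict_mono_on_imp_inj_on[OF mono]] by simp
  qed simp
  have ne: "nths xs A \<noteq> []" using False fin len by (metis card_eq_0_iff length_0_conv)
  have "\<phi> (prod_list (nths xs A)) = nc_sum (\<lambda>V. free_cumulant \<phi> (nths (nths xs A) V)) (r ` A)"
    unfolding moment_cumulant_formula[OF ne, of \<phi>] nc_sum_def ncp_def rA noncrossing_partitions_def len ..
  also have "\<dots> = nc_sum (\<lambda>V. free_cumulant \<phi> (nths (nths xs A) (r ` V))) A"
    by (rule nc_sum_reindex[OF mono])
  also have "\<dots> = nc_sum (\<lambda>V. free_cumulant \<phi> (nths xs V)) A"
  proof (rule nc_sum_cong)
    fix V assume V: "V \<subseteq> A"
    have "{i \<in> A. \<exists>j\<in>r ` V. card {i' \<in> A. i' < i} = j} = V"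
      using V strict_mono_on_imp_inj_on[OF mono] by (auto simp: r_def[symmetric] dest: inj_onD)
    then show "free_cumulant \<phi> (nths (nths xs A) (r ` V)) = free_cumulant \<phi> (nths xs V)"
      by (simp add: nths_nths)
  qed
  finally show ?thesis .
qed (use assms in simp)

text \<open>Passes from cuts at letters of \<open>H\<close> to positions, the form in which the
  first-gap decomposition yields its sum.\<close>

lemma sum_splits:
  "(\<Sum>(B, C)\<leftarrow>splits H A. F B C) =
     (\<Sum>j<length A. if A ! j \<in> H then F (take j A) (drop (Suc j) A) else (0 :: 'b :: comm_monoid_add))"
proof (induction A arbitrary: F)
  case (Cons h A)
  have "(\<Sum>(B, C)\<leftarrow>splits H (h # A). F B C) = (if h \<in> H then F [] A else 0) + (\<Sum>(B, C)\<leftarrow>splits H A. F (h # B) C)"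
    by (simp add: case_prod_unfold comp_def)
  then show ?case by (simp add: Cons sum.lessThan_Suc_shift del: sum.lessThan_Suc cong: if_cong)
qed simp

text \<open>Position 0 belongs to \<open>y\<close>, so positions in the whole list exceed those in
  \<open>ys\<close> by one.\<close>

lemma nths_Cons_gap: "j < length ys \<Longrightarrow> nths (y # ys) {x\<in>{..<Suc (length ys)}. 0 < x \<and> x < Suc j} = take j ys"
proof -
  assume "j < length ys"
  then have "{i. Suc i \<in> {x\<in>{..<Suc (length ys)}. 0 < x \<and> x < Suc j}} = {..<j}" by auto
  then show ?thesis by (simp add: nths_Cons del: lessThan_Suc)
qed

lemma nths_Cons_rest: "nths (y # ys) {x\<in>{..<Suc (length ys)}. Suc j \<le> x} = drop j ys"
proof -
  have "nths (y # ys) {x\<in>{..<Suc (length ys)}. Suc j \<le> x} = nths ys {i. i < length ys \<and> i \<ge> j}"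
    by (simp add: nths_Cons)
  also have "\<dots> = nths ys {i. i \<ge> j}"
    unfolding nths_def by (intro arg_cong[of _ _ "map fst"] filter_cong) (auto dest: set_zip_rightD)
  finally show ?thesis by (simp add: drop_eq_nths)
qed

text \<open>Only blocks of size two with different letters contribute. The first letter is therefore
  paired with some opposite letter at position j, and the partitions of the gap and of the remainder
  after j are independent of each other.\<close>

lemma circular_schwinger_dyson:
  fixes \<phi> :: "'a::ring_1 \<Rightarrow> complex"
  assumes "\<phi> 1 = 1" "standard_circular star \<phi> g"
  defines "L \<equiv> \<lambda>b. if b then star g else g"
  shows "\<phi> (prod_list (map L (b # bs))) =
    (\<Sum>(B, C)\<leftarrow>splits {\<not> b} bs. \<phi> (prod_list (map L B)) * \<phi> (prod_list (map L C)))"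
proof -
  define xs where "xs = map L (b # bs)"
  let ?ys = "map L bs"
  let ?n = "Suc (length bs)"
  define K where "K V = free_cumulant \<phi> (nths xs V)" for V
  let ?A = "{..<?n}"
  have K: "K V = (if nths (b # bs) V = [False, True] \<or> nths (b # bs) V = [True, False] then 1 else 0)"
    if "nths (b # bs) V \<noteq> []" for V
    using assms(2) that unfolding standard_circular_def K_def xs_def L_def[symmetric] nths_map by auto
  have len: "length (nths (b # bs) V) = card V" if "V \<subseteq> ?A" for V
  proof -
    have "{i. i < length (b # bs) \<and> i \<in> V} = V" using that by auto
    then show ?thesis by (simp only: length_nths)
  qed
  have K0: "K V = 0" if "V \<subseteq> ?A" "V \<noteq> {}" "card V \<noteq> 2" for V
  proof -
    have "finite V" using that(1) finite_subset by blast
    then have "nths (b # bs) V \<noteq> []" using len[OF that(1)] that(2) by auto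
    moreover have "nths (b # bs) V \<noteq> [x, y]" for x y using len[OF that(1)] that(3) by auto
    ultimately show ?thesis using K by simp
  qed
  have \<phi>K: "\<phi> (prod_list (nths xs A)) = nc_sum K A" if "A \<subseteq> ?A" for A
    unfolding K_def using that assms(1) by (intro state_eq_nc_sum) (auto simp: xs_def)
  have "\<phi> (prod_list xs) = nc_sum K ?A"
    using \<phi>K[of ?A] by (simp add: nths_all xs_def)
  also have "\<dots> = (\<Sum>j\<in>?A - {0}. nc_sum K {x\<in>?A. 0 < x \<and> x < j} *
       nc_sum (\<lambda>V. if j \<in> V then K (insert 0 V) else K V) {x\<in>?A. j \<le> x})"
    using K0[of "{0}"] by (subst nc_sum_first_gap[where a = 0]) auto
  also have "\<dots> = (\<Sum>j\<in>?A - {0}. nc_sum K {x\<in>?A. 0 < x \<and> x < j} * (K {0, j} * nc_sum K {x\<in>?A. Suc j \<le> x}))"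
  proof (intro sum.cong refl arg_cong2[of _ _ _ _ "(*)"])
    fix j assume j: "j \<in> ?A - {0}"
    let ?C = "{x\<in>?A. j \<le> x}"
    let ?K = "\<lambda>V. if j \<in> V then K (insert 0 V) else K V"
    have "nc_sum ?K ?C = ?K {j} * nc_sum ?K (?C - {j}) +
      (\<Sum>i\<in>?C - {j}. nc_sum ?K {x\<in>?C. j < x \<and> x < i} *
       nc_sum (\<lambda>V. if i \<in> V then ?K (insert j V) else ?K V) {x\<in>?C. i \<le> x})"
      using j by (intro nc_sum_first_gap) auto
    \<comment> \<open>The decomposition is applied a second time, at \<open>j\<close>. A further
      element i in the block of 0 and \<open>j\<close> would give a block of at least three
      elements, whose cumulant is 0.\<close>
    also have "(\<Sum>i\<in>?C - {j}. nc_sum ?K {x\<in>?C. j < x \<and> x < i} *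
       nc_sum (\<lambda>V. if i \<in> V then ?K (insert j V) else ?K V) {x\<in>?C. i \<le> x}) = 0"
    proof (intro sum.neutral ballI)
      fix i assume i: "i \<in> ?C - {j}"
      have "nc_sum (\<lambda>V. if i \<in> V then ?K (insert j V) else ?K V) {x\<in>?C. i \<le> x} = 0"
      proof (rule nc_sum_eq_0)
        fix V assume V: "V \<subseteq> {x\<in>?C. i \<le> x}" "i \<in> V"
        have "finite V" using V(1) by (rule finite_subset) simp
        then have "card {0, j, i} \<le> card (insert 0 (insert j V))" using V by (intro card_mono) auto
        moreover have "card {0, j, i} = 3" using i j by auto
        ultimately have "K (insert 0 (insert j V)) = 0"
          using V j by (intro K0) auto
        then show "(if i \<in> V then ?K (insert j V) else ?K V) = 0" using V by simp
      qed (use i in auto)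
      then show "nc_sum ?K {x\<in>?C. j < x \<and> x < i} *
        nc_sum (\<lambda>V. if i \<in> V then ?K (insert j V) else ?K V) {x\<in>?C. i \<le> x} = 0" by simp
    qed
    also have "nc_sum ?K (?C - {j}) = nc_sum K (?C - {j})"
      by (intro nc_sum_cong) auto
    also have "?C - {j} = {x\<in>?A. Suc j \<le> x}" by auto
    finally show "nc_sum ?K ?C = K {0, j} * nc_sum K {x\<in>?A. Suc j \<le> x}" by simp
  qed
  also have "\<dots> = (\<Sum>j<length bs. nc_sum K {x\<in>?A. 0 < x \<and> x < Suc j} * (K {0, Suc j} * nc_sum K {x\<in>?A. Suc (Suc j) \<le> x}))"
    by (intro sum.reindex_bij_witness[where i = Suc and j = "\<lambda>j. j - 1"]) auto
  also have "\<dots> = (\<Sum>j<length bs. if bs ! j \<in> {\<not> b} then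
      \<phi> (prod_list (map L (take j bs))) * \<phi> (prod_list (map L (drop (Suc j) bs))) else 0)"
  proof (intro sum.cong refl)
    fix j assume "j \<in> {..<length bs}"
    then have j: "j < length bs" by simp
    have sub: "{x\<in>?A. 0 < x \<and> x < Suc j} \<subseteq> ?A" "{x\<in>?A. Suc (Suc j) \<le> x} \<subseteq> ?A" by auto
    have "nc_sum K {x\<in>?A. 0 < x \<and> x < Suc j} = \<phi> (prod_list (map L (take j bs)))"
      using \<phi>K[OF sub(1)] nths_Cons_gap[of j ?ys "L b"] j
      by (simp add: xs_def take_map)
    moreover have "nc_sum K {x\<in>?A. Suc (Suc j) \<le> x} = \<phi> (prod_list (map L (drop (Suc j) bs)))"
      using \<phi>K[OF sub(2)] nths_Cons_rest[of "L b" ?ys "Suc j"]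
      by (simp add: xs_def drop_map)
    moreover have "nths (b # bs) {0, Suc j} = [b, bs ! j]"
    proof -
      have "{i. i = j} = {j}" by auto
      moreover have "nths bs {j} = [bs ! j]" if "j < length bs" for bs :: "bool list" and j
        using that
      proof (induction bs arbitrary: j)
        case (Cons a bs)
        show ?case
        proof (cases j)
          case 0
          then show ?thesis by (simp add: nths_Cons)
        next
          case (Suc i)
          then have "{k. Suc k \<in> {j}} = {i}" by auto
          then show ?thesis using Suc Cons by (simp add: nths_Cons)
        qed
      qed simp
      ultimately show ?thesis using j by (simp add: nths_Cons)
    qed
    then have "K {0, Suc j} = (if bs ! j \<in> {\<not> b} then 1 else 0)"
      using K[of "{0, Suc j}"] by (cases b; cases "bs ! j") auto
    ultimately show "nc_sum K {x\<in>?A. 0 < x \<and> x < Suc j} * (K {0, Suc j} * nc_sum K {x\<in>?A. Suc (Suc j) \<le> x}) =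
      (if bs ! j \<in> {\<not> b} then
      \<phi> (prod_list (map L (take j bs))) * \<phi> (prod_list (map L (drop (Suc j) bs))) else 0)"
      by simp
  qed
  also have "\<dots> = (\<Sum>(B, C)\<leftarrow>splits {\<not> b} bs. \<phi> (prod_list (map L B)) * \<phi> (prod_list (map L C)))"
    by (rule sum_splits[symmetric])
  finally show ?thesis by (simp add: xs_def)
qed

text \<open>All cumulants have the same value c, so adding 0 to the block of \<open>j\<close> does
  not change its weight, and the second factor of the first-gap decomposition is an ordinary
  moment.\<close>

lemma free_poisson_recursion:
  fixes \<phi> :: "'a::ring_1 \<Rightarrow> complex"
  assumes "\<phi> 1 = 1" "free_poisson star \<phi> c w"
  shows "\<phi> (w ^ Suc n) = of_real c * \<phi> (w ^ n) + (\<Sum>j<n. \<phi> (w ^ Suc j) * \<phi> (w ^ (n - 1 - j)))"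
proof -
  define xs where "xs = replicate (Suc n) w"
  define K where "K V = free_cumulant \<phi> (nths xs V)" for V
  let ?A = "{..<Suc n}"
  have nths_xs: "nths xs V = replicate (card V) w" if "V \<subseteq> ?A" for V
  proof -
    have "{i. i < length xs \<and> i \<in> V} = V" using that by (auto simp: xs_def)
    then have "length (nths xs V) = card V" by (simp only: length_nths)
    moreover have "set (nths xs V) \<subseteq> {w}" using set_nths_subset[of xs V] by (auto simp: xs_def)
    ultimately show ?thesis by (metis replicate_length_same singletonD subsetD)
  qed
  have K: "K V = of_real c" if "V \<subseteq> ?A" "V \<noteq> {}" for V
  proof -
    have "finite V" using that(1) finite_subset by blast
    then have "card V \<ge> 1" using that(2) by (simp add: Suc_le_eq card_gt_0_iff)
    then show ?thesis using assms(2) by (simp add: K_def nths_xs[OF that(1)] free_poisson_def)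
  qed
  have \<phi>K: "nc_sum K A = \<phi> (w ^ card A)" if "A \<subseteq> ?A" for A
    using state_eq_nc_sum[where \<phi> = \<phi> and xs = xs and A = A] that assms(1) nths_xs[OF that]
    by (simp add: K_def[abs_def] xs_def)
  have "\<phi> (w ^ Suc n) = nc_sum K ?A" using \<phi>K[of ?A] by simp
  also have "\<dots> = of_real c * nc_sum K (?A - {0}) + (\<Sum>j\<in>?A - {0}. nc_sum K {x\<in>?A. 0 < x \<and> x < j} *
       nc_sum (\<lambda>V. if j \<in> V then K (insert 0 V) else K V) {x\<in>?A. j \<le> x})"
    using K[of "{0}"] by (subst nc_sum_first_gap[where a = 0]) auto
  also have "(\<Sum>j\<in>?A - {0}. nc_sum K {x\<in>?A. 0 < x \<and> x < j} *
       nc_sum (\<lambda>V. if j \<in> V then K (insert 0 V) else K V) {x\<in>?A. j \<le> x}) =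
       (\<Sum>j\<in>?A - {0}. \<phi> (w ^ (j - 1)) * \<phi> (w ^ (Suc n - j)))"
  proof (intro sum.cong refl arg_cong2[of _ _ _ _ "(*)"])
    fix j assume j: "j \<in> ?A - {0}"
    have "{x\<in>?A. 0 < x \<and> x < j} = {1..<j}" using j by auto
    then have "card {x\<in>?A. 0 < x \<and> x < j} = j - 1" by simp
    then show "nc_sum K {x\<in>?A. 0 < x \<and> x < j} = \<phi> (w ^ (j - 1))"
      using \<phi>K[of "{x\<in>?A. 0 < x \<and> x < j}"] by auto
    have "{x\<in>?A. j \<le> x} = {j..<Suc n}" by auto
    then have card: "card {x\<in>?A. j \<le> x} = Suc n - j" by simp
    have "nc_sum (\<lambda>V. if j \<in> V then K (insert 0 V) else K V) {x\<in>?A. j \<le> x} = nc_sum K {x\<in>?A. j \<le> x}"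
    proof (rule nc_sum_cong)
      fix V assume V: "V \<subseteq> {x\<in>?A. j \<le> x}" "V \<noteq> {}"
      then have "K (insert 0 V) = of_real c" "K V = of_real c" by (auto intro!: K)
      then show "(if j \<in> V then K (insert 0 V) else K V) = K V" by simp
    qed
    also have "\<dots> = \<phi> (w ^ (Suc n - j))" using \<phi>K[of "{x\<in>?A. j \<le> x}"] card by auto
    finally show "nc_sum (\<lambda>V. if j \<in> V then K (insert 0 V) else K V) {x\<in>?A. j \<le> x} = \<phi> (w ^ (Suc n - j))" .
  qed
  also have "(\<Sum>j\<in>?A - {0}. \<phi> (w ^ (j - 1)) * \<phi> (w ^ (Suc n - j))) = (\<Sum>j<n. \<phi> (w ^ Suc j) * \<phi> (w ^ (n - 1 - j)))"
    \<comment> \<open>Reversing the summation exchanges gap and remainder, to match the order in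
      which \<open>splits\<close> lists the two pieces.\<close>
    by (rule sum.reindex_bij_witness[where i = "\<lambda>j. n - j" and j = "\<lambda>j. n - j"])
       (auto simp: mult.commute Suc_diff_le)
  also have "nc_sum K (?A - {0}) = \<phi> (w ^ n)" using \<phi>K[of "?A - {0}"] by simp
  finally show ?thesis .
qed

section \<open>Schwinger-Dyson equations and freeness\<close>

text \<open>Cuts a word into maximal runs, so that a monomial becomes a product of elements of
  single subalgebras with neighbours from different ones, the shape required by freeness.\<close>

lemma same_index_runs:
  "\<exists>as. concat as = w \<and> [] \<notin> set as \<and> (\<forall>a\<in>set as. \<forall>l\<in>set a. fst l = fst (hd a)) \<and>
     distinct_adj (map (\<lambda>a. fst (hd a)) as)"
proof (induction w)
  case Nil
  show ?case by (rule exI[of _ "[]"]) auto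
next
  case (Cons l w)
  then obtain as where as: "concat as = w" "[] \<notin> set as"
    "\<forall>a\<in>set as. \<forall>l\<in>set a. fst l = fst (hd a)" "distinct_adj (map (\<lambda>a. fst (hd a)) as)" by blast
  show ?case
  proof (cases "as \<noteq> [] \<and> fst (hd (hd as)) = fst l")
    case True
    then obtain a as' where a: "as = a # as'" by (cases as) auto
    have l: "fst (hd a) = fst l" using True a by simp
    have "concat ((l # a) # as') = l # w" "[] \<notin> set ((l # a) # as')"
      using as(1,2) a by auto
    moreover have "\<forall>b\<in>set ((l # a) # as'). \<forall>m\<in>set b. fst m = fst (hd b)"
      using as(3) l by (simp add: a)
    moreover have "distinct_adj (map (\<lambda>b. fst (hd b)) ((l # a) # as'))"
      using as(4) l by (simp add: a)
    ultimately show ?thesis by blast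
  next
    case False
    have "concat ([l] # as) = l # w" "[] \<notin> set ([l] # as)"
      using as(1,2) by auto
    moreover have "\<forall>b\<in>set ([l] # as). \<forall>m\<in>set b. fst m = fst (hd b)"
      using as(3) by simp
    moreover have "distinct_adj (map (\<lambda>b. fst (hd b)) ([l] # as))"
      using as(4) False by (cases as) auto
    ultimately show ?thesis by blast
  qed
qed

text \<open>
  The expansion of \<open>F\<close> on the product of the centred elements \<open>a - \<psi> a\<close> (\<open>a\<close> in the list), where
  \<open>F\<close> is extended linearly from words to formal linear combinations of words.
\<close>

fun centred_sum :: "('l list \<Rightarrow> complex) \<Rightarrow> ('l list \<Rightarrow> complex) \<Rightarrow> 'l list list \<Rightarrow> 'l list \<Rightarrow> complex" where
  "centred_sum \<psi> F [] v = F v"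
| "centred_sum \<psi> F (a # as) v = centred_sum \<psi> F as (v @ a) - \<psi> a * centred_sum \<psi> F as v"

lemma centred_sum_linear:
  "centred_sum \<psi> (\<lambda>w. F w - c * G w - E w) as v =
     centred_sum \<psi> F as v - c * centred_sum \<psi> G as v - centred_sum \<psi> E as v"
proof (induction as arbitrary: v)
  case (Cons a as)
  show ?case by (simp add: Cons) (simp add: algebra_simps)
qed simp

text \<open>Every other term of the expansion omits a nonempty word of the list and hence is
  \<open>F\<close> at a shorter word, where it vanishes. Inside an induction on length, the words
  may thus be replaced by their centred versions.\<close>

lemma centred_sum_eq:
  assumes "\<And>w. w \<in> lists V \<Longrightarrow> length w < length v + length (concat as) \<Longrightarrow> F w = 0"
    and "[] \<notin> set as" "v \<in> lists V" "as \<in> lists (lists V)"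
  shows "centred_sum \<psi> F as v = F (v @ concat as)"
  using assms
proof (induction as arbitrary: v)
  case (Cons a as)
  have "centred_sum \<psi> F as (v @ a) = F ((v @ a) @ concat as)"
    using Cons.prems by (intro Cons.IH) auto
  moreover have "centred_sum \<psi> F as v = F (v @ concat as)"
    using Cons.prems by (intro Cons.IH) auto
  moreover have "F (v @ concat as) = 0"
    using Cons.prems by (intro Cons.prems(1)) (auto simp: lists_eq_set)
  ultimately show ?case by simp
qed simp

section \<open>Alternating products and reduced Haar words\<close>

context tracial_star_prob_space
begin

lemma state_0 [simp]: "\<phi> 0 = 0"
  using state_add[of 0 0] by simp

lemma state_uminus: "\<phi> (- x) = - \<phi> x"
  using state_add[of x "- x"] by (simp add: eq_neg_iff_add_eq_0 add.commute)

lemma state_diff: "\<phi> (x - y) = \<phi> x - \<phi> y"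
  using state_add[of x "- y"] by (simp add: state_uminus)

definition centred :: "'a \<Rightarrow> 'a" where
  "centred x = x - scaleC (\<phi> x) 1"

lemma state_centred [simp]: "\<phi> (centred x) = 0"
  by (simp add: centred_def state_diff state_scale state_one)

lemma mult_centred: "x * centred a * y = x * a * y - scaleC (\<phi> a) (x * y)"
  by (simp add: centred_def right_diff_distrib left_diff_distrib scale_mult_left scale_mult_right)

lemma mult_centred1: "x * centred a = x * a - scaleC (\<phi> a) x"
  using mult_centred[of x a 1] by simp

lemma centred_mult: "centred a * y = a * y - scaleC (\<phi> a) y"
  using mult_centred[of 1 a y] by simp

lemma state_mult_split: "\<phi> (x * a * y) = \<phi> (x * centred a * y) + \<phi> a * \<phi> (x * y)"
  by (simp add: mult_centred state_diff state_scale)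

abbreviation gen :: "('i \<Rightarrow> 'a) \<Rightarrow> 'i \<Rightarrow> 'a set" where
  "gen X i \<equiv> generated_star_subalgebra scaleC star {X i}"

lemma centred_in_gen:
  assumes "x \<in> gen X i"
  shows "centred x \<in> gen X i"
proof -
  have "centred x = x + scaleC (- \<phi> x) 1" by (simp add: centred_def scale_minus_left)
  moreover have "x + scaleC (- \<phi> x) 1 \<in> gen X i"
    using assms by (intro generated_star_subalgebra.add generated_star_subalgebra.scale
      generated_star_subalgebra.one)
  ultimately show ?thesis by simp
qed

lemma eval_monomial_simps [simp]:
  "eval_monomial star X [] = 1"
  "eval_monomial star X (l # w) = (if snd l then star (X (fst l)) else X (fst l)) * eval_monomial star X w"
  "eval_monomial star X (v @ w) = eval_monomial star X v * eval_monomial star X w"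
  by (auto simp: eval_monomial_def case_prod_unfold)

lemma eval_monomial_in_gen:
  assumes "\<And>l. l \<in> set w \<Longrightarrow> fst l = i"
  shows "eval_monomial star X w \<in> gen X i"
  using assms
proof (induction w)
  case (Cons l w)
  have l: "fst l = i" using Cons.prems by simp
  have "(if snd l then star (X i) else X i) \<in> gen X i"
    by (auto intro: generated_star_subalgebra.star generated_star_subalgebra.base)
  moreover have "eval_monomial star X w \<in> gen X i" using Cons by simp
  ultimately have "(if snd l then star (X i) else X i) * eval_monomial star X w \<in> gen X i"
    by (rule generated_star_subalgebra.mult)
  then show ?case by (simp only: eval_monomial_simps l)
qed (auto intro: generated_star_subalgebra.one)

definition alternating_centred :: "('i \<Rightarrow> 'a) \<Rightarrow> 'i set \<Rightarrow> ('i \<times> 'a) list \<Rightarrow> bool" where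
  "alternating_centred X I p \<longleftrightarrow>
     (\<forall>(i, a)\<in>set p. i \<in> I \<and> a \<in> gen X i \<and> \<phi> a = 0) \<and> distinct_adj (map fst p)"

abbreviation prd :: "('i \<times> 'a) list \<Rightarrow> 'a" where
  "prd p \<equiv> prod_list (map snd p)"

lemma state_alternating:
  assumes "star_free scaleC star \<phi> X I" "alternating_centred X I p" "p \<noteq> []"
  shows "\<phi> (prd p) = 0"
  using assms by (auto simp: star_free_def free_subalgebras_def alternating_centred_def)

lemma alternating_centred_Cons:
  assumes "alternating_centred X I p" "i \<in> I" "d \<in> gen X i" "p \<noteq> [] \<Longrightarrow> fst (hd p) \<noteq> i"
  shows "alternating_centred X I ((i, centred d) # p)"
  using assms by (cases p) (auto simp: alternating_centred_def centred_in_gen)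

lemma alternating_centred_snoc:
  assumes "alternating_centred X I p" "i \<in> I" "d \<in> gen X i" "p \<noteq> [] \<Longrightarrow> fst (last p) \<noteq> i"
  shows "alternating_centred X I (p @ [(i, centred d)])"
  using assms by (auto simp: alternating_centred_def centred_in_gen distinct_adj_append_iff last_map)

text \<open>The outer factor \<open>d\<close> need not be centred: its centred part lengthens the
  alternating product, and its scalar part leaves the nonempty product \<open>p\<close> alone. The
  state vanishes on both.\<close>

lemma state_alternating_left:
  assumes "star_free scaleC star \<phi> X I" "alternating_centred X I p" "p \<noteq> []"
    and "i \<in> I" "d \<in> gen X i" "fst (hd p) \<noteq> i"
  shows "\<phi> (d * prd p) = 0"
  using state_mult_split[of 1 d "prd p"] state_alternating[OF assms(1-3)]
    state_alternating[OF assms(1) alternating_centred_Cons[OF assms(2,4,5)]] assms(6) by simp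

lemma state_alternating_right:
  assumes "star_free scaleC star \<phi> X I" "alternating_centred X I p" "p \<noteq> []"
    and "i \<in> I" "d \<in> gen X i" "fst (last p) \<noteq> i"
  shows "\<phi> (prd p * d) = 0"
  using state_mult_split[of "prd p" d 1] state_alternating[OF assms(1-3)]
    state_alternating[OF assms(1) alternating_centred_snoc[OF assms(2,4,5)]] assms(6) by simp

lemma state_alternating_both:
  assumes "star_free scaleC star \<phi> X I" "alternating_centred X I p" "p \<noteq> []"
    and "i \<in> I" "d \<in> gen X i" "fst (hd p) \<noteq> i" "j \<in> I" "e \<in> gen X j" "fst (last p) \<noteq> j"
  shows "\<phi> (d * prd p * e) = 0"
proof -
  have "\<phi> (centred d * prd p * e) = \<phi> (prd ((i, centred d) # p) * e)" by simp
  also have "\<dots> = 0"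
    using assms by (intro state_alternating_right[OF assms(1) alternating_centred_Cons[OF assms(2,4,5)] _ assms(7,8)]) auto
  finally show ?thesis
    using state_mult_split[of 1 d "prd p * e"] state_alternating_right[OF assms(1-3,7-9)]
    by (simp add: mult.assoc)
qed

text \<open>In a reduced word each maximal run is a positive power of a Haar unitary or of its
  adjoint. Such powers have state 0, so the word is already an alternating product of centred
  elements.\<close>

lemma state_reduced_haar_word:
  assumes free: "star_free scaleC star \<phi> X I" and w: "fst ` set w \<subseteq> I" "w \<noteq> []"
    and haar: "\<And>i. i \<in> fst ` set w \<Longrightarrow> haar_unitary star \<phi> (X i)"
    and red: "successively (\<lambda>x y. y \<noteq> apsnd Not x) w"
  shows "\<phi> (eval_monomial star X w) = 0"
proof -
  obtain as where as: "concat as = w" "[] \<notin> set as"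
    "\<forall>a\<in>set as. \<forall>l\<in>set a. fst l = fst (hd a)" "distinct_adj (map (\<lambda>a. fst (hd a)) as)"
    using same_index_runs[of w] by blast
  let ?p = "map (\<lambda>a. (fst (hd a), eval_monomial star X a)) as"
  have "\<phi> (eval_monomial star X a) = 0" if a: "a \<in> set as" for a
  proof -
    obtain as1 as2 where "as = as1 @ a # as2" using a by (meson split_list)
    then have "w = concat as1 @ a @ concat as2" using as(1) by auto
    then have "successively (\<lambda>x y. y \<noteq> apsnd Not x) a"
      using red by (simp add: successively_append_iff)
    moreover have "\<forall>l\<in>set a. fst l = fst (hd a)" using as(3) a by blast
    \<comment> \<open>Within a run the index is constant, so a change of letter would put a letter
      next to its inverse.\<close>
    ultimately have "a = replicate (length a) (hd a)"
    proof (induction a)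
      case (Cons l a)
      show ?case
      proof (cases a)
        case (Cons m a')
        with Cons.prems Cons.IH have "a = replicate (length a) m" "fst m = fst l" "m \<noteq> apsnd Not l"
          by auto
        then have "m = l" by (cases l; cases m) auto
        then show ?thesis using \<open>a = replicate (length a) m\<close> by simp
      qed simp
    qed simp
    moreover obtain i b where ib: "hd a = (i, b)" by (cases "hd a")
    moreover have "eval_monomial star X (replicate n (i, b)) = (if b then star (X i) else X i) ^ n" for n
      by (induction n) auto
    ultimately have ev: "eval_monomial star X a = (if b then star (X i) else X i) ^ length a" by metis
    have "a \<noteq> []" using as(2) a by auto
    then have "hd a \<in> set (concat as)" using a by (auto intro!: bexI[of _ a])
    then have "i \<in> fst ` set w" using ib as(1) by (metis fst_conv image_eqI)
    then show ?thesis
      using haar \<open>a \<noteq> []\<close> unfolding ev by (auto simp: haar_unitary_def Suc_le_eq)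
  qed
  moreover have "fst (hd a) \<in> I" if "a \<in> set as" for a
    using that as w(1) by (metis UN_I hd_in_set image_subset_iff set_concat)
  moreover have "eval_monomial star X a \<in> gen X (fst (hd a))" if "a \<in> set as" for a
    using that as(3) by (intro eval_monomial_in_gen) auto
  ultimately have "alternating_centred X I ?p"
    using as(4) by (auto simp: alternating_centred_def comp_def)
  moreover have "?p \<noteq> []" using as(1) w(2) by auto
  moreover have "prd ?p = eval_monomial star X w"
    unfolding as(1)[symmetric] by (induction as) (auto simp: comp_def)
  ultimately show ?thesis using state_alternating[OF free] by metis
qed

text \<open>
  \<open>split_state\<close> is the free difference quotient that differentiates the letters in \<open>H\<close>, composed with
  \<open>\<phi> \<otimes> \<phi>\<close>; the elements \<open>x\<close> and \<open>y\<close> stand to the left and to the right of the word.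
\<close>

definition split_state :: "('i \<Rightarrow> 'a) \<Rightarrow> ('i \<times> bool) set \<Rightarrow> 'a \<Rightarrow> ('i \<times> bool) list \<Rightarrow> 'a \<Rightarrow> complex" where
  "split_state X H x w y = (\<Sum>(B, C)\<leftarrow>splits H w. \<phi> (x * eval_monomial star X B) * \<phi> (eval_monomial star X C * y))"

section \<open>Free difference quotients of centred products\<close>

lemma split_state_append:
  "split_state X H x (v @ w) y =
     split_state X H x v (eval_monomial star X w * y) + split_state X H (x * eval_monomial star X v) w y"
  by (simp add: split_state_def splits_append case_prod_unfold comp_def mult.assoc)

lemma split_state_diff_left:
  "split_state X H (x - scaleC c x') w y = split_state X H x w y - c * split_state X H x' w y"
  by (simp add: split_state_def left_diff_distrib scale_mult_left state_diff state_scale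
      case_prod_unfold algebra_simps sum_list_subtractf flip: sum_list_const_mult)

lemma split_state_diff_right:
  "split_state X H x w (y - scaleC c y') = split_state X H x w y - c * split_state X H x w y'"
  by (simp add: split_state_def right_diff_distrib scale_mult_right state_diff state_scale
      case_prod_unfold algebra_simps sum_list_subtractf flip: sum_list_const_mult)

text \<open>The Leibniz rule on a product of centred words: scalars have derivative 0, so the word
  that is differentiated appears uncentred while the others stay centred.\<close>

fun split_state_centred :: "('i \<Rightarrow> 'a) \<Rightarrow> ('i \<times> bool) set \<Rightarrow> 'a \<Rightarrow> ('i \<times> bool) list list \<Rightarrow> 'a \<Rightarrow> complex" where
  "split_state_centred X H x [] y = 0"
| "split_state_centred X H x (a # as) y =
     split_state X H x a (prod_list (map (\<lambda>a. centred (eval_monomial star X a)) as) * y) +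
     split_state_centred X H (x * centred (eval_monomial star X a)) as y"

lemma split_state_centred_diff:
  "split_state_centred X H (x - scaleC c x') as y =
     split_state_centred X H x as y - c * split_state_centred X H x' as y"
  by (induction as arbitrary: x x')
     (simp_all add: split_state_diff_left left_diff_distrib scale_mult_left algebra_simps)

lemma split_state_centred_eq_0:
  assumes "\<And>as1 a as2. as = as1 @ a # as2 \<Longrightarrow>
    split_state X H (x * prod_list (map (\<lambda>a. centred (eval_monomial star X a)) as1)) a
      (prod_list (map (\<lambda>a. centred (eval_monomial star X a)) as2) * y) = 0"
  shows "split_state_centred X H x as y = 0"
  using assms
proof (induction as arbitrary: x)
  case (Cons a as)
  have "split_state_centred X H (x * centred (eval_monomial star X a)) as y = 0"
  proof (rule Cons.IH)
    fix as1 b as2 assume "as = as1 @ b # as2"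
    then show "split_state X H (x * centred (eval_monomial star X a) *
        prod_list (map (\<lambda>a. centred (eval_monomial star X a)) as1)) b
      (prod_list (map (\<lambda>a. centred (eval_monomial star X a)) as2) * y) = 0"
      using Cons.prems[of "a # as1" b as2] by (simp add: mult.assoc)
  qed
  then show ?case using Cons.prems[of "[]" a as] by simp
qed simp

lemma centred_sum_state:
  "centred_sum (\<lambda>a. \<phi> (eval_monomial star X a)) (\<lambda>w. \<phi> (x * eval_monomial star X w)) as v =
     \<phi> (x * eval_monomial star X v * prod_list (map (\<lambda>a. centred (eval_monomial star X a)) as))"
proof (induction as arbitrary: v)
  case (Cons a as)
  let ?B = "prod_list (map (\<lambda>a. centred (eval_monomial star X a)) as)"
  show ?case
    using mult_centred[of "x * eval_monomial star X v" "eval_monomial star X a" ?B]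
    by (simp add: Cons mult.assoc state_diff state_scale)
qed simp

text \<open>Differentiating every term of the expansion amounts to differentiating the centred
  product itself; the first summand accounts for the prefix \<open>v\<close>.\<close>

lemma centred_sum_split_state:
  "centred_sum (\<lambda>a. \<phi> (eval_monomial star X a)) (\<lambda>w. split_state X H x w y) as v =
     split_state X H x v (prod_list (map (\<lambda>a. centred (eval_monomial star X a)) as) * y) +
     split_state_centred X H (x * eval_monomial star X v) as y"
proof (induction as arbitrary: v)
  case (Cons a as)
  let ?B = "prod_list (map (\<lambda>a. centred (eval_monomial star X a)) as)"
  let ?c = "\<phi> (eval_monomial star X a)"
  have 1: "split_state X H x v (centred (eval_monomial star X a) * ?B * y) =
      split_state X H x v (eval_monomial star X a * (?B * y)) - ?c * split_state X H x v (?B * y)"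
    by (simp add: centred_mult left_diff_distrib scale_mult_left mult.assoc split_state_diff_right)
  have 2: "split_state_centred X H (x * eval_monomial star X v * centred (eval_monomial star X a)) as y =
      split_state_centred X H (x * eval_monomial star X v * eval_monomial star X a) as y -
      ?c * split_state_centred X H (x * eval_monomial star X v) as y"
    by (simp add: mult_centred1 split_state_centred_diff)
  show ?case
    using 1 2 by (simp add: Cons split_state_append mult.assoc algebra_simps)
qed simp

text \<open>
  Freeness lifts a Schwinger-Dyson equation from the algebra of one of the variables to all words:
  both sides are compared on alternating products of centred elements, where they vanish.
\<close>

theorem schwinger_dyson_of_free:
  assumes free: "star_free scaleC star \<phi> X I" and i: "i \<in> I"
    and d: "d \<in> gen X i" "e \<in> gen X i" and H: "\<And>h. h \<in> H \<Longrightarrow> fst h = i"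
    and single: "\<And>w. (\<And>l. l \<in> set w \<Longrightarrow> fst l = i) \<Longrightarrow>
      \<phi> (d * eval_monomial star X w) = \<kappa> * \<phi> (eval_monomial star X w) + split_state X H e w 1"
    and w: "fst ` set w \<subseteq> I"
  shows "\<phi> (d * eval_monomial star X w) = \<kappa> * \<phi> (eval_monomial star X w) + split_state X H e w 1"
proof -
  \<comment> \<open>The defect of the equation at a word. The factor \<open>1 *\<close> gives the
    middle term the shape of \<open>centred_sum_state\<close>.\<close>
  define \<Lambda> where "\<Lambda> w = \<phi> (d * eval_monomial star X w) - \<kappa> * \<phi> (1 * eval_monomial star X w) - split_state X H e w 1" for w
  let ?V = "I \<times> (UNIV :: bool set)"
  let ?c = "\<lambda>a. centred (eval_monomial star X a)"
  have "w \<in> lists ?V \<Longrightarrow> \<Lambda> w = 0" for w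
  proof (induction "length w" arbitrary: w rule: less_induct)
    case (less w)
    obtain as where as: "concat as = w" "[] \<notin> set as"
      "\<forall>a\<in>set as. \<forall>l\<in>set a. fst l = fst (hd a)" "distinct_adj (map (\<lambda>a. fst (hd a)) as)"
      using same_index_runs[of w] by blast
    let ?p = "\<lambda>as. map (\<lambda>a. (fst (hd a), ?c a)) as"
    have idx: "fst (hd a) \<in> I" if "a \<in> set as" for a
    proof -
      have "a \<noteq> []" using as(2) that by auto
      then have "hd a \<in> set (concat as)" using that by (auto intro!: bexI[of _ a])
      then show ?thesis using less.prems as(1) by auto
    qed
    have alt: "alternating_centred X I (?p bs)" if "as = bs1 @ bs @ bs2" for bs1 bs bs2
      using as(3,4) idx by (auto simp: alternating_centred_def that comp_def distinct_adj_append_iff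
        intro!: centred_in_gen eval_monomial_in_gen)
    show ?case
    \<comment> \<open>The words covered by the equation in a single subalgebra are exactly the
      exceptions to the vanishing below.\<close>
    proof (cases "as = [] \<or> (\<exists>a. as = [a] \<and> fst (hd a) = i)")
      case True
      then have "fst l = i" if "l \<in> set w" for l
      proof (elim disjE exE conjE)
        assume "as = []"
        then show ?thesis using that as(1) by simp
      next
        fix a assume a: "as = [a]" "fst (hd a) = i"
        then have "w = a" using as(1) by simp
        then show ?thesis using that as(3) a by simp
      qed
      from single[OF this] show ?thesis by (simp add: \<Lambda>_def)
    next
      case False
      then have ne: "as \<noteq> []" by simp
      have "as \<in> lists (lists ?V)" using less.prems as(1) by (force simp: lists_eq_set)
      \<comment> \<open>The defect vanishes on shorter words by induction, so it may be evaluated on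
        the product of the centred runs.\<close>
      then have "\<Lambda> w = centred_sum (\<lambda>a. \<phi> (eval_monomial star X a)) \<Lambda> as []"
        using centred_sum_eq[of ?V "[]" as \<Lambda>] less.hyps as(1,2) by simp
      also have "\<dots> = \<phi> (d * prod_list (map ?c as)) - \<kappa> * \<phi> (prod_list (map ?c as))
          - split_state_centred X H e as 1"
        unfolding \<Lambda>_def[abs_def] centred_sum_linear centred_sum_state centred_sum_split_state
        by (simp add: split_state_def)
      also have "\<phi> (prod_list (map ?c as)) = 0"
        using state_alternating[OF free alt[of "[]" as "[]"]] ne by (simp add: comp_def)
      also have "\<phi> (d * prod_list (map ?c as)) = 0"
      \<comment> \<open>A first run with index \<open>i\<close> is absorbed into \<open>d\<close>;
        as it is not the only run, a nonempty alternating product remains.\<close>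
      proof (cases "fst (hd (hd as)) = i")
        case True
        then obtain a bs where a: "as = a # bs" "bs \<noteq> []" "fst (hd a) = i"
          using ne False by (cases as) auto
        have "fst (hd (?p bs)) \<noteq> i" using as(4) a by (cases bs) auto
        moreover have "d * ?c a \<in> gen X i"
          using as(3) a d by (intro generated_star_subalgebra.mult centred_in_gen eval_monomial_in_gen) auto
        ultimately have "\<phi> (d * ?c a * prd (?p bs)) = 0"
          using a by (intro state_alternating_left[OF free alt[of "[a]" bs "[]"] _ i]) auto
        then show ?thesis by (simp add: a comp_def mult.assoc)
      next
        case False
        then have "\<phi> (d * prd (?p as)) = 0"
          using ne d by (intro state_alternating_left[OF free alt[of "[]" as "[]"] _ i]) (auto simp: hd_map)
        then show ?thesis by (simp add: comp_def)
      qed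
      also have "split_state_centred X H e as 1 = 0"
      proof (rule split_state_centred_eq_0)
        fix as1 a as2 assume dec: "as = as1 @ a # as2"
        show "split_state X H (e * prod_list (map ?c as1)) a (prod_list (map ?c as2) * 1) = 0"
        proof (cases "fst (hd a) = i")
          case False
          then have "set a \<inter> H = {}" using as(3) H dec by auto
          then show ?thesis by (simp add: split_state_def splits_eq_Nil)
        next
          case ai: True
          have adj: "as1 \<noteq> [] \<Longrightarrow> fst (hd (last as1)) \<noteq> i" "as2 \<noteq> [] \<Longrightarrow> fst (hd (hd as2)) \<noteq> i"
            using as(4) ai by (cases as2; auto simp: dec distinct_adj_append_iff last_map)+
          have "\<phi> (e * prod_list (map ?c as1) * eval_monomial star X B) *
              \<phi> (eval_monomial star X C * (prod_list (map ?c as2) * 1)) = 0"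
            if BC: "(B, C) \<in> set (splits H a)" for B C
          proof -
            have set_BC: "set B \<subseteq> set a" "set C \<subseteq> set a" using splitsD[OF BC] by auto
            then have gB: "eval_monomial star X B \<in> gen X i" and gC: "eval_monomial star X C \<in> gen X i"
              using as(3) ai dec by (auto intro!: eval_monomial_in_gen)
            show ?thesis
            \<comment> \<open>If runs follow, the factor containing \<open>C\<close> vanishes, since
              the next run has an index other than \<open>i\<close>. Otherwise runs precede, and the
              factor containing \<open>B\<close> vanishes, with \<open>e\<close> absorbing a first
              run of index \<open>i\<close> if there is one.\<close>
            proof (cases "as2 = []")
              case False
              have "\<phi> (eval_monomial star X C * prd (?p as2)) = 0"
                using False adj gC dec
                by (intro state_alternating_left[OF free alt[of "as1 @ [a]" as2 "[]"] _ i]) (auto simp: hd_map)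
              then show ?thesis by (simp add: comp_def)
            next
              case True
              then have as1: "as1 \<noteq> []" using \<open>\<not> (as = [] \<or> _)\<close> dec ai by auto
              have "\<phi> (e * prod_list (map ?c as1) * eval_monomial star X B) = 0"
              proof (cases "fst (hd (hd as1)) = i")
                case True
                then obtain b bs where b: "as1 = b # bs" "bs \<noteq> []" "fst (hd b) = i"
                  using as1 adj(1) by (cases as1) (auto split: if_splits)
                have "fst (hd (?p bs)) \<noteq> i" using as(4) b dec by (cases bs) auto
                moreover have "e * ?c b \<in> gen X i"
                  using as(3) b d dec by (intro generated_star_subalgebra.mult centred_in_gen eval_monomial_in_gen) auto
                ultimately have "\<phi> (e * ?c b * prd (?p bs) * eval_monomial star X B) = 0"
                  using b adj(1) dec gB
                  by (intro state_alternating_both[OF free alt[of "[b]" bs "a # as2"] _ i _ _ i]) (auto simp: last_map)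
                then show ?thesis by (simp add: b comp_def mult.assoc)
              next
                case False
                then have "\<phi> (e * prd (?p as1) * eval_monomial star X B) = 0"
                  using as1 adj(1) dec gB d
                  by (intro state_alternating_both[OF free alt[of "[]" as1 "a # as2"] _ i _ _ i]) (auto simp: hd_map last_map)
                then show ?thesis by (simp add: comp_def)
              qed
              then show ?thesis by simp
            qed
          qed
          then have "\<And>x. x \<in> set (splits H a) \<Longrightarrow> (case x of (B, C) \<Rightarrow>
              \<phi> (e * prod_list (map ?c as1) * eval_monomial star X B) *
              \<phi> (eval_monomial star X C * (prod_list (map ?c as2) * 1))) = 0" by (auto simp del: mult_eq_0_iff)
          then show ?thesis unfolding split_state_def
            by (metis (mono_tags, lifting) map_eq_conv sum_list_0)
        qed
      qed
      finally show ?thesis by simp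
    qed
  qed
  moreover have "w \<in> lists ?V" using w by force
  ultimately show ?thesis by (simp add: \<Lambda>_def algebra_simps)
qed

end

section \<open>The Ginibre and Wishart models\<close>

text \<open>The letters that contract with \<open>l\<close>: a complex Gaussian entry has a nonzero
  covariance only with its conjugate, so only the adjoint qualifies.\<close>

definition ginibre_dual :: "('r + 'r) \<times> bool \<Rightarrow> (('r + 'r) \<times> bool) set" where
  "ginibre_dual l = (if isl (fst l) then {} else {(fst l, \<not> snd l)})"

text \<open>A Wishart matrix is self-adjoint, so both formal letters denote it and both
  contract.\<close>

definition wishart_dual :: "('r + 'r) \<times> bool \<Rightarrow> (('r + 'r) \<times> bool) set" where
  "wishart_dual l = (if isl (fst l) then {} else {(fst l, False), (fst l, True)})"

definition model_entry :: "('r \<Rightarrow> nat \<Rightarrow> nat) \<Rightarrow> ('r \<Rightarrow> complex mat) \<Rightarrow> 'r + 'r \<Rightarrow> nat \<Rightarrow> nat \<Rightarrow> complex" where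
  "model_entry \<sigma> Y = case_sum (\<lambda>r. perm_entry (\<sigma> r)) (\<lambda>r x y. Y r $$ (x, y))"

context
  fixes P :: "'w measure" and f :: "nat \<Rightarrow> nat \<Rightarrow> nat \<Rightarrow> 'w \<Rightarrow> complex" and J :: "nat set"
  assumes gauss: "gaussian_family P (\<lambda>(r, i, j). f r i j) (J \<times> UNIV \<times> UNIV)"
begin

interpretation gaussian_family P "\<lambda>(r, i, j). f r i j" "J \<times> UNIV \<times> UNIV"
  by (rule gauss)

lemma ginibre_entry:
  "x < N \<Longrightarrow> y < N \<Longrightarrow> ginibre_mat f N r \<omega> $$ (x, y) = complex_of_real (1 / sqrt (real N)) * f r x y \<omega>"
  by (simp add: ginibre_mat_def gaussian_mat_def)

text \<open>The general form asks for a sum of products of an entry and a cofactor. Here the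
  cofactor is 1/sqrt N at m = y and 0 elsewhere, so the sum over m < N collapses. Two cofactors
  contract to the identity over N, hence \<open>Z\<close> is empty, and a constant has derivative 0,
  hence no self-contraction.\<close>

lemma ginibre_schwinger_dyson:
  fixes \<sigma> :: "nat \<Rightarrow> nat \<Rightarrow> nat"
  assumes N: "N > 0" and l: "l \<in> (J <+> J) \<times> UNIV" "\<not> isl (fst l)"
    and A: "A \<in> lists ((J <+> J) \<times> UNIV)" and L: "L \<in> lists (lists ((J <+> J) \<times> UNIV))"
  defines "T \<equiv> \<lambda>L. \<integral>\<omega>. trace_prod N (model_entry \<sigma> (\<lambda>r. ginibre_mat f N r \<omega>)) L \<partial>P"
  shows "T ((l # A) # L) = 
      (\<Sum>(B, C)\<leftarrow>splits (ginibre_dual l) A. T (B # C # L)) +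
      (\<Sum>(v, L')\<leftarrow>splits_list (ginibre_dual l) L. T ((A @ v) # L')) / of_nat N ^ 2"
    and "L' \<in> lists (lists ((J <+> J) \<times> UNIV)) \<Longrightarrow>
      integrable P (\<lambda>\<omega>. trace_prod N (model_entry \<sigma> (\<lambda>r. ginibre_mat f N r \<omega>)) L')"
proof -
  obtain r b where lb: "l = (Inr r, b)" and r: "r \<in> J"
    using l by (cases l) auto
  let ?c = "complex_of_real (1 / sqrt (real N))"
  let ?X = "\<lambda>\<omega>. model_entry \<sigma> (\<lambda>r. ginibre_mat f N r \<omega>)"
  define k where "k m x = ((r, if b then m else x, if b then x else m), \<not> b)" for m x :: nat
  define E where "E m y \<omega> = (if m = y then ?c else 0)" for m y :: nat and \<omega> :: 'w
  have cc: "?c * ?c = 1 / of_nat N"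
  proof -
    have "1 / sqrt (real N) * (1 / sqrt (real N)) = 1 / real N" by simp
    then have "complex_of_real (1 / sqrt (real N) * (1 / sqrt (real N))) = complex_of_real (1 / real N)"
      by (rule arg_cong)
    then show ?thesis unfolding of_real_mult by simp
  qed
  have letter: "letter_entry (?X \<omega>) (Inr r', b') x y =
      ?c * gletter ((r', if b' then y else x, if b' then x else y), b') \<omega>"
    if "x < N" "y < N" for r' b' x y \<omega>
    using that by (simp add: letter_entry_def model_entry_def ginibre_entry gletter_def)
  have 1: "fst (k m x) \<in> J \<times> UNIV \<times> UNIV" for m x using r by (simp add: k_def)
  have 2: "letter_entry (?X \<omega>) l x y = (\<Sum>m<N. gletter (apsnd Not (k m x)) \<omega> * E m y \<omega>)"
    if "x < N" "y < N" for x y \<omega>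
  proof -
    have "(\<Sum>m<N. gletter (apsnd Not (k m x)) \<omega> * E m y \<omega>) =
        (\<Sum>m<N. if m = y then gletter (apsnd Not (k m x)) \<omega> * ?c else 0)"
      by (intro sum.cong) (auto simp: E_def)
    then show ?thesis using that by (simp add: lb letter k_def)
  qed
  have 3: "wick_deriv (k m x) (E m y) (\<lambda>_. if x = y then 0 else 0)" for m x y
    unfolding E_def using wick_deriv_const by simp
  have 4: "wick_deriv (k m x) (\<lambda>\<omega>. letter_entry (?X \<omega>) h y t) (\<lambda>\<omega>. if h \<in> ginibre_dual l \<and> t = x then E m y \<omega> else 0)"
    if "h \<in> (J <+> J) \<times> UNIV" "y < N" "t < N" for m x h y t
  proof (cases "fst h")
    case (Inl r')
    then have "h \<notin> ginibre_dual l" by (auto simp: ginibre_dual_def lb)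
    moreover have "letter_entry (?X \<omega>) h y t = letter_entry (\<lambda>_. perm_entry (\<sigma> r')) h y t" for \<omega>
      using Inl by (simp add: letter_entry_def model_entry_def)
    ultimately show ?thesis using wick_deriv_const by simp
  next
    case (Inr r')
    then have h: "h = (Inr r', snd h)" by (simp add: prod_eq_iff)
    then have r': "r' \<in> J" using that(1) by auto
    let ?m = "((r', if snd h then t else y, if snd h then y else t), snd h)"
    have "wick_deriv (k m x) (\<lambda>\<omega>. ?c * gletter ?m \<omega>) (\<lambda>\<omega>. ?c * (if k m x = ?m then 1 else 0))"
      by (intro wick_deriv_cmult wick_deriv_gletter) (use r' in simp)
    moreover have "(\<lambda>\<omega>. ?c * gletter ?m \<omega>) = (\<lambda>\<omega>. letter_entry (?X \<omega>) h y t)"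
      using letter[OF that(2,3), of _ r' "snd h"] h by (simp add: fun_eq_iff)
    moreover have "?c * (if k m x = ?m then 1 else 0) = (if h \<in> ginibre_dual l \<and> t = x then E m y \<omega> else 0)" for \<omega>
      using h by (cases "snd h"; cases b) (auto simp: k_def ginibre_dual_def lb E_def)
    ultimately show ?thesis by simp
  qed
  have 5: "(\<Sum>m<N. E m u \<omega> * E m y \<omega>) = word_entry N (?X \<omega>) [] u y / of_nat N" if "y < N" "u < N" for y u \<omega>
  proof -
    have "(\<Sum>m<N. E m u \<omega> * E m y \<omega>) = (\<Sum>m<N. if m = y then (if u = y then ?c * ?c else 0) else 0)"
      by (intro sum.cong) (auto simp: E_def)
    then show ?thesis using that cc by simp
  qed
  note SD = schwinger_dyson_matrices[where X = ?X and k = k and E = E and e = E and M = N and N = N and \<epsilon> = 0 and l = l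
      and Z = "[]" and V = "(J <+> J) \<times> UNIV" and H = "ginibre_dual l" and A = A and L = L, OF N N 1 2 3 4 5 l(1) _ A L]
  from SD(1) show "T ((l # A) # L) = 
      (\<Sum>(B, C)\<leftarrow>splits (ginibre_dual l) A. T (B # C # L)) +
      (\<Sum>(v, L')\<leftarrow>splits_list (ginibre_dual l) L. T ((A @ v) # L')) / of_nat N ^ 2"
    by (simp add: T_def del: trace_prod_simps)
  from SD(2) show "L' \<in> lists (lists ((J <+> J) \<times> UNIV)) \<Longrightarrow> integrable P (\<lambda>\<omega>. trace_prod N (?X \<omega>) L')"
    by simp
qed

lemma wishart_entry:
  assumes "x < N" "y < N"
  shows "wishart_mat f M N r \<omega> $$ (x, y) = (\<Sum>m<M. cnj (f r m x \<omega>) * f r m y \<omega>) / of_nat N"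
proof -
  let ?G = "gaussian_mat f M N r \<omega>"
  have G: "?G \<in> carrier_mat M N" by (simp add: gaussian_mat_def)
  have aG: "mat_adjoint ?G \<in> carrier_mat N M" by (rule mat_adjoint_carrier[OF G])
  have "(mat_adjoint ?G * ?G) $$ (x, y) = (\<Sum>m<M. mat_adjoint ?G $$ (x, m) * ?G $$ (m, y))"
    using assms G aG by (auto simp: scalar_prod_def atLeast0LessThan intro!: sum.cong)
  also have "\<dots> = (\<Sum>m<M. cnj (f r m x \<omega>) * f r m y \<omega>)"
    using assms by (intro sum.cong refl) (simp add: index_mat_adjoint[OF G], simp add: gaussian_mat_def)
  finally show ?thesis
    using assms G aG by (simp add: wishart_mat_def)
qed

text \<open>Integration by parts takes the conjugated entry of row m; the cofactor is the other
  entry over N. Differentiating the cofactor gives 1/N for each of the M rows, hence the coefficient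
  M/N, and the leftover entries of a contraction sum up to the matrix again, so \<open>Z\<close> is
  the letter itself.\<close>

lemma wishart_schwinger_dyson:
  fixes \<sigma> :: "nat \<Rightarrow> nat \<Rightarrow> nat"
  assumes N: "N > 0" and M: "M > 0" and l: "l \<in> (J <+> J) \<times> UNIV" "\<not> isl (fst l)"
    and A: "A \<in> lists ((J <+> J) \<times> UNIV)" and L: "L \<in> lists (lists ((J <+> J) \<times> UNIV))"
  defines "T \<equiv> \<lambda>L. \<integral>\<omega>. trace_prod N (model_entry \<sigma> (\<lambda>r. wishart_mat f M N r \<omega>)) L \<partial>P"
  shows "T ((l # A) # L) = of_nat M / of_nat N * T (A # L) +
      (\<Sum>(B, C)\<leftarrow>splits (wishart_dual l) A. T (((fst l, False) # B) # C # L)) +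
      (\<Sum>(v, L')\<leftarrow>splits_list (wishart_dual l) L. T (((fst l, False) # A @ v) # L')) / of_nat N ^ 2"
    and "L' \<in> lists (lists ((J <+> J) \<times> UNIV)) \<Longrightarrow>
      integrable P (\<lambda>\<omega>. trace_prod N (model_entry \<sigma> (\<lambda>r. wishart_mat f M N r \<omega>)) L')"
proof -
  obtain r b where lb: "l = (Inr r, b)" and r: "r \<in> J"
    using l by (cases l) auto
  let ?X = "\<lambda>\<omega>. model_entry \<sigma> (\<lambda>r. wishart_mat f M N r \<omega>)"
  let ?g = "\<lambda>r m x b. gletter ((r, m, x), b)"
  define k where "k m x = ((r, m, x), False)" for m x :: nat
  define E where "E m y \<omega> = 1 / of_nat N * ?g r m y False \<omega>" for m y :: nat and \<omega> :: 'w
  define e where "e m y \<omega> = 1 / of_nat N * ?g r m y True \<omega>" for m y :: nat and \<omega> :: 'w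
  have letter: "letter_entry (?X \<omega>) (Inr r', b') x y = 1 / of_nat N * (\<Sum>m<M. ?g r' m x True \<omega> * ?g r' m y False \<omega>)"
    if "x < N" "y < N" for r' b' x y \<omega>
    using that by (cases b') (simp_all add: letter_entry_def model_entry_def wishart_entry gletter_def mult.commute)
  have 1: "fst (k m x) \<in> J \<times> UNIV \<times> UNIV" for m x using r by (simp add: k_def)
  have 2: "letter_entry (?X \<omega>) l x y = (\<Sum>m<M. gletter (apsnd Not (k m x)) \<omega> * E m y \<omega>)"
    if "x < N" "y < N" for x y \<omega>
    using that by (simp add: lb letter k_def E_def sum_distrib_left mult_ac)
  have 3: "wick_deriv (k m x) (E m y) (\<lambda>_. if x = y then 1 / of_nat N else 0)" for m x y
  proof -
    have "wick_deriv (k m x) (E m y) (\<lambda>_. 1 / of_nat N * (if k m x = ((r, m, y), False) then 1 else 0))"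
      unfolding E_def[abs_def] by (intro wick_deriv_cmult wick_deriv_gletter) (use r in simp)
    then show ?thesis by (cases "x = y") (simp_all add: k_def)
  qed
  have 4: "wick_deriv (k m x) (\<lambda>\<omega>. letter_entry (?X \<omega>) h y t) (\<lambda>\<omega>. if h \<in> wishart_dual l \<and> t = x then e m y \<omega> else 0)"
    if m: "m < M" and h: "h \<in> (J <+> J) \<times> UNIV" "y < N" "t < N" for m x h y t
  proof (cases "fst h")
    case (Inl r')
    then have "h \<notin> wishart_dual l" by (auto simp: wishart_dual_def lb)
    moreover have "letter_entry (?X \<omega>) h y t = letter_entry (\<lambda>_. perm_entry (\<sigma> r')) h y t" for \<omega>
      using Inl by (simp add: letter_entry_def model_entry_def)
    ultimately show ?thesis using wick_deriv_const by simp
  next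
    case (Inr r')
    then have hr: "h = (Inr r', snd h)" by (simp add: prod_eq_iff)
    then have r': "r' \<in> J" using h(1) by auto
    have "wick_deriv (k m x) (\<lambda>\<omega>. 1 / of_nat N * (\<Sum>i<M. ?g r' i y True \<omega> * ?g r' i t False \<omega>))
       (\<lambda>\<omega>. 1 / of_nat N * (\<Sum>i<M. (if k m x = ((r', i, y), True) then 1 else 0) * ?g r' i t False \<omega> +
          ?g r' i y True \<omega> * (if k m x = ((r', i, t), False) then 1 else 0)))"
      by (intro wick_deriv_cmult wick_deriv_sum wick_deriv_mult wick_deriv_gletter) (use r' in simp_all)
    moreover have "(\<lambda>\<omega>. 1 / of_nat N * (\<Sum>i<M. ?g r' i y True \<omega> * ?g r' i t False \<omega>)) = (\<lambda>\<omega>. letter_entry (?X \<omega>) h y t)"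
      using letter[OF h(2,3), of _ r' "snd h"] hr by (simp add: fun_eq_iff)
    moreover have "1 / of_nat N * (\<Sum>i<M. (if k m x = ((r', i, y), True) then 1 else 0) * ?g r' i t False \<omega> +
          ?g r' i y True \<omega> * (if k m x = ((r', i, t), False) then 1 else 0)) =
        (if h \<in> wishart_dual l \<and> t = x then e m y \<omega> else 0)" for \<omega>
    proof -
      have "(\<Sum>i<M. (if k m x = ((r', i, y), True) then 1 else 0) * ?g r' i t False \<omega> +
          ?g r' i y True \<omega> * (if k m x = ((r', i, t), False) then 1 else 0)) =
          (\<Sum>i<M. if i = m then (if r' = r \<and> t = x then ?g r' m y True \<omega> else 0) else 0)"
        by (intro sum.cong) (auto simp: k_def)
      then show ?thesis
        using hr m by (cases "snd h") (auto simp: wishart_dual_def lb e_def)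
    qed
    ultimately show ?thesis by simp
  qed
  have 5: "(\<Sum>m<M. e m u \<omega> * E m y \<omega>) = word_entry N (?X \<omega>) [(fst l, False)] u y / of_nat N" if "y < N" "u < N" for y u \<omega>
  proof -
    have "word_entry N (?X \<omega>) [(fst l, False)] u y = (\<Sum>t<N. if t = y then letter_entry (?X \<omega>) (Inr r, False) u t else 0)"
      unfolding word_entry.simps by (intro sum.cong) (auto simp: lb)
    also have "\<dots> = 1 / of_nat N * (\<Sum>m<M. ?g r m u True \<omega> * ?g r m y False \<omega>)"
      using that by (simp add: letter)
    finally show ?thesis
      by (simp add: e_def E_def sum_divide_distrib)
  qed
  have Z: "set [(fst l, False)] \<subseteq> (J <+> J) \<times> UNIV" using r by (auto simp: lb)
  note SD = schwinger_dyson_matrices[where X = ?X and k = k and E = E and e = e and M = M and N = N and \<epsilon> = "1 / of_nat N" and l = l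
      and Z = "[(fst l, False)]" and V = "(J <+> J) \<times> UNIV" and H = "wishart_dual l" and A = A and L = L, OF N M 1 2 3 4 5 l(1) Z A L]
  from SD(1) show "T ((l # A) # L) = of_nat M / of_nat N * T (A # L) +
      (\<Sum>(B, C)\<leftarrow>splits (wishart_dual l) A. T (((fst l, False) # B) # C # L)) +
      (\<Sum>(v, L')\<leftarrow>splits_list (wishart_dual l) L. T (((fst l, False) # A @ v) # L')) / of_nat N ^ 2"
    by (simp add: T_def del: trace_prod_simps)
  from SD(2) show "L' \<in> lists (lists ((J <+> J) \<times> UNIV)) \<Longrightarrow> integrable P (\<lambda>\<omega>. trace_prod N (?X \<omega>) L')"
    by simp
qed

end

section \<open>Limit equations of the circular and the free Poisson family\<close>

lemma splits_map:
  assumes "inj f"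
  shows "splits (f ` H) (map f A) = map (map_prod (map f) (map f)) (splits H A)"
  using assms by (induction A) (auto simp: inj_image_mem_iff comp_def case_prod_unfold map_prod_def)

context tracial_star_prob_space
begin

lemma circular_family_schwinger_dyson:
  fixes u g :: "'r \<Rightarrow> 'a"
  assumes free: "star_free scaleC star \<phi> (case_sum u g) (J <+> J)"
    and g: "\<And>r. r \<in> J \<Longrightarrow> standard_circular star \<phi> (g r)"
    and l: "l \<in> (J <+> J) \<times> UNIV" "\<not> isl (fst l)" and w: "w \<in> lists ((J <+> J) \<times> UNIV)"
  defines "\<psi> \<equiv> \<lambda>w. \<phi> (eval_monomial star (case_sum u g) w)"
  shows "\<psi> (l # w) = (\<Sum>(B, C)\<leftarrow>splits (ginibre_dual l) w. \<psi> B * \<psi> C)"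
proof -
  obtain r b where lb: "l = (Inr r, b)" and r: "r \<in> J"
    using l by (cases l) auto
  let ?X = "case_sum u g"
  let ?L = "\<lambda>b. if b then star (g r) else g r"
  have "\<phi> (?L b * eval_monomial star ?X v) = 0 * \<phi> (eval_monomial star ?X v) + split_state ?X (ginibre_dual l) 1 v 1"
    if v: "\<And>l. l \<in> set v \<Longrightarrow> fst l = Inr r" for v
  proof -
    let ?f = "Pair (Inr r) :: bool \<Rightarrow> ('r + 'r) \<times> bool"
    have inj: "inj ?f" by (rule injI) simp
    have v_eq: "v = map ?f (map snd v)" using v by (induction v) (auto simp: prod_eq_iff)
    have ev: "eval_monomial star ?X (map ?f bs) = prod_list (map ?L bs)" for bs
      by (induction bs) auto
    have "split_state ?X (ginibre_dual l) 1 (map ?f bs) 1 =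
        (\<Sum>(B, C)\<leftarrow>splits {\<not> b} bs. \<phi> (prod_list (map ?L B)) * \<phi> (prod_list (map ?L C)))" for bs
    proof -
      have H: "ginibre_dual l = ?f ` {\<not> b}" by (simp add: ginibre_dual_def lb)
      show ?thesis
        unfolding split_state_def H splits_map[OF inj] by (simp add: ev comp_def case_prod_unfold)
    qed
    with circular_schwinger_dyson[OF state_one g[OF r], of b "map snd v"] show ?thesis
      by (subst (1 2 3) v_eq) (simp add: ev del: map_map)
  qed
  note single = this
  have d: "?L b \<in> gen ?X (Inr r)"
    by (cases b) (simp_all add: generated_star_subalgebra.star generated_star_subalgebra.base)
  have "\<phi> (?L b * eval_monomial star ?X w) = 0 * \<phi> (eval_monomial star ?X w) + split_state ?X (ginibre_dual l) 1 w 1"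
    by (rule schwinger_dyson_of_free[OF free _ d generated_star_subalgebra.one _ single])
      (use r w in \<open>auto simp: ginibre_dual_def lb lists_eq_set\<close>)
  then show ?thesis by (cases b) (simp_all add: \<psi>_def lb split_state_def case_prod_unfold)
qed

lemma free_poisson_family_schwinger_dyson:
  fixes u p :: "'r \<Rightarrow> 'a"
  assumes free: "star_free scaleC star \<phi> (case_sum u p) (J <+> J)"
    and p: "\<And>r. r \<in> J \<Longrightarrow> free_poisson star \<phi> c (p r)"
    and l: "l \<in> (J <+> J) \<times> UNIV" "\<not> isl (fst l)" and w: "w \<in> lists ((J <+> J) \<times> UNIV)"
  defines "\<psi> \<equiv> \<lambda>w. \<phi> (eval_monomial star (case_sum u p) w)"
  shows "\<psi> (l # w) = of_real c * \<psi> w + (\<Sum>(B, C)\<leftarrow>splits (wishart_dual l) w. \<psi> ((fst l, False) # B) * \<psi> C)"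
proof -
  obtain r b where lb: "l = (Inr r, b)" and r: "r \<in> J"
    using l by (cases l) auto
  let ?X = "case_sum u p"
  have star_p: "star (p r) = p r" using p[OF r] by (simp add: free_poisson_def)
  have "\<phi> (p r * eval_monomial star ?X v) = of_real c * \<phi> (eval_monomial star ?X v) + split_state ?X (wishart_dual l) (p r) v 1"
    if v: "\<And>l. l \<in> set v \<Longrightarrow> fst l = Inr r" for v
  proof -
    have ev: "eval_monomial star ?X v' = p r ^ length v'" if "set v' \<subseteq> set v" for v'
      using that v by (induction v') (auto simp: star_p)
    have "v ! j \<in> wishart_dual l" if "j < length v" for j
      using v[OF nth_mem[OF that]] by (cases "snd (v ! j)") (auto simp: wishart_dual_def lb prod_eq_iff)
    then have "split_state ?X (wishart_dual l) (p r) v 1 =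
        (\<Sum>j<length v. \<phi> (p r * eval_monomial star ?X (take j v)) * \<phi> (eval_monomial star ?X (drop (Suc j) v) * 1))"
      unfolding split_state_def sum_splits by (intro sum.cong) auto
    also have "\<dots> = (\<Sum>j<length v. \<phi> (p r ^ Suc j) * \<phi> (p r ^ (length v - 1 - j)))"
      by (intro sum.cong refl) (simp add: ev set_take_subset set_drop_subset)
    finally show ?thesis
      using free_poisson_recursion[OF state_one p[OF r], of "length v"] by (simp add: ev)
  qed
  note single = this
  have d: "p r \<in> gen ?X (Inr r)"
    by (auto intro!: generated_star_subalgebra.base)
  have "\<phi> (p r * eval_monomial star ?X w) = of_real c * \<phi> (eval_monomial star ?X w) + split_state ?X (wishart_dual l) (p r) w 1"
    by (rule schwinger_dyson_of_free[OF free _ d d _ single])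
      (use r w in \<open>auto simp: wishart_dual_def lb lists_eq_set\<close>)
  then show ?thesis by (simp add: \<psi>_def lb split_state_def case_prod_unfold star_p)
qed

end

section \<open>Words in the permutations\<close>

definition fixed_count :: "nat \<Rightarrow> ('r \<Rightarrow> nat \<Rightarrow> nat) \<Rightarrow> ('r \<times> bool) list \<Rightarrow> nat" where
  "fixed_count N \<sigma> v = card {x\<in>{..<N}. perm_action \<sigma> v x = x}"

lemma perm_action_append: "perm_action \<sigma> (v @ w) = perm_action \<sigma> v \<circ> perm_action \<sigma> w"
  by (induction v) (auto simp: comp_assoc)

text \<open>The two permutations are conjugate: the action of \<open>w\<close> maps the fixed points
  of the one to those of the other, and the action of \<open>v\<close> maps them back.\<close>

lemma fixed_count_rotate:
  assumes "\<And>r. r \<in> fst ` (set v \<union> set w) \<Longrightarrow> \<sigma> r permutes {..<N}"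
  shows "fixed_count N \<sigma> (v @ w) = fixed_count N \<sigma> (w @ v)"
proof -
  let ?f = "perm_action \<sigma> v" and ?g = "perm_action \<sigma> w"
  have "?f permutes {..<N}" "?g permutes {..<N}"
    using assms by (auto intro!: perm_action_permutes)
  then have lt: "?f x < N \<longleftrightarrow> x < N" "?g x < N \<longleftrightarrow> x < N" for x
    using permutes_in_image[of ?f "{..<N}" x] permutes_in_image[of ?g "{..<N}" x] by simp_all
  have "bij_betw ?g {x\<in>{..<N}. ?f (?g x) = x} {x\<in>{..<N}. ?g (?f x) = x}"
    by (rule bij_betw_byWitness[where f' = ?f]) (simp_all add: lt image_subset_iff)
  then show ?thesis
    by (simp add: fixed_count_def perm_action_append bij_betw_same_card)
qed

lemma fixed_count_cancel:
  assumes "\<sigma> (fst l) permutes {..<N}"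
  shows "fixed_count N \<sigma> (l # apsnd Not l # v) = fixed_count N \<sigma> v"
proof -
  obtain r b where l: "l = (r, b)" by (cases l)
  have "\<sigma> r (inv_into UNIV (\<sigma> r) x) = x" "inv_into UNIV (\<sigma> r) (\<sigma> r x) = x" for x
    using assms permutes_inverses[of "\<sigma> r"] by (auto simp: l)
  then have "perm_action \<sigma> (l # apsnd Not l # v) = perm_action \<sigma> v"
    by (cases b) (simp_all add: l fun_eq_iff)
  then show ?thesis by (simp add: fixed_count_def)
qed

lemma word_trace_perm:
  assumes "\<And>r. r \<in> fst ` set v \<Longrightarrow> \<sigma> r permutes {..<N}"
  shows "word_trace N (model_entry \<sigma> Y) (map (apfst Inl) v) = of_nat (fixed_count N \<sigma> v) / of_nat N"
proof -
  let ?X = "model_entry \<sigma> Y"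
  have "word_entry N ?X (map (apfst Inl) v) x y = (if x = perm_action \<sigma> v y then 1 else 0)"
    if "x < N" "y < N" for x y
    using assms that
  proof (induction v arbitrary: x rule: list.induct)
    case (Cons l v)
    obtain r b where l: "l = (r, b)" by (cases l)
    let ?\<tau> = "if b then inv_into UNIV (\<sigma> r) else \<sigma> r"
    have r: "\<sigma> r permutes {..<N}" using Cons.prems by (simp add: l)
    have letter: "letter_entry ?X (Inl r, b) x z = (if x = ?\<tau> z then 1 else 0)" for z
      using permutes_inverses[OF r] by (auto simp: letter_entry_def model_entry_def perm_entry_def)
    have "perm_action \<sigma> v permutes {..<N}"
      using Cons.prems by (intro perm_action_permutes) auto
    then have act: "perm_action \<sigma> v y < N" using permutes_in_image[of _ "{..<N}" y] Cons.prems(3) by simp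
    have IH: "word_entry N ?X (map (apfst Inl) v) z y = (if z = perm_action \<sigma> v y then 1 else 0)" if "z < N" for z
      using Cons.prems that by (intro Cons.IH) auto
    have "word_entry N ?X (map (apfst Inl) (l # v)) x y =
        (\<Sum>z<N. letter_entry ?X (Inl r, b) x z * word_entry N ?X (map (apfst Inl) v) z y)"
      by (simp add: l)
    also have "\<dots> = (\<Sum>z<N. if z = perm_action \<sigma> v y then (if x = ?\<tau> z then 1 else 0) else 0)"
      using letter IH by (intro sum.cong refl) simp
    finally show ?case using act by (simp add: l)
  qed simp
  then have "(\<Sum>x<N. word_entry N ?X (map (apfst Inl) v) x x) = (\<Sum>x<N. if perm_action \<sigma> v x = x then 1 else 0)"
    by (intro sum.cong) auto
  also have "\<dots> = of_nat (fixed_count N \<sigma> v)"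
    by (simp add: fixed_count_def sum.If_cases Int_def)
  finally show ?thesis by (simp add: word_trace_def)
qed

text \<open>Rotations and cancellations preserve both the number of fixed points and, by traciality
  and unitarity, the state. One and the same reduced word therefore decides the limit on the matrix
  side and the value in the algebra.\<close>

lemma (in tracial_star_prob_space) cyclic_reduction:
  assumes haar: "\<And>r. r \<in> J \<Longrightarrow> haar_unitary star \<phi> (u r)" and v: "fst ` set v \<subseteq> J"
  shows "\<exists>v'. fst ` set v' \<subseteq> J \<and> cyclically_reduced v' \<and>
    (\<forall>N \<sigma>. (\<forall>r\<in>J. \<sigma> r permutes {..<N}) \<longrightarrow> fixed_count N \<sigma> v = fixed_count N \<sigma> v') \<and>
    \<phi> (eval_monomial star u v) = \<phi> (eval_monomial star u v')"
  using v
proof (induction "length v" arbitrary: v rule: less_induct)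
  case (less v)
  show ?case
  proof (cases "cyclically_reduced v")
    case True
    then show ?thesis using less.prems by blast
  next
    case False
    then obtain t where t: "t < length v" "v ! (Suc t mod length v) = apsnd Not (v ! t)"
      by (auto simp: cyclically_reduced_def)
    \<comment> \<open>In a word of one letter the cyclic successor is the letter itself, which is
      not its own inverse; so the cancelling pair occupies two positions.\<close>
    have "apsnd Not (v ! t) \<noteq> v ! t" by (cases "v ! t") simp
    with t have len: "length v \<ge> 2" by (cases v; cases "tl v") auto
    define l where "l = v ! t"
    have rot: "rotate t v ! 0 = l" "rotate t v ! 1 = apsnd Not l"
    proof -
      have "0 < length v" "1 < length v" using len by linarith+
      note * = this[THEN nth_rotate, of t]
      then show "rotate t v ! 0 = l" "rotate t v ! 1 = apsnd Not l"
        using * t by (simp_all add: l_def)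
    qed
    have "length (rotate t v) \<ge> 2" using len by simp
    then obtain x y v1 where "rotate t v = x # y # v1"
      by (cases "rotate t v"; cases "tl (rotate t v)") auto
    with rot have v1: "rotate t v = l # apsnd Not l # v1" by simp
    define a where "a = take t v"
    define b where "b = drop t v"
    have v_ab: "v = a @ b" and rot_ab: "rotate t v = b @ a"
      using t by (simp_all add: a_def b_def rotate_drop_take)
    have set_v1: "set v1 \<subseteq> set v" "l \<in> set v"
      using arg_cong[OF v1, of set] by auto
    have "length v1 < length v" using arg_cong[OF v1, of length] by simp
    then obtain v' where v': "fst ` set v' \<subseteq> J" "cyclically_reduced v'"
      "\<And>N \<sigma>. \<forall>r\<in>J. \<sigma> r permutes {..<N} \<Longrightarrow> fixed_count N \<sigma> v1 = fixed_count N \<sigma> v'"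
      "\<phi> (eval_monomial star u v1) = \<phi> (eval_monomial star u v')"
      using less.hyps[of v1] less.prems set_v1 by blast
    have "fixed_count N \<sigma> v = fixed_count N \<sigma> v'" if "\<forall>r\<in>J. \<sigma> r permutes {..<N}" for N \<sigma>
    proof -
      have "fixed_count N \<sigma> v = fixed_count N \<sigma> (b @ a)"
        unfolding v_ab using that less.prems by (intro fixed_count_rotate) (auto simp: v_ab)
      also have "\<dots> = fixed_count N \<sigma> v1"
        unfolding rot_ab[symmetric] v1 using that less.prems set_v1 by (intro fixed_count_cancel) auto
      finally show ?thesis using v'(3)[OF that] by simp
    qed
    moreover have "\<phi> (eval_monomial star u v) = \<phi> (eval_monomial star u v')"
    proof -
      have "\<phi> (eval_monomial star u v) = \<phi> (eval_monomial star u (b @ a))"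
        unfolding v_ab by (simp add: state_trace)
      also have "\<dots> = \<phi> (eval_monomial star u v1)"
      proof -
        have "haar_unitary star \<phi> (u (fst l))" using haar set_v1 less.prems by auto
        then have inv: "star (u (fst l)) * u (fst l) = 1" "u (fst l) * star (u (fst l)) = 1"
          by (auto simp: haar_unitary_def)
        have "star (u (fst l)) * (u (fst l) * x) = x" "u (fst l) * (star (u (fst l)) * x) = x" for x
          using inv by (simp_all flip: mult.assoc)
        then show ?thesis unfolding rot_ab[symmetric] v1 by simp
      qed
      finally show ?thesis using v'(4) by simp
    qed
    ultimately show ?thesis using v'(1,2) by blast
  qed
qed

lemma (in tracial_star_prob_space) state_cyclically_reduced:
  assumes free: "star_free scaleC star \<phi> (case_sum u g) (J <+> J)"
    and haar: "\<And>r. r \<in> J \<Longrightarrow> haar_unitary star \<phi> (u r)"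
    and v: "fst ` set v \<subseteq> J" "v \<noteq> []" "cyclically_reduced v"
  shows "\<phi> (eval_monomial star u v) = 0"
proof -
  have "\<phi> (eval_monomial star (case_sum u g) (map (apfst Inl) v)) = 0"
  proof (rule state_reduced_haar_word[OF free])
    show "fst ` set (map (apfst Inl) v) \<subseteq> J <+> J" using v(1) by auto
    show "map (apfst Inl) v \<noteq> []" using v(2) by simp
    show "haar_unitary star \<phi> (case_sum u g i)" if "i \<in> fst ` set (map (apfst Inl) v)" for i
      using that v(1) haar by auto
    have "v ! Suc t \<noteq> apsnd Not (v ! t)" if "Suc t < length v" for t
    proof -
      have "v ! (Suc t mod length v) \<noteq> apsnd Not (v ! t)"
        using v(3)[unfolded cyclically_reduced_def, rule_format, of t] that by simp
      then show ?thesis using that by simp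
    qed
    then show "successively (\<lambda>x y. y \<noteq> apsnd Not x) (map (apfst Inl) v)"
      by (auto simp: successively_conv_nth prod_eq_iff)
  qed
  moreover have "eval_monomial star (case_sum u g) (map (apfst Inl) v) = eval_monomial star u v"
    by (induction v) auto
  ultimately show ?thesis by simp
qed

section \<open>Almost sure convergence\<close>

lemma prod_list_unit_interval:
  fixes p :: "'x \<Rightarrow> real"
  assumes "\<And>x. x \<in> set xs \<Longrightarrow> 0 \<le> p x \<and> p x \<le> 1"
  shows "0 \<le> (\<Prod>x\<leftarrow>xs. p x) \<and> (\<Prod>x\<leftarrow>xs. p x) \<le> 1"
  using assms by (induction xs) (auto intro: mult_le_one)

lemma prod_list_le_factor:
  fixes p :: "'x \<Rightarrow> real"
  assumes "\<And>x. x \<in> set xs \<Longrightarrow> 0 \<le> p x \<and> p x \<le> 1" "y \<in> set xs"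
  shows "(\<Prod>x\<leftarrow>xs. p x) \<le> p y"
proof -
  obtain as bs where xs: "xs = as @ y # bs" using assms(2) by (meson split_list)
  have "(\<Prod>x\<leftarrow>xs. p x) = p y * (\<Prod>x\<leftarrow>as @ bs. p x)" by (simp add: xs)
  also have "\<dots> \<le> p y * 1"
    using assms(1) prod_list_unit_interval[of "as @ bs" p] by (intro mult_left_mono) (auto simp: xs)
  finally show ?thesis by simp
qed

definition perm_avg :: "'r set \<Rightarrow> nat \<Rightarrow> (('r \<Rightarrow> nat \<Rightarrow> nat) \<Rightarrow> real) \<Rightarrow> real" where
  "perm_avg J N F = (\<Sum>\<sigma>\<in>J \<rightarrow>\<^sub>E {\<sigma>. \<sigma> permutes {..<N}}. F \<sigma>) / fact N ^ card J"

lemma perm_avg_const: "finite J \<Longrightarrow> perm_avg J N (\<lambda>_. c) = c"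
  using card_permutations[OF refl, of "{..<N}"] by (simp add: perm_avg_def card_PiE)

lemma perm_avg_mono:
  "(\<And>\<sigma>. \<sigma> \<in> J \<rightarrow>\<^sub>E {\<sigma>. \<sigma> permutes {..<N}} \<Longrightarrow> F \<sigma> \<le> G \<sigma>) \<Longrightarrow> perm_avg J N F \<le> perm_avg J N G"
  by (auto simp: perm_avg_def intro!: divide_right_mono sum_mono)

lemma perm_avg_cong:
  "(\<And>\<sigma>. \<sigma> \<in> J \<rightarrow>\<^sub>E {\<sigma>. \<sigma> permutes {..<N}} \<Longrightarrow> F \<sigma> = G \<sigma>) \<Longrightarrow> perm_avg J N F = perm_avg J N G"
  unfolding perm_avg_def by (metis (no_types, lifting) sum.cong)

definition fixed_ratio :: "nat \<Rightarrow> ('r \<Rightarrow> nat \<Rightarrow> nat) \<Rightarrow> ('r \<times> bool) list \<Rightarrow> real" where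
  "fixed_ratio N \<sigma> v = real (fixed_count N \<sigma> v) / real N"

lemma fixed_ratio_bounds: "0 \<le> fixed_ratio N \<sigma> v" "fixed_ratio N \<sigma> v \<le> 1"
proof -
  have "fixed_count N \<sigma> v \<le> card {..<N}" unfolding fixed_count_def by (intro card_mono) auto
  then show "fixed_ratio N \<sigma> v \<le> 1" by (cases "N = 0") (auto simp: fixed_ratio_def)
qed (simp add: fixed_ratio_def)

lemma prod_fixed_ratio_bounds:
  "0 \<le> (\<Prod>v\<leftarrow>vs. fixed_ratio N \<sigma> v)" "(\<Prod>v\<leftarrow>vs. fixed_ratio N \<sigma> v) \<le> 1"
  using prod_list_unit_interval[of vs "fixed_ratio N \<sigma>"] fixed_ratio_bounds[of N \<sigma>] by simp_all

text \<open>The bounded second moment of the number of fixed points controls its mean as well,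
  because k is at most k^2 for natural k.\<close>

lemma perm_avg_fixed_ratio:
  fixes v :: "('r \<times> bool) list"
  assumes "finite J" "fst ` set v \<subseteq> J" "v \<noteq> []" "cyclically_reduced v"
  shows "\<exists>C\<ge>0. \<forall>N\<ge>4 * length v. perm_avg J N (\<lambda>\<sigma>. fixed_ratio N \<sigma> v ^ 2) \<le> C / real N ^ 2 \<and>
    perm_avg J N (\<lambda>\<sigma>. fixed_ratio N \<sigma> v) \<le> C / real N"
proof -
  define C where "C = (real (2 * length v) + 2) ^ (2 * length v)"
  have "perm_avg J N (\<lambda>\<sigma>. fixed_ratio N \<sigma> v ^ 2) \<le> C / real N ^ 2 \<and> perm_avg J N (\<lambda>\<sigma>. fixed_ratio N \<sigma> v) \<le> C / real N"
    if N: "N \<ge> 4 * length v" for N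
  proof -
    let ?Q = "J \<rightarrow>\<^sub>E {\<sigma>. \<sigma> permutes {..<N}}"
    have "N > 0" using N assms(3) by (cases v) auto
    have 2: "(\<Sum>\<sigma>\<in>?Q. real (fixed_count N \<sigma> v) ^ 2) \<le> C * fact N ^ card J"
      unfolding fixed_count_def C_def by (rule fixed_points_second_moment[OF assms N])
    have "real n \<le> real n ^ 2" for n
    proof -
      have "n \<le> n ^ 2" by (cases n) (simp_all add: power2_eq_square)
      then have "real n \<le> real (n ^ 2)" by (intro of_nat_mono)
      then show ?thesis by simp
    qed
    then have 1: "(\<Sum>\<sigma>\<in>?Q. real (fixed_count N \<sigma> v)) \<le> C * fact N ^ card J"
      by (intro order_trans[OF sum_mono 2])
    have "perm_avg J N (\<lambda>\<sigma>. fixed_ratio N \<sigma> v ^ 2) = (\<Sum>\<sigma>\<in>?Q. real (fixed_count N \<sigma> v) ^ 2) / fact N ^ card J / real N ^ 2"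
      by (simp add: perm_avg_def fixed_ratio_def power_divide flip: sum_divide_distrib)
    also have "\<dots> \<le> C / real N ^ 2"
      using 2 by (intro divide_right_mono) (simp_all add: divide_le_eq)
    finally have "perm_avg J N (\<lambda>\<sigma>. fixed_ratio N \<sigma> v ^ 2) \<le> C / real N ^ 2" .
    moreover have "perm_avg J N (\<lambda>\<sigma>. fixed_ratio N \<sigma> v) = (\<Sum>\<sigma>\<in>?Q. real (fixed_count N \<sigma> v)) / fact N ^ card J / real N"
      by (simp add: perm_avg_def fixed_ratio_def flip: sum_divide_distrib)
    moreover have "\<dots> \<le> C / real N"
      using 1 by (intro divide_right_mono) (simp_all add: divide_le_eq)
    ultimately show ?thesis by simp
  qed
  moreover have "C \<ge> 0" by (simp add: C_def)
  ultimately show ?thesis by blast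
qed

text \<open>Words with ratio 1 drop out, and with at most one other word factorization is exact.
  With two others, the average of the product and the product of the averages are each O(1/N^2), so
  no cancellation between them is needed.\<close>

lemma perm_avg_factor:
  fixes vs :: "('r \<times> bool) list list"
  assumes J: "finite J" and n: "filterlim n at_top sequentially" and npos: "\<And>q. n q > 0"
    and dich: "\<And>v. v \<in> set vs \<Longrightarrow> triv v \<or> nontriv v"
    and triv: "\<And>v q \<sigma>. triv v \<Longrightarrow> \<sigma> \<in> J \<rightarrow>\<^sub>E {\<sigma>. \<sigma> permutes {..<n q}} \<Longrightarrow> fixed_ratio (n q) \<sigma> v = 1"
    and nontriv: "\<And>v. nontriv v \<Longrightarrow> \<exists>C\<ge>0. eventually (\<lambda>q.
        perm_avg J (n q) (\<lambda>\<sigma>. fixed_ratio (n q) \<sigma> v ^ 2) \<le> C / real (n q) ^ 2 \<and>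
        perm_avg J (n q) (\<lambda>\<sigma>. fixed_ratio (n q) \<sigma> v) \<le> C / real (n q)) sequentially"
  defines "a \<equiv> \<lambda>q vs. perm_avg J (n q) (\<lambda>\<sigma>. \<Prod>v\<leftarrow>vs. fixed_ratio (n q) \<sigma> v)"
  shows "\<exists>C. eventually (\<lambda>q. \<bar>a q vs - (\<Prod>v\<leftarrow>vs. a q [v])\<bar> \<le> C / real (n q) ^ 2) sequentially"
  using dich
proof (induction vs)
  case Nil
  show ?case using J by (intro exI[of _ 0]) (simp add: a_def perm_avg_const)
next
  case (Cons v vs)
  have a_bounds: "0 \<le> a q us \<and> a q us \<le> 1" for q us
  proof -
    have "perm_avg J (n q) (\<lambda>_. 0) \<le> a q us" "a q us \<le> perm_avg J (n q) (\<lambda>_. 1)"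
      unfolding a_def by (intro perm_avg_mono prod_fixed_ratio_bounds)+
    then show ?thesis by (simp add: perm_avg_const J)
  qed
  have a_triv: "a q (v # us) = a q us" if "triv v" for q v us
    unfolding a_def using triv[OF that] by (intro perm_avg_cong) simp
  from Cons.prems[of v] consider "triv v" | "nontriv v" "\<forall>v'\<in>set vs. triv v'"
    | v' where "nontriv v" "v' \<in> set vs" "nontriv v'"
    using Cons.prems by fastforce
  then show ?case
  proof cases
    case 1
    have "a q [v] = 1" for q using a_triv[OF 1, of q "[]"] J by (simp add: a_def perm_avg_const)
    then show ?thesis using Cons.IH Cons.prems a_triv[OF 1, of _ vs] by simp
  next
    case 2
    have "a q us = 1" if "\<forall>v'\<in>set us. triv v'" for q us
      using that
    proof (induction us)
      case (Cons u us)
      then show ?case using a_triv[of u q us] by simp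
    qed (use J in \<open>simp add: a_def perm_avg_const\<close>)
    moreover have "a q (v # vs) = a q [v]" for q
    proof -
      have "(\<Prod>v\<leftarrow>vs. fixed_ratio (n q) \<sigma> v) = 1"
        if "\<sigma> \<in> J \<rightarrow>\<^sub>E {\<sigma>. \<sigma> permutes {..<n q}}" for \<sigma>
        using 2(2) triv that by (induction vs) auto
      then show ?thesis unfolding a_def by (intro perm_avg_cong) simp
    qed
    moreover have "(\<Prod>v\<leftarrow>vs. a q [v]) = 1" for q
      using 2(2) calculation(1) by (induction vs) auto
    ultimately show ?thesis by (intro exI[of _ 0]) simp
  next
    case 3
    obtain C where C: "C \<ge> 0" "eventually (\<lambda>q.
        perm_avg J (n q) (\<lambda>\<sigma>. fixed_ratio (n q) \<sigma> v ^ 2) \<le> C / real (n q) ^ 2 \<and>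
        perm_avg J (n q) (\<lambda>\<sigma>. fixed_ratio (n q) \<sigma> v) \<le> C / real (n q)) sequentially"
      using nontriv[OF 3(1)] by blast
    obtain C' where C': "C' \<ge> 0" "eventually (\<lambda>q.
        perm_avg J (n q) (\<lambda>\<sigma>. fixed_ratio (n q) \<sigma> v' ^ 2) \<le> C' / real (n q) ^ 2 \<and>
        perm_avg J (n q) (\<lambda>\<sigma>. fixed_ratio (n q) \<sigma> v') \<le> C' / real (n q)) sequentially"
      using nontriv[OF 3(3)] by blast
    have "eventually (\<lambda>q. \<bar>a q (v # vs) - (\<Prod>v\<leftarrow>v # vs. a q [v])\<bar> \<le> (C + C' + C * C') / real (n q) ^ 2) sequentially"
      using C(2) C'(2)
    proof eventually_elim
      case (elim q)
      let ?p = "\<lambda>\<sigma>. fixed_ratio (n q) \<sigma>"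
      have "a q (v # vs) \<le> perm_avg J (n q) (\<lambda>\<sigma>. ?p \<sigma> v ^ 2 + ?p \<sigma> v' ^ 2)"
        unfolding a_def
      proof (rule perm_avg_mono)
        fix \<sigma>
        have "(\<Prod>v\<leftarrow>vs. ?p \<sigma> v) \<le> ?p \<sigma> v'"
          using 3(2) by (intro prod_list_le_factor conjI fixed_ratio_bounds)
        then have "(\<Prod>v\<leftarrow>v # vs. ?p \<sigma> v) \<le> ?p \<sigma> v * ?p \<sigma> v'"
          by (simp add: mult_left_mono fixed_ratio_bounds)
        \<comment> \<open>No independence of the two words is available; the mean of their product
          is controlled by their second moments.\<close>
        also have "\<dots> \<le> ?p \<sigma> v ^ 2 + ?p \<sigma> v' ^ 2"
          using sum_squares_bound[of "?p \<sigma> v" "?p \<sigma> v'"] fixed_ratio_bounds(1)[of "n q" \<sigma>]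
            mult_nonneg_nonneg[OF fixed_ratio_bounds(1)[of "n q" \<sigma> v] fixed_ratio_bounds(1)[of "n q" \<sigma> v']]
          by linarith
        finally show "(\<Prod>v\<leftarrow>v # vs. ?p \<sigma> v) \<le> ?p \<sigma> v ^ 2 + ?p \<sigma> v' ^ 2" .
      qed
      also have "\<dots> = perm_avg J (n q) (\<lambda>\<sigma>. ?p \<sigma> v ^ 2) + perm_avg J (n q) (\<lambda>\<sigma>. ?p \<sigma> v' ^ 2)"
        by (simp add: perm_avg_def sum.distrib add_divide_distrib)
      also have "\<dots> \<le> (C + C') / real (n q) ^ 2"
        using elim by (simp add: add_divide_distrib)
      finally have 1: "a q (v # vs) \<le> (C + C') / real (n q) ^ 2" .
      have "(\<Prod>v\<leftarrow>vs. a q [v]) \<le> a q [v']"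
        using 3(2) by (intro prod_list_le_factor a_bounds)
      then have "(\<Prod>v\<leftarrow>v # vs. a q [v]) \<le> a q [v] * a q [v']"
        using a_bounds by (simp add: mult_left_mono)
      also have "\<dots> \<le> (C / real (n q)) * (C' / real (n q))"
      proof (rule mult_mono)
        show "a q [v] \<le> C / real (n q)" "a q [v'] \<le> C' / real (n q)"
          using elim by (simp_all add: a_def)
        show "0 \<le> a q [v']" using a_bounds by blast
        show "0 \<le> C / real (n q)" using C(1) by simp
      qed
      finally have 2: "(\<Prod>v\<leftarrow>v # vs. a q [v]) \<le> C * C' / real (n q) ^ 2"
        by (simp add: power2_eq_square)
      have 3: "0 \<le> a q (v # vs)" "0 \<le> (\<Prod>v\<leftarrow>v # vs. a q [v])"
        using a_bounds prod_list_unit_interval[of "v # vs" "\<lambda>v. a q [v]"] by auto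
      have "0 \<le> (C + C') / real (n q) ^ 2" "0 \<le> C * C' / real (n q) ^ 2" using C(1) C'(1) by auto
      with 1 2 3 show ?case by (simp add: add_divide_distrib abs_le_iff)
    qed
    then show ?thesis by blast
  qed
qed

section \<open>Almost sure limits from summable variances\<close>

text \<open>By monotone convergence the sum of the squares has finite expectation, so it is finite
  almost surely and its terms tend to 0.\<close>

lemma (in prob_space) AE_tendsto_0_of_second_moments:
  fixes D :: "nat \<Rightarrow> 'a \<Rightarrow> complex"
  assumes int: "\<And>q. integrable M (\<lambda>\<omega>. (norm (D q \<omega>))\<^sup>2)"
    and sum: "summable (\<lambda>q. \<integral>\<omega>. (norm (D q \<omega>))\<^sup>2 \<partial>M)"
  shows "AE \<omega> in M. (\<lambda>q. D q \<omega>) \<longlonglongrightarrow> 0"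
proof -
  have nn: "(\<integral>\<^sup>+\<omega>. ennreal ((norm (D q \<omega>))\<^sup>2) \<partial>M) = ennreal (\<integral>\<omega>. (norm (D q \<omega>))\<^sup>2 \<partial>M)" for q
    using int by (intro nn_integral_eq_integral) auto
  have meas: "(\<lambda>\<omega>. ennreal ((norm (D q \<omega>))\<^sup>2)) \<in> borel_measurable M" for q
    using borel_measurable_integrable[OF int] by measurable
  have "(\<integral>\<^sup>+\<omega>. (\<Sum>q. ennreal ((norm (D q \<omega>))\<^sup>2)) \<partial>M) = (\<Sum>q. ennreal (\<integral>\<omega>. (norm (D q \<omega>))\<^sup>2 \<partial>M))"
    using meas by (subst nn_integral_suminf) (simp_all add: nn)
  also have "\<dots> = ennreal (\<Sum>q. \<integral>\<omega>. (norm (D q \<omega>))\<^sup>2 \<partial>M)"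
    using sum by (intro suminf_ennreal2) auto
  finally have "(\<integral>\<^sup>+\<omega>. (\<Sum>q. ennreal ((norm (D q \<omega>))\<^sup>2)) \<partial>M) \<noteq> \<infinity>" by simp
  then have "AE \<omega> in M. (\<Sum>q. ennreal ((norm (D q \<omega>))\<^sup>2)) \<noteq> \<infinity>"
    using meas by (intro nn_integral_PInf_AE borel_measurable_suminf) auto
  then show ?thesis
  proof eventually_elim
    case (elim \<omega>)
    then have "summable (\<lambda>q. (norm (D q \<omega>))\<^sup>2)"
      by (intro summable_suminf_not_top) auto
    then have "(\<lambda>q. (norm (D q \<omega>))\<^sup>2) \<longlonglongrightarrow> 0" by (rule summable_LIMSEQ_zero)
    then have "(\<lambda>q. sqrt ((norm (D q \<omega>))\<^sup>2)) \<longlonglongrightarrow> sqrt 0" by (intro tendsto_real_sqrt)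
    then show ?case by (simp add: tendsto_norm_zero_iff)
  qed
qed

lemma trace_prod_mset: "mset L = mset L' \<Longrightarrow> trace_prod N X L = trace_prod N X L'"
  unfolding trace_prod_def by (metis mset_map prod_mset_prod_list)

lemma average_linear:
  fixes a :: "'s \<Rightarrow> complex"
  shows "(\<Sum>\<sigma>\<in>Q. k * a \<sigma> + (\<Sum>x\<leftarrow>xs. b \<sigma> x) + (\<Sum>y\<leftarrow>ys. d \<sigma> y) / m) / c =
    k * ((\<Sum>\<sigma>\<in>Q. a \<sigma>) / c) + (\<Sum>x\<leftarrow>xs. (\<Sum>\<sigma>\<in>Q. b \<sigma> x) / c) + (\<Sum>y\<leftarrow>ys. (\<Sum>\<sigma>\<in>Q. d \<sigma> y) / c) / m"
proof -
  have "(\<Sum>x\<leftarrow>xs. (\<Sum>\<sigma>\<in>Q. b \<sigma> x) / c) = (\<Sum>\<sigma>\<in>Q. \<Sum>x\<leftarrow>xs. b \<sigma> x) / c" for xs :: "'x list" and b :: "'s \<Rightarrow> 'x \<Rightarrow> complex"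
    by (simp add: divide_inverse sum_list_mult_const sum_list_swap_sum)
  from this[of b xs] this[of d ys] show ?thesis
    by (simp add: sum.distrib sum_distrib_left sum_divide_distrib add_divide_distrib mult.commute)
qed

text \<open>
  The Ginibre and the Wishart model are instances; \<open>H\<close>, \<open>Z\<close>, \<open>\<kappa>\<close> describe the Schwinger-Dyson
  equation, which holds for fixed permutations and survives averaging over them.
\<close>

lemma almost_sure_convergence:
  fixes P :: "'w measure" and J :: "nat set" and n :: "nat \<Rightarrow> nat"
    and U Y :: "nat \<Rightarrow> nat \<Rightarrow> 'w \<Rightarrow> complex mat"
    and \<psi> :: "((nat + nat) \<times> bool) list \<Rightarrow> complex"
  defines "V \<equiv> (J <+> J) \<times> (UNIV :: bool set)"
  defines "T\<sigma> \<equiv> \<lambda>q \<sigma> L. \<integral>\<omega>. trace_prod (n q) (model_entry \<sigma> (\<lambda>r. Y q r \<omega>)) L \<partial>P"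
  assumes P: "prob_space P" and J: "finite J" and n: "strict_mono n" "\<And>q. n q \<ge> 1"
    and U: "\<And>q r. r \<in> J \<Longrightarrow> uniform_permutation_mat P (n q) (U q r)"
    and Y: "\<And>q r \<omega>. Y q r \<omega> \<in> carrier_mat (n q) (n q)"
    and indep: "\<And>q. prob_space.indep_vars P (\<lambda>_. mat_borel (n q) (n q)) (case_sum (U q) (Y q)) (J <+> J)"
    and int: "\<And>q \<sigma> L. L \<in> lists (lists V) \<Longrightarrow> integrable P (\<lambda>\<omega>. trace_prod (n q) (model_entry \<sigma> (\<lambda>r. Y q r \<omega>)) L)"
    and sd: "\<And>q \<sigma> l A L. l \<in> V \<Longrightarrow> \<not> isl (fst l) \<Longrightarrow> A \<in> lists V \<Longrightarrow> L \<in> lists (lists V) \<Longrightarrow>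
      T\<sigma> q \<sigma> ((l # A) # L) = \<kappa> q l * T\<sigma> q \<sigma> (A # L) +
        (\<Sum>(B, C)\<leftarrow>splits (H l) A. T\<sigma> q \<sigma> ((Z l @ B) # C # L)) +
        (\<Sum>(v, L')\<leftarrow>splits_list (H l) L. T\<sigma> q \<sigma> ((Z l @ A @ v) # L')) / of_nat (n q) ^ 2"
    and Z: "\<And>l. l \<in> V \<Longrightarrow> \<not> isl (fst l) \<Longrightarrow> set (Z l) \<subseteq> V" "\<And>l. length (Z l) \<le> 1"
    and H: "\<And>h l. h \<in> H l \<Longrightarrow> \<not> isl (fst h)"
    and \<kappa>: "\<And>l. l \<in> V \<Longrightarrow> \<not> isl (fst l) \<Longrightarrow> (\<lambda>q. \<kappa> q l) \<longlonglongrightarrow> \<kappa>' l"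
    and \<psi>_rotate: "\<And>v w. \<psi> (v @ w) = \<psi> (w @ v)"
    and \<psi>_sd: "\<And>l A. l \<in> V \<Longrightarrow> \<not> isl (fst l) \<Longrightarrow> A \<in> lists V \<Longrightarrow>
      \<psi> (l # A) = \<kappa>' l * \<psi> A + (\<Sum>(B, C)\<leftarrow>splits (H l) A. \<psi> (Z l @ B) * \<psi> C)"
    and \<psi>_perm: "\<And>v. fst ` set v \<subseteq> J \<Longrightarrow> \<exists>v'. fst ` set v' \<subseteq> J \<and> cyclically_reduced v' \<and>
      (\<forall>N \<sigma>. (\<forall>r\<in>J. \<sigma> r permutes {..<N}) \<longrightarrow> fixed_count N \<sigma> v = fixed_count N \<sigma> v') \<and>
      \<psi> (map (apfst Inl) v) = (if v' = [] then 1 else 0)"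
    and \<alpha>: "\<alpha> \<in> lists V"
  shows "AE \<omega> in P. (\<lambda>q. normalized_trace (n q) (eval_monomial_mat (n q) (\<lambda>i. case_sum (U q) (Y q) i \<omega>) \<alpha>))
    \<longlonglongrightarrow> \<psi> \<alpha>"
proof -
  interpret P: prob_space P by fact
  let ?Q = "\<lambda>q. J \<rightarrow>\<^sub>E {\<sigma>. \<sigma> permutes {..<n q}}"
  \<comment> \<open>For words in \<open>V\<close> these averages are the expectations belonging to
    the random matrices, as the fact \<open>E\<close> below shows.\<close>
  define T where "T q L = (\<Sum>\<sigma>\<in>?Q q. T\<sigma> q \<sigma> L) / fact (n q) ^ card J" for q L
  have n_ge: "q \<le> n q" for q using n(1) by (rule strict_mono_imp_increasing)
  have n_lim: "filterlim n at_top sequentially" using n(1) by (rule filterlim_subseq)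
  define a where "a q vs = perm_avg J (n q) (\<lambda>\<sigma>. \<Prod>v\<leftarrow>vs. fixed_ratio (n q) \<sigma> v)" for q and vs :: "(nat \<times> bool) list list"
  have T_perm: "T q (map (map (apfst Inl)) vs) = of_real (a q vs)" if vs: "\<And>v. v \<in> set vs \<Longrightarrow> fst ` set v \<subseteq> J" for q vs
  proof -
    have "T\<sigma> q \<sigma> (map (map (apfst Inl)) vs) = of_real (\<Prod>v\<leftarrow>vs. fixed_ratio (n q) \<sigma> v)" if \<sigma>: "\<sigma> \<in> ?Q q" for \<sigma>
    proof -
      have "trace_prod (n q) (model_entry \<sigma> Y') (map (map (apfst Inl)) vs) = of_real (\<Prod>v\<leftarrow>vs. fixed_ratio (n q) \<sigma> v)" for Y'
        using vs
      proof (induction vs)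
        case (Cons v vs)
        have "word_trace (n q) (model_entry \<sigma> Y') (map (apfst Inl) v) = of_nat (fixed_count (n q) \<sigma> v) / of_nat (n q)"
          using \<sigma> Cons.prems[of v] by (intro word_trace_perm) (auto simp: PiE_iff)
        then show ?case using Cons by (simp add: fixed_ratio_def)
      qed simp
      then show ?thesis by (simp add: T\<sigma>_def P.prob_space)
    qed
    then show ?thesis by (simp add: T_def a_def perm_avg_def)
  qed
  have perm_words: "\<exists>vs. L = map (map (apfst Inl)) vs \<and> (\<forall>v\<in>set vs. fst ` set v \<subseteq> J)"
    if "L \<in> lists (lists {l\<in>V. \<not> \<not> isl (fst l)})" for L
  proof (intro exI conjI ballI)
    have 1: "map (apfst Inl) (map (apfst projl) w) = w" "fst ` set (map (apfst projl) w) \<subseteq> J" if "w \<in> set L" for w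
    proof -
      have w: "\<forall>l\<in>set w. l \<in> V \<and> isl (fst l)"
        using \<open>w \<in> set L\<close> \<open>L \<in> _\<close> by (auto simp: lists_eq_set)
      have "(apfst Inl \<circ> apfst projl) l = l" if "l \<in> set w" for l
        using w that by (cases l) auto
      then show "map (apfst Inl) (map (apfst projl) w) = w" by (simp add: map_idI)
      show "fst ` set (map (apfst projl) w) \<subseteq> J" using w by (force simp: V_def)
    qed
    have "map (\<lambda>w. map (apfst Inl) (map (apfst projl) w)) L = L" by (rule map_idI) (rule 1)
    then show "L = map (map (apfst Inl)) (map (map (apfst projl)) L)" by (simp add: comp_def)
    show "fst ` set v \<subseteq> J" if "v \<in> set (map (map (apfst projl)) L)" for v
    proof -
      from that obtain w where "w \<in> set L" "v = map (apfst projl) w" by auto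
      then show ?thesis using 1(2)[of w] by simp
    qed
  qed
  \<comment> \<open>\<open>v'\<close> is a reduced form of \<open>v\<close>. It is empty when every
    fixed ratio is 1; otherwise the ratio has mean O(1/N) and the limit is 0.\<close>
  define red where "red v v' \<longleftrightarrow> fst ` set v' \<subseteq> J \<and> cyclically_reduced v' \<and>
      (\<forall>N \<sigma>. (\<forall>r\<in>J. \<sigma> r permutes {..<N}) \<longrightarrow> fixed_count N \<sigma> v = fixed_count N \<sigma> v') \<and>
      \<psi> (map (apfst Inl) v) = (if v' = [] then 1 else 0)" for v v' :: "(nat \<times> bool) list"
  have red_ratio: "fixed_ratio (n q) \<sigma> v = fixed_ratio (n q) \<sigma> v'" if "red v v'" "\<sigma> \<in> ?Q q" for v v' q \<sigma>
    using that by (auto simp: red_def fixed_ratio_def PiE_iff)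
  have red_triv: "fixed_ratio (n q) \<sigma> v = 1" if "red v []" "\<sigma> \<in> ?Q q" for v q \<sigma>
    using red_ratio[OF that] n(2)[of q] by (simp add: fixed_ratio_def fixed_count_def)
  have red_nontriv: "\<exists>C\<ge>0. eventually (\<lambda>q.
        perm_avg J (n q) (\<lambda>\<sigma>. fixed_ratio (n q) \<sigma> v ^ 2) \<le> C / real (n q) ^ 2 \<and>
        perm_avg J (n q) (\<lambda>\<sigma>. fixed_ratio (n q) \<sigma> v) \<le> C / real (n q)) sequentially"
    if "\<exists>v'. v' \<noteq> [] \<and> red v v'" for v
  proof -
    obtain v' where v': "v' \<noteq> []" "red v v'" using \<open>\<exists>v'. _\<close> by blast
    obtain C where C: "C \<ge> 0" "\<forall>N\<ge>4 * length v'. perm_avg J N (\<lambda>\<sigma>. fixed_ratio N \<sigma> v' ^ 2) \<le> C / real N ^ 2 \<and>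
        perm_avg J N (\<lambda>\<sigma>. fixed_ratio N \<sigma> v') \<le> C / real N"
      using perm_avg_fixed_ratio[OF J _ v'(1)] v'(2) by (auto simp: red_def)
    have "perm_avg J (n q) (\<lambda>\<sigma>. fixed_ratio (n q) \<sigma> v ^ 2) = perm_avg J (n q) (\<lambda>\<sigma>. fixed_ratio (n q) \<sigma> v' ^ 2)"
      "perm_avg J (n q) (\<lambda>\<sigma>. fixed_ratio (n q) \<sigma> v) = perm_avg J (n q) (\<lambda>\<sigma>. fixed_ratio (n q) \<sigma> v')" for q
      by (rule perm_avg_cong; simp add: red_ratio[OF v'(2)])+
    moreover have "eventually (\<lambda>q. n q \<ge> 4 * length v') sequentially"
      using n_lim by (simp add: filterlim_at_top)
    ultimately show ?thesis using C by (intro exI[of _ C]) (auto elim: eventually_mono)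
  qed
  have big: "(\<lambda>q. complex_of_real (f q)) \<in> O(\<lambda>q. 1 / of_nat (n q) ^ 2)"
    if "eventually (\<lambda>q. \<bar>f q\<bar> \<le> C / real (n q) ^ 2) sequentially" for f C
    using that by (intro bigoI[of _ C]) (auto elim!: eventually_mono simp: norm_divide norm_power)
  interpret schwinger_dyson V "\<lambda>l. \<not> isl (fst l)" H Z \<kappa> \<kappa>' n T \<psi>
  proof
    show "filterlim n sequentially sequentially" by (rule n_lim)
    show "T q L = T q L'" if "mset L = mset L'" for q L L'
      using trace_prod_mset[OF that] by (simp add: T_def T\<sigma>_def)
    show "T q ((v @ w) # L) = T q ((w @ v) # L)" for q v w L
      by (simp add: T_def T\<sigma>_def word_trace_rotate[of _ _ v w])
    show "T q ((l # A) # L) = \<kappa> q l * T q (A # L) + (\<Sum>(B, C)\<leftarrow>splits (H l) A. T q ((Z l @ B) # C # L)) +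
        (\<Sum>(w, L')\<leftarrow>splits_list (H l) L. T q ((Z l @ A @ w) # L')) / (of_nat (n q))\<^sup>2"
      if "l \<in> V" "\<not> isl (fst l)" "A \<in> lists V" "L \<in> lists (lists V)" for l A L q
      unfolding T_def sd[OF that] case_prod_unfold by (rule average_linear)
    show "(\<lambda>q. T q L) \<in> O(\<lambda>_. 1)" if "L \<in> lists (lists {l\<in>V. \<not> \<not> isl (fst l)})" for L
    proof -
      obtain vs where vs: "L = map (map (apfst Inl)) vs" "\<forall>v\<in>set vs. fst ` set v \<subseteq> J"
        using perm_words[OF \<open>L \<in> _\<close>] by blast
      have "perm_avg J (n q) (\<lambda>_. 0) \<le> a q vs" "a q vs \<le> perm_avg J (n q) (\<lambda>_. 1)" for q
        unfolding a_def by (intro perm_avg_mono prod_fixed_ratio_bounds)+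
      then have "\<bar>a q vs\<bar> \<le> 1" for q using J by (simp add: perm_avg_const abs_le_iff order_trans[of _ 0])
      then show ?thesis using vs T_perm[of vs] by (intro bigoI[of _ 1]) auto
    qed
    show "(\<lambda>q. T q L - (\<Prod>w\<leftarrow>L. T q [w])) \<in> O(\<lambda>q. 1 / of_nat (n q) ^ 2)"
      if "L \<in> lists (lists {l\<in>V. \<not> \<not> isl (fst l)})" for L
    proof -
      obtain vs where vs: "L = map (map (apfst Inl)) vs" "\<forall>v\<in>set vs. fst ` set v \<subseteq> J"
        using perm_words[OF \<open>L \<in> _\<close>] by blast
      have dich: "red v [] \<or> (\<exists>v'. v' \<noteq> [] \<and> red v v')" if "v \<in> set vs" for v
      proof -
        have "fst ` set v \<subseteq> J" using vs(2) that by blast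
        from \<psi>_perm[OF this] obtain v' where "red v v'" unfolding red_def[symmetric] by (rule exE)
        then show ?thesis by (cases "v' = []") auto
      qed
      have n0: "n q > 0" for q using n(2)[of q] by simp
      have "\<exists>C. eventually (\<lambda>q. \<bar>a q vs - (\<Prod>v\<leftarrow>vs. a q [v])\<bar> \<le> C / real (n q) ^ 2) sequentially"
        unfolding a_def
      proof (rule perm_avg_factor[where triv = "\<lambda>v. red v []" and nontriv = "\<lambda>v. \<exists>v'. v' \<noteq> [] \<and> red v v'", OF J n_lim n0])
        show "red v [] \<or> (\<exists>v'. v' \<noteq> [] \<and> red v v')" if "v \<in> set vs" for v by (rule dich[OF that])
        show "fixed_ratio (n q) \<sigma> v = 1" if "red v []" "\<sigma> \<in> ?Q q" for v q \<sigma> by (rule red_triv[OF that])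
        show "\<exists>C\<ge>0. eventually (\<lambda>q.
          perm_avg J (n q) (\<lambda>\<sigma>. fixed_ratio (n q) \<sigma> v ^ 2) \<le> C / real (n q) ^ 2 \<and>
          perm_avg J (n q) (\<lambda>\<sigma>. fixed_ratio (n q) \<sigma> v) \<le> C / real (n q)) sequentially"
          if "\<exists>v'. v' \<noteq> [] \<and> red v v'" for v by (rule red_nontriv[OF that])
      qed
      then obtain C where "eventually (\<lambda>q. \<bar>a q vs - (\<Prod>v\<leftarrow>vs. a q [v])\<bar> \<le> C / real (n q) ^ 2) sequentially"
        by (rule exE)
      from big[OF this] have "(\<lambda>q. complex_of_real (a q vs - (\<Prod>v\<leftarrow>vs. a q [v]))) \<in> O(\<lambda>q. 1 / of_nat (n q) ^ 2)" .
      moreover have "T q L - (\<Prod>w\<leftarrow>L. T q [w]) = of_real (a q vs - (\<Prod>v\<leftarrow>vs. a q [v]))" for q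
      proof -
        have "(\<Prod>w\<leftarrow>map (map (apfst Inl)) vs. T q [w]) = of_real (\<Prod>v\<leftarrow>vs. a q [v])"
          using vs(2)
        proof (induction vs)
          case (Cons v vs)
          then show ?case using T_perm[of "[v]" q] by simp
        qed simp
        then show ?thesis using T_perm[of vs q] vs by simp
      qed
      ultimately show ?thesis by simp
    qed
    show "(\<lambda>q. T q [w]) \<longlonglongrightarrow> \<psi> w" if "w \<in> lists {l\<in>V. \<not> \<not> isl (fst l)}" for w
    proof -
      have "[w] \<in> lists (lists {l\<in>V. \<not> \<not> isl (fst l)})" using \<open>w \<in> _\<close> by simp
      from perm_words[OF this] obtain v where v: "w = map (apfst Inl) v" "fst ` set v \<subseteq> J" by auto
      have T_a: "T q [w] = of_real (a q [v])" for q
        using T_perm[of "[v]" q] v by simp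
      obtain v' where v': "red v v'" using \<psi>_perm[OF v(2)] unfolding red_def[symmetric] by (rule exE)
      have "(\<lambda>q. a q [v]) \<longlonglongrightarrow> (if v' = [] then 1 else 0)"
      proof (cases "v' = []")
        case True
        then have "a q [v] = perm_avg J (n q) (\<lambda>_. 1)" for q
          unfolding a_def using red_triv[of v] v' by (intro perm_avg_cong) simp
        then show ?thesis using True J by (simp add: perm_avg_const)
      next
        case False
        then obtain C where C: "eventually (\<lambda>q.
            perm_avg J (n q) (\<lambda>\<sigma>. fixed_ratio (n q) \<sigma> v ^ 2) \<le> C / real (n q) ^ 2 \<and>
            perm_avg J (n q) (\<lambda>\<sigma>. fixed_ratio (n q) \<sigma> v) \<le> C / real (n q)) sequentially"
          using red_nontriv v' by blast
        have "perm_avg J (n q) (\<lambda>_. 0) \<le> a q [v]" for q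
          unfolding a_def using fixed_ratio_bounds by (intro perm_avg_mono) simp
        then have "0 \<le> a q [v]" for q using J by (simp add: perm_avg_const)
        then have "eventually (\<lambda>q. norm (a q [v]) \<le> C / real (n q)) sequentially"
          using C by (auto elim!: eventually_mono simp: a_def)
        moreover have "(\<lambda>q. C / real (n q)) \<longlonglongrightarrow> 0"
          using filterlim_compose[OF filterlim_real_sequentially n_lim]
          by (intro tendsto_divide_0[OF tendsto_const] filterlim_at_top_imp_at_infinity)
        ultimately show ?thesis using False by (simp add: Lim_null_comparison)
      qed
      then have "(\<lambda>q. complex_of_real (a q [v])) \<longlonglongrightarrow> of_real (if v' = [] then 1 else 0)"
        by (rule tendsto_of_real)
      then show ?thesis using v' v(1) unfolding T_a red_def by (auto split: if_splits)
    qed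
  qed (use Z H \<kappa> \<psi>_rotate \<psi>_sd in auto)
  let ?E = "\<lambda>q \<omega> i x y. case_sum (U q) (Y q) i \<omega> $$ (x, y)"
  have E: "integrable P (\<lambda>\<omega>. trace_prod (n q) (?E q \<omega>) L)"
    "(\<integral>\<omega>. trace_prod (n q) (?E q \<omega>) L \<partial>P) = T q L" if "L \<in> lists (lists V)" for q L
  proof -
    note * = P.expectation_trace_prod_permutations[OF J U indep, of L q]
    show "integrable P (\<lambda>\<omega>. trace_prod (n q) (?E q \<omega>) L)"
      using that int[OF that] by (intro *(1)) (auto simp: V_def model_entry_def)
    show "(\<integral>\<omega>. trace_prod (n q) (?E q \<omega>) L \<partial>P) = T q L"
      unfolding T_def T\<sigma>_def model_entry_def
      using that int[OF that] by (intro *(2)) (auto simp: V_def model_entry_def)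
  qed
  \<comment> \<open>The conjugate of a trace is the trace of the adjoint word, so the squared
    modulus is a product of two traces and the variance is a factorization error.\<close>
  define \<beta> where "\<beta> = adjoint_word \<alpha>"
  have \<beta>: "\<beta> \<in> lists V" using \<alpha> by (auto simp: \<beta>_def adjoint_word_def V_def lists_eq_set)
  define tr where "tr q \<omega> = word_trace (n q) (?E q \<omega>) \<alpha>" for q \<omega>
  have cnj_tr: "cnj (tr q \<omega>) = word_trace (n q) (?E q \<omega>) \<beta>" for q \<omega>
    by (simp add: tr_def \<beta>_def cnj_word_trace)
  have tr1: "integrable P (tr q)" "integral\<^sup>L P (tr q) = T q [\<alpha>]" for q
    using E[of "[\<alpha>]" q] \<alpha> by (simp_all add: tr_def[abs_def])
  have tr2: "integrable P (\<lambda>\<omega>. cnj (tr q \<omega>))" "(\<integral>\<omega>. cnj (tr q \<omega>) \<partial>P) = T q [\<beta>]" for q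
    using E[of "[\<beta>]" q] \<beta> by (simp_all add: cnj_tr)
  have tr3: "integrable P (\<lambda>\<omega>. tr q \<omega> * cnj (tr q \<omega>))" "(\<integral>\<omega>. tr q \<omega> * cnj (tr q \<omega>) \<partial>P) = T q [\<alpha>, \<beta>]" for q
    using E[of "[\<alpha>, \<beta>]" q] \<alpha> \<beta> by (simp_all add: cnj_tr) (simp_all add: tr_def)
  have cnj_T: "cnj (T q [\<alpha>]) = T q [\<beta>]" for q
    unfolding tr1(2)[symmetric] tr2(2)[symmetric]
    by (rule integral_bounded_linear[OF bounded_linear_cnj tr1(1), symmetric])
  define D where "D q \<omega> = tr q \<omega> - T q [\<alpha>]" for q \<omega>
  have D2: "complex_of_real ((norm (D q \<omega>))\<^sup>2) =
      tr q \<omega> * cnj (tr q \<omega>) - T q [\<alpha>] * cnj (tr q \<omega>) - T q [\<beta>] * tr q \<omega> + T q [\<alpha>] * T q [\<beta>]" for q \<omega>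
    unfolding complex_norm_square D_def by (simp add: cnj_T algebra_simps)
  have intD: "integrable P (\<lambda>\<omega>. complex_of_real ((norm (D q \<omega>))\<^sup>2))" for q
    unfolding D2 using tr1(1) tr2(1) tr3(1) by (intro Bochner_Integration.integrable_add Bochner_Integration.integrable_diff
      integrable_mult_right) auto
  have intD': "integrable P (\<lambda>\<omega>. (norm (D q \<omega>))\<^sup>2)" for q
    using integrable_Re[OF intD, of q] by simp
  have ED: "complex_of_real (\<integral>\<omega>. (norm (D q \<omega>))\<^sup>2 \<partial>P) = T q [\<alpha>, \<beta>] - T q [\<alpha>] * T q [\<beta>]" for q
  proof -
    have "complex_of_real (\<integral>\<omega>. (norm (D q \<omega>))\<^sup>2 \<partial>P) = (\<integral>\<omega>. complex_of_real ((norm (D q \<omega>))\<^sup>2) \<partial>P)"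
      by (rule integral_complex_of_real[symmetric])
    also have "\<dots> = T q [\<alpha>, \<beta>] - T q [\<alpha>] * T q [\<beta>] - T q [\<beta>] * T q [\<alpha>] + T q [\<alpha>] * T q [\<beta>]"
      unfolding D2 using tr1 tr2 tr3 by (simp add: P.prob_space)
    finally show ?thesis by simp
  qed
  have "summable (\<lambda>q. \<integral>\<omega>. (norm (D q \<omega>))\<^sup>2 \<partial>P)"
  proof -
    have "(\<lambda>q. T q [\<alpha>, \<beta>] - T q [\<alpha>] * T q [\<beta>]) \<in> O(\<lambda>q. 1 / of_nat (n q) ^ 2)"
      using T_factor[of "[\<alpha>, \<beta>]"] \<alpha> \<beta> by simp
    then obtain C where C: "C > 0" "eventually (\<lambda>q. norm (T q [\<alpha>, \<beta>] - T q [\<alpha>] * T q [\<beta>]) \<le>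
        C * norm (1 / of_nat (n q) ^ 2 :: complex)) sequentially"
      by (elim landau_o.bigE)
    have "eventually (\<lambda>q. norm (\<integral>\<omega>. (norm (D q \<omega>))\<^sup>2 \<partial>P) \<le> C * inverse (real q ^ 2)) sequentially"
      using C(2) eventually_gt_at_top[of 0]
    proof eventually_elim
      case (elim q)
      have "norm (\<integral>\<omega>. (norm (D q \<omega>))\<^sup>2 \<partial>P) = norm (complex_of_real (\<integral>\<omega>. (norm (D q \<omega>))\<^sup>2 \<partial>P))" by simp
      also have "\<dots> \<le> C * (1 / real (n q) ^ 2)"
        using elim(1) unfolding ED by (simp add: norm_divide norm_power)
      \<comment> \<open>A strictly increasing sequence of naturals satisfies
        \<open>n q \<ge> q\<close>; this turns the bound in the matrix size into a summable one in
        q.\<close>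
      also have "\<dots> \<le> C * inverse (real q ^ 2)"
        using C(1) elim(2) n_ge[of q]
        by (auto simp: inverse_eq_divide intro!: mult_left_mono divide_left_mono power_mono)
      finally show ?case .
    qed
    moreover have "summable (\<lambda>q. C * inverse (real q ^ 2))"
      by (intro summable_mult inverse_power_summable) simp
    ultimately show ?thesis by (rule summable_comparison_test_ev)
  qed
  from P.AE_tendsto_0_of_second_moments[OF intD' this] have "AE \<omega> in P. (\<lambda>q. D q \<omega>) \<longlonglongrightarrow> 0" .
  then show ?thesis
    using AE_space
  proof eventually_elim
    case (elim \<omega>)
    have "normalized_trace (n q) (eval_monomial_mat (n q) (\<lambda>i. case_sum (U q) (Y q) i \<omega>) \<alpha>) = tr q \<omega>" for q
      unfolding tr_def
    proof (rule normalized_trace_eval_monomial_mat)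
      fix i assume "i \<in> fst ` set \<alpha>"
      then have i: "i \<in> J <+> J" using \<alpha> by (force simp: V_def lists_eq_set)
      show "case_sum (U q) (Y q) i \<omega> \<in> carrier_mat (n q) (n q)"
      proof (cases i)
        case (Inl r)
        then have "U q r \<in> measurable P (count_space (permutation_mats (n q)))"
          using i U[of r q] by (auto simp: uniform_permutation_mat_def)
        from measurable_space[OF this elim(2)] show ?thesis
          using Inl by (auto simp: permutation_mats_eq perm_mat_carrier)
      qed (simp add: Y)
    qed
    moreover have "(\<lambda>q. D q \<omega> + T q [\<alpha>]) \<longlonglongrightarrow> 0 + \<psi> \<alpha>"
      using elim(1) T_tendsto[OF \<alpha>] by (rule tendsto_add)
    ultimately show ?case by (simp add: D_def)
  qed
qed

section \<open>The limits of the two models\<close>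

lemma (in tracial_star_prob_space) haar_word_limit:
  assumes free: "star_free scaleC star \<phi> (case_sum u g) (J <+> J)"
    and haar: "\<And>r. r \<in> J \<Longrightarrow> haar_unitary star \<phi> (u r)" and v: "fst ` set v \<subseteq> J"
  shows "\<exists>v'. fst ` set v' \<subseteq> J \<and> cyclically_reduced v' \<and>
    (\<forall>N \<sigma>. (\<forall>r\<in>J. \<sigma> r permutes {..<N}) \<longrightarrow> fixed_count N \<sigma> v = fixed_count N \<sigma> v') \<and>
    \<phi> (eval_monomial star (case_sum u g) (map (apfst Inl) v)) = (if v' = [] then 1 else 0)"
proof -
  obtain v' where v': "fst ` set v' \<subseteq> J" "cyclically_reduced v'"
    "\<forall>N \<sigma>. (\<forall>r\<in>J. \<sigma> r permutes {..<N}) \<longrightarrow> fixed_count N \<sigma> v = fixed_count N \<sigma> v'"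
    "\<phi> (eval_monomial star u v) = \<phi> (eval_monomial star u v')"
    using cyclic_reduction[of J u v, OF haar v] by blast
  have "eval_monomial star (case_sum u g) (map (apfst Inl) v) = eval_monomial star u v"
    by (induction v) auto
  moreover have "\<phi> (eval_monomial star u v') = (if v' = [] then 1 else 0)"
    using state_cyclically_reduced[OF free haar v'(1) _ v'(2)] by (auto simp: state_one)
  ultimately show ?thesis using v' by (intro exI[of _ v']) simp
qed

theorem theorem4p3:
  fixes s :: nat and c :: real
    and P :: "'w measure"
    and f :: "nat \<Rightarrow> nat \<Rightarrow> nat \<Rightarrow> 'w \<Rightarrow> complex"
    and U :: "nat \<Rightarrow> nat \<Rightarrow> 'w \<Rightarrow> complex mat"
    and scaleC :: "complex \<Rightarrow> 'a::ring_1 \<Rightarrow> 'a"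
    and star :: "'a \<Rightarrow> 'a"
    and \<phi> :: "'a \<Rightarrow> complex"
    and u g w :: "nat \<Rightarrow> 'a"
  assumes "s \<ge> 1" and "c > 0"
    and "prob_space P"
    and "\<And>r i j. r \<in> {1..s} \<Longrightarrow> complex_std_gaussian P (f r i j)"
    and "prob_space.indep_vars P (\<lambda>_. borel) (\<lambda>(r, i, j). f r i j) ({1..s} \<times> UNIV \<times> UNIV)"
    and "\<And>N r. N \<ge> 1 \<Longrightarrow> r \<in> {1..s} \<Longrightarrow> uniform_permutation_mat P N (U N r)"
    and "\<And>N. N \<ge> 1 \<Longrightarrow>
      prob_space.indep_vars P (\<lambda>_. mat_borel N N) (case_sum (U N) (ginibre_mat f N)) ({1..s} <+> {1..s})"
    and "\<And>M N. M \<ge> 1 \<Longrightarrow> N \<ge> 1 \<Longrightarrow>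
      prob_space.indep_vars P (\<lambda>_. mat_borel N N) (case_sum (U N) (wishart_mat f M N)) ({1..s} <+> {1..s})"
    and "tracial_star_prob_space scaleC star \<phi>"
    and "\<And>r. r \<in> {1..s} \<Longrightarrow> haar_unitary star \<phi> (u r)"
    and "\<And>r. r \<in> {1..s} \<Longrightarrow> standard_circular star \<phi> (g r)"
    and "\<And>r. r \<in> {1..s} \<Longrightarrow> free_poisson star \<phi> c (w r)"
    and "star_free scaleC star \<phi> (case_sum u g) ({1..s} <+> {1..s})"
    and "star_free scaleC star \<phi> (case_sum u w) ({1..s} <+> {1..s})"
  shows "\<forall>Mq Nq :: nat \<Rightarrow> nat.
    strict_mono Mq \<and> strict_mono Nq \<and> (\<forall>q. Mq q \<ge> 1 \<and> Nq q \<ge> 1) \<and>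
    (\<lambda>q. real (Mq q) / real (Nq q)) \<longlonglongrightarrow> c \<longrightarrow>
    (\<forall>\<alpha> \<in> lists (({1..s} <+> {1..s}) \<times> UNIV).
      (AE \<omega> in P.
        (\<lambda>q. normalized_trace (Nq q)
          (eval_monomial_mat (Nq q) (\<lambda>i. case_sum (U (Nq q)) (ginibre_mat f (Nq q)) i \<omega>) \<alpha>))
        \<longlonglongrightarrow> \<phi> (eval_monomial star (case_sum u g) \<alpha>)) \<and>
      (AE \<omega> in P.
        (\<lambda>q. normalized_trace (Nq q)
          (eval_monomial_mat (Nq q) (\<lambda>i. case_sum (U (Nq q)) (wishart_mat f (Mq q) (Nq q)) i \<omega>) \<alpha>))
        \<longlonglongrightarrow> \<phi> (eval_monomial star (case_sum u w) \<alpha>)))"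
proof (intro allI impI ballI)
  fix Mq Nq :: "nat \<Rightarrow> nat" and \<alpha> :: "((nat + nat) \<times> bool) list"
  assume seq: "strict_mono Mq \<and> strict_mono Nq \<and> (\<forall>q. Mq q \<ge> 1 \<and> Nq q \<ge> 1) \<and>
    (\<lambda>q. real (Mq q) / real (Nq q)) \<longlonglongrightarrow> c"
    and \<alpha>: "\<alpha> \<in> lists (({1..s} <+> {1..s}) \<times> UNIV)"
  let ?J = "{1..s}"
  let ?V = "(?J <+> ?J) \<times> (UNIV :: bool set)"
  interpret tracial_star_prob_space scaleC star \<phi> by fact
  have gauss: "gaussian_family P (\<lambda>(r, i, j). f r i j) (?J \<times> UNIV \<times> UNIV)"
    using assms(3-5) by (intro gaussian_family.intro gaussian_family_axioms.intro) auto
  have Nq: "strict_mono Nq" "Nq q \<ge> 1" "Nq q > 0" and Mq: "Mq q > 0" for q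
    using seq by (auto simp: Suc_le_eq)
  have ratio: "(\<lambda>q. of_nat (Mq q) / of_nat (Nq q)) \<longlonglongrightarrow> complex_of_real c"
    using seq tendsto_of_real[where 'a = complex, of "\<lambda>q. real (Mq q) / real (Nq q)" c] by simp
  show "(AE \<omega> in P.
        (\<lambda>q. normalized_trace (Nq q)
          (eval_monomial_mat (Nq q) (\<lambda>i. case_sum (U (Nq q)) (ginibre_mat f (Nq q)) i \<omega>) \<alpha>))
        \<longlonglongrightarrow> \<phi> (eval_monomial star (case_sum u g) \<alpha>)) \<and>
      (AE \<omega> in P.
        (\<lambda>q. normalized_trace (Nq q)
          (eval_monomial_mat (Nq q) (\<lambda>i. case_sum (U (Nq q)) (wishart_mat f (Mq q) (Nq q)) i \<omega>) \<alpha>))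
        \<longlonglongrightarrow> \<phi> (eval_monomial star (case_sum u w) \<alpha>))"
  proof
    show "AE \<omega> in P. (\<lambda>q. normalized_trace (Nq q)
          (eval_monomial_mat (Nq q) (\<lambda>i. case_sum (U (Nq q)) (ginibre_mat f (Nq q)) i \<omega>) \<alpha>))
        \<longlonglongrightarrow> \<phi> (eval_monomial star (case_sum u g) \<alpha>)"
    \<comment> \<open>Ginibre letters have no self-contraction and leave no letter behind, which
      gives the zero coefficients and the empty word.\<close>
    proof (rule almost_sure_convergence[where J = ?J and n = Nq and U = "\<lambda>q. U (Nq q)" and Y = "\<lambda>q. ginibre_mat f (Nq q)"
          and \<psi> = "\<lambda>v. \<phi> (eval_monomial star (case_sum u g) v)" and H = ginibre_dual and Z = "\<lambda>_. []"
          and \<kappa> = "\<lambda>_ _. 0" and \<kappa>' = "\<lambda>_. 0", OF assms(3) finite_atLeastAtMost Nq(1) Nq(2)])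
      show "uniform_permutation_mat P (Nq q) (U (Nq q) r)" if "r \<in> ?J" for q r
        using assms(6)[OF Nq(2) that] .
      show "ginibre_mat f (Nq q) r \<omega> \<in> carrier_mat (Nq q) (Nq q)" for q r \<omega>
        by (simp add: ginibre_mat_def gaussian_mat_def)
      show "prob_space.indep_vars P (\<lambda>_. mat_borel (Nq q) (Nq q)) (case_sum (U (Nq q)) (ginibre_mat f (Nq q))) (?J <+> ?J)" for q
        by (rule assms(7)[OF Nq(2)])
      show "\<phi> (eval_monomial star (case_sum u g) (v @ v')) = \<phi> (eval_monomial star (case_sum u g) (v' @ v))" for v v'
        by (simp add: state_trace)
      show "integrable P (\<lambda>\<omega>. trace_prod (Nq q) (model_entry \<sigma> (\<lambda>r. ginibre_mat f (Nq q) r \<omega>)) L)"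
        if "L \<in> lists (lists ?V)" for q \<sigma> L
        \<comment> \<open>Any Gaussian letter will do to instantiate the lemma; index 1 exists
          because \<open>s \<ge> 1\<close>.\<close>
        by (rule ginibre_schwinger_dyson(2)[OF gauss Nq(3) _ _ _ _ that, where l = "(Inr 1, False)" and A = "[]" and L = "[]"])
          (use assms(1) in auto)
      show "(\<integral>\<omega>. trace_prod (Nq q) (model_entry \<sigma> (\<lambda>r. ginibre_mat f (Nq q) r \<omega>)) ((l # A) # L) \<partial>P) =
          0 * (\<integral>\<omega>. trace_prod (Nq q) (model_entry \<sigma> (\<lambda>r. ginibre_mat f (Nq q) r \<omega>)) (A # L) \<partial>P) +
          (\<Sum>(B, C)\<leftarrow>splits (ginibre_dual l) A.
            \<integral>\<omega>. trace_prod (Nq q) (model_entry \<sigma> (\<lambda>r. ginibre_mat f (Nq q) r \<omega>)) (([] @ B) # C # L) \<partial>P) +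
          (\<Sum>(v, L')\<leftarrow>splits_list (ginibre_dual l) L.
            \<integral>\<omega>. trace_prod (Nq q) (model_entry \<sigma> (\<lambda>r. ginibre_mat f (Nq q) r \<omega>)) (([] @ A @ v) # L') \<partial>P) / of_nat (Nq q) ^ 2"
        if "l \<in> ?V" "\<not> isl (fst l)" "A \<in> lists ?V" "L \<in> lists (lists ?V)" for q \<sigma> l A L
        using ginibre_schwinger_dyson(1)[OF gauss Nq(3) that] by (simp del: trace_prod_simps)
      show "\<phi> (eval_monomial star (case_sum u g) (l # A)) = 0 * \<phi> (eval_monomial star (case_sum u g) A) +
          (\<Sum>(B, C)\<leftarrow>splits (ginibre_dual l) A.
            \<phi> (eval_monomial star (case_sum u g) ([] @ B)) * \<phi> (eval_monomial star (case_sum u g) C))"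
        if "l \<in> ?V" "\<not> isl (fst l)" "A \<in> lists ?V" for l A
        using circular_family_schwinger_dyson[OF assms(13) assms(11) that] by simp
      show "\<exists>v'. fst ` set v' \<subseteq> ?J \<and> cyclically_reduced v' \<and>
          (\<forall>N \<sigma>. (\<forall>r\<in>?J. \<sigma> r permutes {..<N}) \<longrightarrow> fixed_count N \<sigma> v = fixed_count N \<sigma> v') \<and>
          \<phi> (eval_monomial star (case_sum u g) (map (apfst Inl) v)) = (if v' = [] then 1 else 0)"
        if "fst ` set v \<subseteq> ?J" for v
        by (rule haar_word_limit[OF assms(13) assms(10) that])
    qed (use \<alpha> in \<open>auto simp: ginibre_dual_def split: if_splits\<close>)
    show "AE \<omega> in P. (\<lambda>q. normalized_trace (Nq q)
          (eval_monomial_mat (Nq q) (\<lambda>i. case_sum (U (Nq q)) (wishart_mat f (Mq q) (Nq q)) i \<omega>) \<alpha>))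
        \<longlonglongrightarrow> \<phi> (eval_monomial star (case_sum u w) \<alpha>)"
    \<comment> \<open>The coefficient M/N tends to c, the common value of the free Poisson
      cumulants; this is where the ratio of the two sequences enters.\<close>
    proof (rule almost_sure_convergence[where J = ?J and n = Nq and U = "\<lambda>q. U (Nq q)" and Y = "\<lambda>q. wishart_mat f (Mq q) (Nq q)"
          and \<psi> = "\<lambda>v. \<phi> (eval_monomial star (case_sum u w) v)" and H = wishart_dual and Z = "\<lambda>l. [(fst l, False)]"
          and \<kappa> = "\<lambda>q _. of_nat (Mq q) / of_nat (Nq q)" and \<kappa>' = "\<lambda>_. of_real c", OF assms(3) finite_atLeastAtMost Nq(1) Nq(2)])
      show "uniform_permutation_mat P (Nq q) (U (Nq q) r)" if "r \<in> ?J" for q r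
        using assms(6)[OF Nq(2) that] .
      show "wishart_mat f (Mq q) (Nq q) r \<omega> \<in> carrier_mat (Nq q) (Nq q)" for q r \<omega>
      proof -
        have G: "gaussian_mat f (Mq q) (Nq q) r \<omega> \<in> carrier_mat (Mq q) (Nq q)" by (simp add: gaussian_mat_def)
        show ?thesis
          unfolding wishart_mat_def using mult_carrier_mat[OF mat_adjoint_carrier[OF G] G] by (rule smult_carrier_mat)
      qed
      show "prob_space.indep_vars P (\<lambda>_. mat_borel (Nq q) (Nq q)) (case_sum (U (Nq q)) (wishart_mat f (Mq q) (Nq q))) (?J <+> ?J)" for q
        using Mq[of q] by (intro assms(8) Nq(2)) simp
      show "\<phi> (eval_monomial star (case_sum u w) (v @ v')) = \<phi> (eval_monomial star (case_sum u w) (v' @ v))" for v v'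
        by (simp add: state_trace)
      show "integrable P (\<lambda>\<omega>. trace_prod (Nq q) (model_entry \<sigma> (\<lambda>r. wishart_mat f (Mq q) (Nq q) r \<omega>)) L)"
        if "L \<in> lists (lists ?V)" for q \<sigma> L
        by (rule wishart_schwinger_dyson(2)[OF gauss Nq(3) Mq _ _ _ _ that, where l = "(Inr 1, False)" and A = "[]" and L = "[]"])
          (use assms(1) in auto)
      show "(\<integral>\<omega>. trace_prod (Nq q) (model_entry \<sigma> (\<lambda>r. wishart_mat f (Mq q) (Nq q) r \<omega>)) ((l # A) # L) \<partial>P) =
          of_nat (Mq q) / of_nat (Nq q) *
            (\<integral>\<omega>. trace_prod (Nq q) (model_entry \<sigma> (\<lambda>r. wishart_mat f (Mq q) (Nq q) r \<omega>)) (A # L) \<partial>P) +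
          (\<Sum>(B, C)\<leftarrow>splits (wishart_dual l) A.
            \<integral>\<omega>. trace_prod (Nq q) (model_entry \<sigma> (\<lambda>r. wishart_mat f (Mq q) (Nq q) r \<omega>)) (([(fst l, False)] @ B) # C # L) \<partial>P) +
          (\<Sum>(v, L')\<leftarrow>splits_list (wishart_dual l) L.
            \<integral>\<omega>. trace_prod (Nq q) (model_entry \<sigma> (\<lambda>r. wishart_mat f (Mq q) (Nq q) r \<omega>)) (([(fst l, False)] @ A @ v) # L') \<partial>P) / of_nat (Nq q) ^ 2"
        if "l \<in> ?V" "\<not> isl (fst l)" "A \<in> lists ?V" "L \<in> lists (lists ?V)" for q \<sigma> l A L
        using wishart_schwinger_dyson(1)[OF gauss Nq(3) Mq that] by (simp del: trace_prod_simps)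
      show "\<phi> (eval_monomial star (case_sum u w) (l # A)) = of_real c * \<phi> (eval_monomial star (case_sum u w) A) +
          (\<Sum>(B, C)\<leftarrow>splits (wishart_dual l) A.
            \<phi> (eval_monomial star (case_sum u w) ([(fst l, False)] @ B)) * \<phi> (eval_monomial star (case_sum u w) C))"
        if "l \<in> ?V" "\<not> isl (fst l)" "A \<in> lists ?V" for l A
        using free_poisson_family_schwinger_dyson[OF assms(14) assms(12) that] by simp
      show "\<exists>v'. fst ` set v' \<subseteq> ?J \<and> cyclically_reduced v' \<and>
          (\<forall>N \<sigma>. (\<forall>r\<in>?J. \<sigma> r permutes {..<N}) \<longrightarrow> fixed_count N \<sigma> v = fixed_count N \<sigma> v') \<and>
          \<phi> (eval_monomial star (case_sum u w) (map (apfst Inl) v)) = (if v' = [] then 1 else 0)"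
        if "fst ` set v \<subseteq> ?J" for v
        by (rule haar_word_limit[OF assms(14) assms(10) that])
    qed (use \<alpha> ratio in \<open>auto simp: wishart_dual_def split: if_splits\<close>)
  qed
qed

end
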